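(* Let $\mathbb{K}\in\{\mathbb{R},\mathbb{C}\}$. Let $\mathbb{M}$ and $\mathbb{P}$ be initial subsets of $\mathbb{N}$ with $\mathbb{M}\subset\mathbb{P}$, let $(p_n)_{n\in\mathbb{P}}$ be a $\mathbb{P}$-compatible sequence, let $(\mathscr{A}_i)_{i\in\mathbb{M}}$ be a partition of $\{p_n:n\in\mathbb{P}\}$, and let $q_n:=\sum_{k\in\mathscr{A}_n}k$ for every $n\in\mathbb{M}$ (with $q_n=\infty$ if $\mathscr{A}_n$ is infinite). For each $n\in\mathbb{M}$, let $K_n$ be a separable nonempty compact Hausdorff space and let $\kappa_n$ be a cardinal with $\aleph_0\le\kappa_n\le\mathfrak{c}$. Assume also that $K_n^{\kappa_n}\ne K_k^{\kappa_k}$ whenever $n\ne k$, $n,k\in\mathbb{M}$. Let $N:=\mathrm{card}\,\mathbb{P}$ (with $N=\infty$ if $\mathbb{P}$ is infinite). Then there exists a compactification $X$ of the topological sum $$\left(\sum_{n\in\mathbb{M}}\underbrace{K_n^{\kappa_n}+\cdots+K_n^{\kappa_n}}_{q_n}\right)+\mathcal{N}\cup\{\infty\}$$ such that $C(X)$ admits an $N$-generated isometric shift of type $\mathrm{I}_0$. Moreover, if $K_n$ is metrizable and $\kappa_n=\aleph_0$ for every $n\in\mathbb{M}$, then $X$ may be taken to be contained in $\ell^2$, endowed with the norm topology.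
   Context: Initial subsets and compatible sequences. A subset $\mathbb{P}\subset\mathbb{N}=\{1,2,\dots\}$ is an initial subset if $1\in\mathbb{P}$ and $n-1\in\mathbb{P}$ whenever $n\ge2$ and $n\in\mathbb{P}$. A sequence $(p_n)_{n\in\mathbb{P}}$ of natural numbers is $\mathbb{P}$-compatible if: when $\mathbb{P}=\{1\}$, $p_1>1$; when $\mathbb{P}\ne\{1\}$, $p_{n+1}$ is an even multiple of $p_n$ (i.e. $p_{n+1}=2lp_n$ for some $l\in\mathbb{N}$) for every $n$ with $n,n+1\in\mathbb{P}$. Spaces. $W^{\kappa}$ is the product of $\kappa$ copies of $W$. $\mathfrak{c}$ and $\aleph_0$ are the cardinals of $\mathbb{R}$ and $\mathbb{N}$. $\sum$ and $+$ denote topological sums; $q_n$ under a brace is the number of copies, $q_n=\infty$ meaning countably infinitely many. $\mathcal{N}\cup\{\infty\}$ is the one-point compactification of a countably infinite discrete space $\mathcal{N}=\{\mathbf{1},\mathbf{2},\dots\}$. A compactification of a space $W$ is a compact Hausdorff space containing (a homeomorphic copy of) $W$ as a dense subspace. Shifts. For compact Hausdorff $X$, $C(X)$ is the Banach space of $\mathbb{K}$-valued continuous functions on $X$ with the supremum norm. An isometric shift on a Banach space $E$ is a linear isometry $T:E\to E$ with $T(E)$ of codimension $1$ and $\bigcap_{n\ge1}T^n(E)=\{0\}$. An isometric shift $T$ on $C(X)$ is of type $\mathrm{I}$ if there are an isolated point $p\in X$, a homeomorphism $\phi$ from $X\setminus\{p\}$ onto $X$ and $a\in C(X\setminus\{p\})$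 with $|a|\equiv1$ such that $(Tf)(x)=a(x)f(\phi(x))$ for all $x\ne p$ and $f\in C(X)$. It is of type $\mathrm{II}$ if there are a continuous surjection $\phi:X\to X$ and $a\in C(X)$, $|a|\equiv1$, with $(Tf)(x)=a(x)f(\phi(x))$ for all $x\in X$ and $f\in C(X)$. It is of type $\mathrm{I}_0$ if it is of type $\mathrm{I}$ and not of type $\mathrm{II}$. For $T$ of type $\mathrm{I}$, with $p\in X$ an isolated point, $\phi$ a homeomorphism from $X\setminus\{p\}$ onto $X$ and $a\in C(X\setminus\{p\})$, $|a|\equiv1$, such that $(Tf)(x)=a(x)f(\phi(x))$ for all $x\ne p$ and $f\in C(X)$, put $\mathbf{1}:=p$ and let $\mathbf{n+1}$ be the point with $\phi(\mathbf{n+1})=\mathbf{n}$; set $\mathcal{N}:=\{\mathbf{1},\mathbf{2},\dots\}$ (a set of isolated points). Then $\phi$ restricts to a homeomorphism of $X\setminus\mathrm{cl}_X(\mathcal{N})$ onto itself. If $\mathcal{N}$ is not dense in $X$, then for $n\in\mathbb{N}$, $T$ is $n$-generated if $n$ is the least number for which there are $x_1,\dots,x_n\in X\setminus\mathrm{cl}_X(\mathcal{N})$ such that $\{\phi^k(x_i):k\in\mathbb{Z},\,1\le i\le n\}$ is dense in $X\setminus\mathrm{cl}_X(\mathcal{N})$; $T$ is $\infty$-generated if it is not $n$-generated for any $n\in\mathbb{N}$. *)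

theory Defs
  imports "HOL-Analysis.Analysis"
begin

section \<open>Initial subsets and compatible sequences\<close>

text \<open>Natural numbers start at 1 here, whence the conditions excluding 0.\<close>

definition initial_subset :: "nat set \<Rightarrow> bool" where
  "initial_subset P \<longleftrightarrow> 0 \<notin> P \<and> 1 \<in> P \<and> (\<forall>n\<in>P. 2 \<le> n \<longrightarrow> n - 1 \<in> P)"

definition compatible :: "nat set \<Rightarrow> (nat \<Rightarrow> nat) \<Rightarrow> bool" where
  "compatible P p \<longleftrightarrow>
     (\<forall>n\<in>P. 1 \<le> p n) \<and>
     (P = {1} \<longrightarrow> 1 < p 1) \<and>
     (P \<noteq> {1} \<longrightarrow> (\<forall>n. n \<in> P \<and> n + 1 \<in> P \<longrightarrow> (\<exists>l\<ge>1. p (n + 1) = 2 * l * p n)))"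

definition indexed_partition :: "nat set \<Rightarrow> (nat \<Rightarrow> 'a set) \<Rightarrow> 'a set \<Rightarrow> bool" where
  "indexed_partition M A S \<longleftrightarrow>
     (\<Union>i\<in>M. A i) = S \<and> disjoint_family_on A M \<and> (\<forall>i\<in>M. A i \<noteq> {})"

definition esum :: "nat set \<Rightarrow> enat" where
  "esum A = (if finite A then enat (\<Sum>k\<in>A. k) else \<infinity>)"

definition ecard :: "'a set \<Rightarrow> enat" where
  "ecard A = (if finite A then enat (card A) else \<infinity>)"


section \<open>Spaces\<close>

definition power_topology :: "'a topology \<Rightarrow> 'i set \<Rightarrow> ('i \<Rightarrow> 'a) topology" where
  "power_topology W I = product_topology (\<lambda>_. W) I"

definition plus_topology :: "'a topology \<Rightarrow> 'b topology \<Rightarrow> ('a + 'b) topology" where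
  "plus_topology V W = topology (\<lambda>U. U \<subseteq> topspace V <+> topspace W \<and>
     openin V {x. Inl x \<in> U} \<and> openin W {y. Inr y \<in> U})"

lemma openin_plus_topology:
  "openin (plus_topology V W) U \<longleftrightarrow> U \<subseteq> topspace V <+> topspace W \<and>
     openin V {x. Inl x \<in> U} \<and> openin W {y. Inr y \<in> U}"
proof -
  have "istopology (\<lambda>U. U \<subseteq> topspace V <+> topspace W \<and>
     openin V {x. Inl x \<in> U} \<and> openin W {y. Inr y \<in> U})"
    unfolding istopology_def
  proof (intro conjI allI impI)
    fix S T :: "('a + 'b) set"
    assume S: "S \<subseteq> topspace V <+> topspace W \<and> openin V {x. Inl x \<in> S} \<and> openin W {y. Inr y \<in> S}"
      and T: "T \<subseteq> topspace V <+> topspace W \<and> openin V {x. Inl x \<in> T} \<and> openin W {y. Inr y \<in> T}"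
    have "{x. Inl x \<in> S \<inter> T} = {x. Inl x \<in> S} \<inter> {x. Inl x \<in> T}"
      "{y. Inr y \<in> S \<inter> T} = {y. Inr y \<in> S} \<inter> {y. Inr y \<in> T}" by auto
    then show "openin V {x. Inl x \<in> S \<inter> T}" "openin W {y. Inr y \<in> S \<inter> T}"
      using S T by (simp_all add: openin_Int)
    show "S \<inter> T \<subseteq> topspace V <+> topspace W" using S by blast
  next
    fix \<K> :: "('a + 'b) set set"
    assume K: "\<forall>U\<in>\<K>. U \<subseteq> topspace V <+> topspace W \<and> openin V {x. Inl x \<in> U} \<and> openin W {y. Inr y \<in> U}"
    have "{x. Inl x \<in> \<Union>\<K>} = (\<Union>U\<in>\<K>. {x. Inl x \<in> U})"
      "{y. Inr y \<in> \<Union>\<K>} = (\<Union>U\<in>\<K>. {y. Inr y \<in> U})" by auto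
    then show "openin V {x. Inl x \<in> \<Union>\<K>}" "openin W {y. Inr y \<in> \<Union>\<K>}"
      using K by auto
    show "\<Union>\<K> \<subseteq> topspace V <+> topspace W" using K by blast
  qed
  then show ?thesis by (simp add: plus_topology_def)
qed

lemma topspace_plus_topology [simp]:
  "topspace (plus_topology V W) = topspace V <+> topspace W"
proof
  show "topspace (plus_topology V W) \<subseteq> topspace V <+> topspace W"
    using openin_plus_topology openin_topspace by blast
  have "{x. Inl x \<in> topspace V <+> topspace W} = topspace V"
    "{y. Inr y \<in> topspace V <+> topspace W} = topspace W" by auto
  then have "openin (plus_topology V W) (topspace V <+> topspace W)"
    by (simp add: openin_plus_topology)
  then show "topspace V <+> topspace W \<subseteq> topspace (plus_topology V W)"
    by (rule openin_subset)
qed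

text \<open>Copies are indexed by \<^term>\<open>j\<close> with \<^term>\<open>enat j < q n\<close>, so that there are
  \<^term>\<open>q n\<close> of them, countably infinitely many for \<^term>\<open>q n = \<infinity>\<close>.\<close>

definition sum_of_copies :: "nat set \<Rightarrow> (nat \<Rightarrow> enat) \<Rightarrow> (nat \<Rightarrow> 'b topology) \<Rightarrow> ((nat \<times> nat) \<times> 'b) topology" where
  "sum_of_copies M q Y = sum_topology (\<lambda>(n, j). Y n) {(n, j). n \<in> M \<and> enat j < q n}"

definition convergent_sequence_space :: "nat option topology" where
  "convergent_sequence_space = Alexandroff_compactification (discrete_topology UNIV)"

definition compactification :: "'w topology \<Rightarrow> 'x topology \<Rightarrow> bool" where
  "compactification W X \<longleftrightarrow> compact_space X \<and> Hausdorff_space X \<and>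
     (\<exists>e. embedding_map W X e \<and> X closure_of (e ` topspace W) = topspace X)"

text \<open>A type large enough to carry a copy of every compactification in question: a countable sum of
  products of at most continuum many separable spaces is separable, hence so are its
  compactifications, and a separable Hausdorff space has at most as many points as there are sets
  of sets of natural numbers.\<close>

type_synonym point = "nat set set"


section \<open>The space \<open>\<ell>\<^sup>2\<close>\<close>

definition ell2 :: "(nat \<Rightarrow> real) set" where
  "ell2 = {x. (\<lambda>n. (x n)\<^sup>2) summable_on UNIV}"

definition ell2_norm :: "(nat \<Rightarrow> real) \<Rightarrow> real" where
  "ell2_norm x = sqrt (\<Sum>\<^sub>\<infinity>n. (x n)\<^sup>2)"

definition ell2_dist :: "(nat \<Rightarrow> real) \<Rightarrow> (nat \<Rightarrow> real) \<Rightarrow> real" where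
  "ell2_dist x y = ell2_norm (\<lambda>n. x n - y n)"

lemma ell2_iff_summable: "x \<in> ell2 \<longleftrightarrow> summable (\<lambda>n. (x n)\<^sup>2)"
  by (simp add: ell2_def summable_on_UNIV_nonneg_real_iff)

lemma ell2_norm_suminf: "x \<in> ell2 \<Longrightarrow> ell2_norm x = sqrt (\<Sum>n. (x n)\<^sup>2)"
  unfolding ell2_norm_def ell2_def
  by (simp add: has_sum_imp_sums sums_unique[symmetric, OF has_sum_imp_sums[OF has_sum_infsum]])

lemma ell2_add:
  assumes "x \<in> ell2" "y \<in> ell2" 
  shows "(\<lambda>n. x n + y n) \<in> ell2" "ell2_norm (\<lambda>n. x n + y n) \<le> ell2_norm x + ell2_norm y"
proof -
  have s: "summable (\<lambda>n. (x n)\<^sup>2)" "summable (\<lambda>n. (y n)\<^sup>2)"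
    using assms by (auto simp: ell2_iff_summable)
  have b: "(x n + y n)\<^sup>2 \<le> 2 * (x n)\<^sup>2 + 2 * (y n)\<^sup>2" for n
    using sum_squares_bound[of "x n" "y n"] by (simp add: power2_sum)
  have s3: "summable (\<lambda>n. (x n + y n)\<^sup>2)"
    by (rule summable_comparison_test'[of "\<lambda>n. 2 * (x n)\<^sup>2 + 2 * (y n)\<^sup>2" 0])
      (use b s in \<open>auto intro!: summable_add summable_mult\<close>)
  then show "(\<lambda>n. x n + y n) \<in> ell2" by (simp add: ell2_iff_summable)
  have lim: "(\<lambda>n. L2_set z {..<n}) \<longlonglongrightarrow> ell2_norm z" if "summable (\<lambda>n. (z n)\<^sup>2)" for z
    using that unfolding L2_set_def
    by (subst ell2_norm_suminf) (auto simp: ell2_iff_summable intro!: tendsto_real_sqrt summable_LIMSEQ)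
  show "ell2_norm (\<lambda>n. x n + y n) \<le> ell2_norm x + ell2_norm y"
    by (rule LIMSEQ_le[OF lim[OF s3] tendsto_add[OF lim[OF s(1)] lim[OF s(2)]]])
      (auto intro: L2_set_triangle_ineq)
qed

lemma ell2_minus: "x \<in> ell2 \<Longrightarrow> (\<lambda>n. - x n) \<in> ell2"
  by (simp add: ell2_def)

interpretation ell2: Metric_space ell2 ell2_dist
proof
  fix x y z :: "nat \<Rightarrow> real"
  show "0 \<le> ell2_dist x y"
    by (simp add: ell2_dist_def ell2_norm_def infsum_nonneg)
  show "ell2_dist x y = ell2_dist y x"
    by (simp add: ell2_dist_def ell2_norm_def power2_commute)
  assume x: "x \<in> ell2" and y: "y \<in> ell2"
  have d: "(\<lambda>n. a n - b n) \<in> ell2" if "a \<in> ell2" "b \<in> ell2" for a b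
    using ell2_add(1)[OF that(1) ell2_minus[OF that(2)]] by simp
  show "ell2_dist x y = 0 \<longleftrightarrow> x = y"
    using d[OF x y] by (auto simp: ell2_dist_def ell2_norm_suminf ell2_iff_summable suminf_eq_zero_iff)
  assume z: "z \<in> ell2"
  show "ell2_dist x z \<le> ell2_dist x y + ell2_dist y z"
    using ell2_add(2)[OF d[OF x y] d[OF y z]] by (simp add: ell2_dist_def)
qed

definition ell2_topology :: "(nat \<Rightarrow> real) topology" where
  "ell2_topology = Metric_space.mtopology ell2 ell2_dist"


section \<open>Isometric shifts on \<open>C(X)\<close>\<close>

text \<open>Functions are normalised to vanish outside the carrier of \<open>X\<close>, so that \<open>C(X)\<close> is a vector
  space under the pointwise operations. The scalar field is \<^typ>\<open>real\<close> or \<^typ>\<open>complex\<close>.\<close>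

definition Cfun :: "'x topology \<Rightarrow> ('x \<Rightarrow> 'k::real_normed_field) set" where
  "Cfun X = {f. continuous_map X euclidean f \<and> (\<forall>x. x \<notin> topspace X \<longrightarrow> f x = 0)}"

definition sup_norm :: "'x topology \<Rightarrow> ('x \<Rightarrow> 'k::real_normed_field) \<Rightarrow> real" where
  "sup_norm X f = (SUP x\<in>topspace X. norm (f x))"

definition linear_isometry :: "'x topology \<Rightarrow> (('x \<Rightarrow> 'k::real_normed_field) \<Rightarrow> ('x \<Rightarrow> 'k)) \<Rightarrow> bool" where
  "linear_isometry X T \<longleftrightarrow>
     (\<forall>f\<in>Cfun X. T f \<in> Cfun X) \<and>
     (\<forall>f\<in>Cfun X. \<forall>g\<in>Cfun X. T (\<lambda>x. f x + g x) = (\<lambda>x. T f x + T g x)) \<and>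
     (\<forall>c. \<forall>f\<in>Cfun X. T (\<lambda>x. c * f x) = (\<lambda>x. c * T f x)) \<and>
     (\<forall>f\<in>Cfun X. sup_norm X (T f) = sup_norm X f)"

text \<open>The quotient of \<open>C(X)\<close> by the subspace \<open>R\<close> is one-dimensional: it is spanned by the nonzero
  class of \<open>g\<close>.\<close>

definition codimension_one :: "'x topology \<Rightarrow> ('x \<Rightarrow> 'k::real_normed_field) set \<Rightarrow> bool" where
  "codimension_one X R \<longleftrightarrow>
     (\<exists>g\<in>Cfun X. g \<notin> R \<and> (\<forall>f\<in>Cfun X. \<exists>c. (\<lambda>x. f x - c * g x) \<in> R))"

definition isometric_shift :: "'x topology \<Rightarrow> (('x \<Rightarrow> 'k::real_normed_field) \<Rightarrow> ('x \<Rightarrow> 'k)) \<Rightarrow> bool" where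
  "isometric_shift X T \<longleftrightarrow>
     linear_isometry X T \<and> codimension_one X (T ` Cfun X) \<and>
     (\<Inter>n\<in>{1..}. (T ^^ n) ` Cfun X) = {\<lambda>_. 0}"

definition type_I_representation ::
  "'x topology \<Rightarrow> (('x \<Rightarrow> 'k::real_normed_field) \<Rightarrow> ('x \<Rightarrow> 'k)) \<Rightarrow> 'x \<Rightarrow> ('x \<Rightarrow> 'x) \<Rightarrow> ('x \<Rightarrow> 'k) \<Rightarrow> bool" where
  "type_I_representation X T p \<phi> a \<longleftrightarrow>
     p \<in> topspace X \<and> openin X {p} \<and>
     homeomorphic_map (subtopology X (topspace X - {p})) X \<phi> \<and>
     continuous_map (subtopology X (topspace X - {p})) euclidean a \<and>
     (\<forall>x\<in>topspace X - {p}. norm (a x) = 1) \<and>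
     (\<forall>f\<in>Cfun X. \<forall>x\<in>topspace X - {p}. T f x = a x * f (\<phi> x))"

definition type_I :: "'x topology \<Rightarrow> (('x \<Rightarrow> 'k::real_normed_field) \<Rightarrow> ('x \<Rightarrow> 'k)) \<Rightarrow> bool" where
  "type_I X T \<longleftrightarrow> isometric_shift X T \<and> (\<exists>p \<phi> a. type_I_representation X T p \<phi> a)"

definition type_II :: "'x topology \<Rightarrow> (('x \<Rightarrow> 'k::real_normed_field) \<Rightarrow> ('x \<Rightarrow> 'k)) \<Rightarrow> bool" where
  "type_II X T \<longleftrightarrow> isometric_shift X T \<and>
     (\<exists>\<phi> a. continuous_map X X \<phi> \<and> \<phi> ` topspace X = topspace X \<and>
        continuous_map X euclidean a \<and> (\<forall>x\<in>topspace X. norm (a x) = 1) \<and>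
        (\<forall>f\<in>Cfun X. \<forall>x\<in>topspace X. T f x = a x * f (\<phi> x)))"

definition type_I0 :: "'x topology \<Rightarrow> (('x \<Rightarrow> 'k::real_normed_field) \<Rightarrow> ('x \<Rightarrow> 'k)) \<Rightarrow> bool" where
  "type_I0 X T \<longleftrightarrow> type_I X T \<and> \<not> type_II X T"


section \<open>Generation\<close>

text \<open>The \<open>k\<close>-fold preimage of \<open>p\<close> under \<open>\<phi>\<close>, for \<open>k = 0, 1, \<dots>\<close>, is the point
  \<open>\<^bold>k \<^bold>+ \<^bold>1\<close>.\<close>

definition shift_points :: "'x topology \<Rightarrow> 'x \<Rightarrow> ('x \<Rightarrow> 'x) \<Rightarrow> 'x set" where
  "shift_points X p \<phi> = range (\<lambda>k. (inv_into (topspace X - {p}) \<phi> ^^ k) p)"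

definition shift_rest :: "'x topology \<Rightarrow> 'x \<Rightarrow> ('x \<Rightarrow> 'x) \<Rightarrow> 'x set" where
  "shift_rest X p \<phi> = topspace X - X closure_of shift_points X p \<phi>"

definition int_iterate :: "'x set \<Rightarrow> ('x \<Rightarrow> 'x) \<Rightarrow> int \<Rightarrow> 'x \<Rightarrow> 'x" where
  "int_iterate Y \<phi> k = (if 0 \<le> k then \<phi> ^^ nat k else inv_into Y \<phi> ^^ nat (- k))"

definition generated_by :: "'x topology \<Rightarrow> 'x \<Rightarrow> ('x \<Rightarrow> 'x) \<Rightarrow> nat \<Rightarrow> bool" where
  "generated_by X p \<phi> n \<longleftrightarrow>
     (\<exists>x. x ` {1..n} \<subseteq> shift_rest X p \<phi> \<and>
        subtopology X (shift_rest X p \<phi>) closure_of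
          {int_iterate (shift_rest X p \<phi>) \<phi> k (x i) | k i. i \<in> {1..n}} = shift_rest X p \<phi>)"

definition least_generated_by :: "'x topology \<Rightarrow> 'x \<Rightarrow> ('x \<Rightarrow> 'x) \<Rightarrow> nat \<Rightarrow> bool" where
  "least_generated_by X p \<phi> n \<longleftrightarrow>
     1 \<le> n \<and> generated_by X p \<phi> n \<and> (\<forall>m. 1 \<le> m \<and> m < n \<longrightarrow> \<not> generated_by X p \<phi> m)"

text \<open>The notion refers to a representation of the shift. A representation is not unique in general,
  but for a shift of type \<open>I\<^sub>0\<close> the point \<open>p\<close>, and with it \<open>\<phi>\<close> on its domain, is: a second choice
  of \<open>p\<close> would allow one to extend \<open>\<phi>\<close> to all of \<open>X\<close>, making the shift of type II.\<close>

definition generated_shift :: "'x topology \<Rightarrow> (('x \<Rightarrow> 'k::real_normed_field) \<Rightarrow> ('x \<Rightarrow> 'k)) \<Rightarrow> enat \<Rightarrow> bool" where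
  "generated_shift X T N \<longleftrightarrow> type_I X T \<and>
     (\<exists>p \<phi> a. type_I_representation X T p \<phi> a \<and>
        X closure_of shift_points X p \<phi> \<noteq> topspace X \<and>
        (case N of enat n \<Rightarrow> least_generated_by X p \<phi> n
                 | \<infinity> \<Rightarrow> \<forall>n. \<not> least_generated_by X p \<phi> n))"

definition admits_generated_I0_shift :: "'k::real_normed_field itself \<Rightarrow> 'x topology \<Rightarrow> enat \<Rightarrow> bool" where
  "admits_generated_I0_shift _ X N \<longleftrightarrow>
     (\<exists>T :: ('x \<Rightarrow> 'k) \<Rightarrow> ('x \<Rightarrow> 'k). type_I0 X T \<and> generated_shift X T N)"

end

theory Submission
  imports Defs
begin

text \<open>
  Let \<open>\<phi>\<close> be the homeomorphism underlying the shift, \<open>\<psi>\<close> its inverse, \<open>p\<close> the isolated point.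
  Put one block for each \<open>m \<in> P\<close>: a cycle of \<open>p m\<close> copies of a power \<open>K\<^sup>\<kappa>\<close>, on which \<open>\<psi>\<close>
  moves cyclically while acting as a two-sided coordinate shift on \<open>K\<^sup>\<kappa> = (K\<^sup>\<int>)\<^sup>\<kappa>\<close>.
  With \<open>x m\<close> a point of block \<open>m\<close>, the operator is \<open>(T f)(x) = a(x) f(\<phi> x)\<close> away from \<open>p\<close> and
  \<open>(T f)(p) = \<Sum>m\<in>P. 4\<^sup>-\<^sup>m f(x m)\<close>; since this functional has norm at most \<open>1/3\<close>, it is not a
  unimodular multiple of an evaluation and \<open>T\<close> is not of type II. The weight \<open>a\<close> is \<open>-1\<close> on a
  single copy of each block, so that going \<open>p m\<close> steps along block \<open>m\<close> changes the sign.

  A function in every \<open>T\<^sup>n(C(X))\<close> satisfies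
  \<open>f(\<psi>\<^sup>n p) = \<Sum>m\<in>P. \<plusminus> 4\<^sup>-\<^sup>m f(\<psi>\<^sup>n\<^sup>+\<^sup>1 (x m))\<close>, and the left side converges. The points \<open>x m\<close>
  are chosen jointly generic, with return times in any residue class. As \<open>2 p m\<close> divides \<open>p k\<close>
  for \<open>m < k\<close>, return times differing by \<open>p k\<close> modulo \<open>2 p k\<close> change the sign of the \<open>k\<close>-th term
  but of no earlier one, and the later terms are small: \<open>\<bar>f\<bar>\<close> is at most a third of its norm on
  block \<open>k\<close>. This holds on a dense set, hence \<open>f = 0\<close>.

  For infinite \<open>P\<close> the blocks accumulate at a remainder \<open>\<int> \<union> {\<infinity>}\<close>, the copy of index \<open>k\<close> in block
  \<open>m\<close> tending to \<open>k\<close> as \<open>m\<close> grows; thus \<open>a\<close> and \<open>\<phi>\<close> extend continuously.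
\<close>

section \<open>Shifts from transitive dynamics\<close>

lemma continuous_map_mult':
  fixes f g :: "'y \<Rightarrow> 'k::real_normed_field"
  assumes "continuous_map Y euclidean f" "continuous_map Y euclidean g"
  shows "continuous_map Y euclidean (\<lambda>z. f z * g z)"
  using assms unfolding continuous_map_atin by (auto intro: tendsto_mult)

text \<open>Everything that the operator needs from the dynamics, detached from the concrete space:
  \<open>l\<close> is the limit of the orbit of \<open>p\<close>, and the \<open>C m\<close> are
  disjoint invariant open sets marking the blocks. The weight \<open>a\<close> is real of modulus
  one, hence a sign, so that one model serves all scalar fields. In \<open>recurrent\<close>, two
  late times bring each \<open>x m\<close> with \<open>m \<le> k\<close> back near
  \<open>(\<psi> ^^ j) (x m)\<close>, while the signs collected up to these times differ for
  \<open>m = k\<close> only.\<close>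

locale shift_model =
  fixes X :: "'x topology" and P :: "nat set" and p :: 'x and \<phi> \<psi> :: "'x \<Rightarrow> 'x"
    and a :: "'x \<Rightarrow> real" and l :: 'x and x :: "nat \<Rightarrow> 'x" and C :: "nat \<Rightarrow> 'x set"
  assumes compact_X: "compact_space X" and Hausdorff_X: "Hausdorff_space X"
    and P_nonempty: "P \<noteq> {}" and P_pos: "0 \<notin> P"
    and open_p: "openin X {p}"
    and maps: "homeomorphic_maps X (subtopology X (topspace X - {p})) \<psi> \<phi>"
    and a_cont: "continuous_map X euclideanreal a"
    and a_abs: "z \<in> topspace X \<Longrightarrow> \<bar>a z\<bar> = 1"
    and lim: "limitin X (\<lambda>n. (\<psi> ^^ n) p) l sequentially"
    and a_p: "a ((\<psi> ^^ n) p) = 1"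
    and open_C: "m \<in> P \<Longrightarrow> openin X (C m)"
    and x_C: "m \<in> P \<Longrightarrow> x m \<in> C m"
    and psi_C: "m \<in> P \<Longrightarrow> \<psi> ` C m = C m"
    and p_C: "m \<in> P \<Longrightarrow> p \<notin> C m"
    and disjoint_C: "disjoint_family_on C P"
    and dense: "X closure_of (range (\<lambda>n. (\<psi> ^^ n) p) \<union> (\<Union>m\<in>P. range (\<lambda>n. (\<psi> ^^ n) (x m)))) = topspace X"
    and recurrent: "\<lbrakk>k \<in> P; \<And>m. \<lbrakk>m \<in> P; m \<le> k\<rbrakk> \<Longrightarrow> openin X (U m) \<and> (\<psi> ^^ j) (x m) \<in> U m\<rbrakk> \<Longrightarrow>
      \<exists>n n'. B \<le> n \<and> B \<le> n' \<and> (\<forall>m\<in>P. m \<le> k \<longrightarrow>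
         (\<psi> ^^ n) (x m) \<in> U m \<and> (\<psi> ^^ n') (x m) \<in> U m \<and>
         (\<Prod>i=1..n. a ((\<psi> ^^ i) (x m))) =
           (if m = k then - 1 else 1) * (\<Prod>i=1..n'. a ((\<psi> ^^ i) (x m))))"
begin

lemma p_in: "p \<in> topspace X"
  using open_p openin_subset by blast

lemma open_compl_p: "openin X (topspace X - {p})"
  using closedin_Hausdorff_singleton[OF Hausdorff_X p_in] by (rule openin_diff[OF openin_topspace])

lemma C_sub: "m \<in> P \<Longrightarrow> C m \<subseteq> topspace X"
  by (simp add: open_C openin_subset)

lemma x_in: "m \<in> P \<Longrightarrow> x m \<in> topspace X"
  using C_sub x_C by blast

lemma phi_psi [simp]: "z \<in> topspace X \<Longrightarrow> \<phi> (\<psi> z) = z"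
  using maps by (simp add: homeomorphic_maps_def)

lemma psi_phi [simp]: "z \<in> topspace X \<Longrightarrow> z \<noteq> p \<Longrightarrow> \<psi> (\<phi> z) = z"
  using maps by (simp add: homeomorphic_maps_def)

lemma cont_psi: "continuous_map X X \<psi>" and cont_phi: "continuous_map (subtopology X (topspace X - {p})) X \<phi>"
  using maps by (auto simp: homeomorphic_maps_def dest: continuous_map_into_fulltopology)

lemma psi_in: "z \<in> topspace X \<Longrightarrow> \<psi> z \<in> topspace X" and psi_ne: "z \<in> topspace X \<Longrightarrow> \<psi> z \<noteq> p"
  using maps by (auto simp: homeomorphic_maps_def continuous_map_def)

lemma phi_in: "z \<in> topspace X \<Longrightarrow> z \<noteq> p \<Longrightarrow> \<phi> z \<in> topspace X"
  using cont_phi by (auto simp: continuous_map_def)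

lemma psi_pow_in: "z \<in> topspace X \<Longrightarrow> (\<psi> ^^ n) z \<in> topspace X"
  by (induction n) (auto intro: psi_in)

lemma homeomorphic_phi: "homeomorphic_map (subtopology X (topspace X - {p})) X \<phi>"
  using maps by (meson homeomorphic_maps_map)

lemma psi_C_mem: "m \<in> P \<Longrightarrow> z \<in> C m \<Longrightarrow> (\<psi> ^^ n) z \<in> C m"
proof (induction n)
  case (Suc n)
  then show ?case using psi_C[of m] by (auto simp del: psi_C)
qed auto

lemma phi_C_mem: "m \<in> P \<Longrightarrow> z \<in> C m \<Longrightarrow> \<phi> z \<in> C m"
  using psi_C[of m] C_sub by (metis (no_types, lifting) imageE phi_psi subsetD)

lemma pow_p_notin_C: "m \<in> P \<Longrightarrow> (\<psi> ^^ n) p \<notin> C m"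
proof (induction n)
  case (Suc n)
  then show ?case
    using phi_C_mem[of m "\<psi> ((\<psi> ^^ n) p)"] by (auto simp: psi_pow_in p_in)
qed (auto simp: p_C)

lemma closure_p_C: "m \<in> P \<Longrightarrow> X closure_of range (\<lambda>n. (\<psi> ^^ n) p) \<inter> C m = {}"
  using openin_Int_closure_of_eq_empty[OF open_C, of m "range (\<lambda>n. (\<psi> ^^ n) p)"] pow_p_notin_C[of m]
  by blast

subsection \<open>The functional and the operator\<close>

text \<open>The value prescribed at \<open>p\<close>. The weights after \<open>k\<close> add up to
  at most a third of the \<open>k\<close>-th one, which is what isolates a single term in
  \<open>Inter_range_bound\<close>.\<close>

definition \<Delta> :: "('x \<Rightarrow> 'k::{real_normed_field,banach}) \<Rightarrow> 'k" where
  "\<Delta> f = (\<Sum>m. if m \<in> P then (1/4) ^ m *\<^sub>R f (x m) else 0)"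

definition T :: "('x \<Rightarrow> 'k::{real_normed_field,banach}) \<Rightarrow> 'x \<Rightarrow> 'k" where
  "T f z = (if z \<notin> topspace X then 0 else if z = p then \<Delta> f else of_real (a z) * f (\<phi> z))"

lemma weight_sums:
  "summable (\<lambda>m. if m \<in> P then (1/4::real) ^ m else 0)" "(\<Sum>m. if m \<in> P then (1/4::real) ^ m else 0) \<le> 1/3"
proof -
  have g: "(\<lambda>m. (1/4::real) ^ Suc m) sums (1/3)"
    using sums_mult[OF geometric_sums[of "1/4::real"], of "1/4"] by simp
  \<comment> \<open>The geometric series is padded with 0 at index 0, which \<open>P_pos\<close>
    keeps out of \<open>P\<close>; this lowers the bound from 4/3 to 1/3.\<close>
  then have g': "(\<lambda>m. if m = 0 then 0 else (1/4::real) ^ m) sums (1/3)"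
    using sums_Suc[of "\<lambda>m. if m = 0 then 0 else (1/4::real) ^ m" "1/3"] by simp
  show s: "summable (\<lambda>m. if m \<in> P then (1/4::real) ^ m else 0)"
    by (rule summable_comparison_test'[OF sums_summable[OF g'], of 0]) (use P_pos in auto)
  have "suminf (\<lambda>m. if m \<in> P then (1/4::real) ^ m else 0) \<le> suminf (\<lambda>m. if m = 0 then 0 else (1/4::real) ^ m)"
    by (rule suminf_le[OF _ s sums_summable[OF g']]) (use P_pos in auto)
  then show "(\<Sum>m. if m \<in> P then (1/4::real) ^ m else 0) \<le> 1/3" using sums_unique[OF g'] by simp
qed

lemma summable_weighted:
  fixes v :: "nat \<Rightarrow> 'k::{real_normed_field,banach}"
  assumes "\<And>m. m \<in> P \<Longrightarrow> norm (v m) \<le> M"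
  shows "summable (\<lambda>m. norm (if m \<in> P then (1/4) ^ m *\<^sub>R v m else 0))"
    and "norm (\<Sum>m. if m \<in> P then (1/4) ^ m *\<^sub>R v m else 0) \<le> M / 3"
proof -
  let ?w = "\<lambda>m. if m \<in> P then (1/4::real) ^ m else 0"
  note w = weight_sums
  have M: "0 \<le> M" using P_nonempty assms norm_ge_zero order_trans by blast
  have b: "norm (if m \<in> P then (1/4) ^ m *\<^sub>R v m else 0) \<le> M * ?w m" for m
    using assms by (auto simp: mult.commute mult_left_mono)
  have sM: "summable (\<lambda>m. M * ?w m)" using w by (intro summable_mult)
  show s: "summable (\<lambda>m. norm (if m \<in> P then (1/4) ^ m *\<^sub>R v m else 0))"
    by (rule summable_comparison_test'[OF sM, of 0]) (use b in auto)
  have "norm (\<Sum>m. if m \<in> P then (1/4) ^ m *\<^sub>R v m else 0)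
     \<le> (\<Sum>m. norm (if m \<in> P then (1/4) ^ m *\<^sub>R v m else 0))"
    by (rule summable_norm[OF s])
  also have "\<dots> \<le> (\<Sum>m. M * ?w m)" by (rule suminf_le[OF b s sM])
  also have "\<dots> = M * suminf ?w" by (rule suminf_mult[OF w(1)])
  also have "\<dots> \<le> M * (1/3)" using w(2) M by (intro mult_left_mono)
  finally show "norm (\<Sum>m. if m \<in> P then (1/4) ^ m *\<^sub>R v m else 0) \<le> M / 3" by simp
qed

lemma Cfun_bdd:
  assumes "f \<in> Cfun X"
  shows "bdd_above ((\<lambda>z. norm (f z)) ` topspace X)"
proof -
  have "compactin euclidean (f ` topspace X)"
    using assms compact_X unfolding Cfun_def compact_space_def by (blast intro: image_compactin)
  then have "bounded (f ` topspace X)" by (simp add: compact_imp_bounded)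
  then show ?thesis unfolding bdd_above_def by (auto simp: bounded_iff)
qed

lemma Cfun_le: "f \<in> Cfun X \<Longrightarrow> z \<in> topspace X \<Longrightarrow> norm (f z) \<le> sup_norm X f"
  unfolding sup_norm_def by (rule cSUP_upper[OF _ Cfun_bdd])

lemma sup_norm_le: "(\<And>z. z \<in> topspace X \<Longrightarrow> norm (f z) \<le> b) \<Longrightarrow> sup_norm X f \<le> b"
  unfolding sup_norm_def using p_in by (intro cSUP_least) auto

lemma norm_a: "z \<in> topspace X \<Longrightarrow> norm (of_real (a z) :: 'k::real_normed_field) = 1"
  by (simp add: a_abs)

lemma a_sq: "z \<in> topspace X \<Longrightarrow> (of_real (a z) :: 'k::real_normed_field) * (of_real (a z) * w) = w"
  using a_abs[of z] by (metis abs_mult_self_eq mult.assoc mult.left_neutral mult_1 of_real_1 of_real_mult)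

lemma T_p: "T f p = \<Delta> f" by (simp add: T_def p_in)

lemma T_psi: "z \<in> topspace X \<Longrightarrow> T f (\<psi> z) = of_real (a (\<psi> z)) * f z"
  by (simp add: T_def psi_in psi_ne)

lemma \<Delta>_summable:
  fixes f :: "'x \<Rightarrow> 'k::{real_normed_field,banach}"
  assumes "f \<in> Cfun X"
  shows "summable (\<lambda>m. if m \<in> P then (1/4) ^ m *\<^sub>R f (x m) else 0)"
  by (rule summable_norm_cancel, rule summable_weighted(1)) (use Cfun_le[OF assms] x_in in blast)

lemma \<Delta>_le: "f \<in> Cfun X \<Longrightarrow> norm (\<Delta> f) \<le> sup_norm X f / 3"
  unfolding \<Delta>_def by (rule summable_weighted(2)) (use Cfun_le x_in in blast)

lemma \<Delta>_add:
  assumes "f \<in> Cfun X" "g \<in> Cfun X"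
  shows "\<Delta> (\<lambda>z. f z + g z) = \<Delta> f + \<Delta> g"
  unfolding \<Delta>_def
  by (subst suminf_add[OF \<Delta>_summable \<Delta>_summable]) (auto intro!: suminf_cong simp: assms scaleR_add_right)

lemma \<Delta>_cmult:
  assumes "f \<in> Cfun X"
  shows "\<Delta> (\<lambda>z. c * f z) = c * \<Delta> f"
  unfolding \<Delta>_def
  by (subst suminf_mult[OF \<Delta>_summable, symmetric]) (auto intro!: suminf_cong simp: assms)

lemma sup_norm_nonneg: "f \<in> Cfun X \<Longrightarrow> 0 \<le> sup_norm X f"
  using Cfun_le[OF _ p_in] norm_ge_zero order_trans by blast

lemma continuous_of_real_a: "continuous_map X euclidean (\<lambda>z. of_real (a z) :: 'k::real_normed_field)"
  using a_cont unfolding continuous_map_atin by (auto intro: tendsto_of_real)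

text \<open>Since \<open>p\<close> is isolated, continuity can be checked separately on
  \<open>{p}\<close> and on its open complement, whatever value \<open>\<Delta> f\<close> is put at
  \<open>p\<close>.\<close>

lemma T_Cfun:
  fixes f :: "'x \<Rightarrow> 'k::{real_normed_field,banach}"
  assumes f: "f \<in> Cfun X" shows "T f \<in> Cfun X"
proof -
  let ?S = "topspace X - {p}"
  have op: "openin X ?S" by (rule open_compl_p)
  have fc: "continuous_map X euclidean f" using f by (simp add: Cfun_def)
  have c: "continuous_map (subtopology X ?S) euclidean (\<lambda>z. of_real (a z) * f (\<phi> z))"
    by (rule continuous_map_mult'[OF continuous_map_from_subtopology[OF continuous_of_real_a]
      continuous_map_compose[OF cont_phi fc, unfolded o_def]])
  have "openin X {z \<in> topspace X. T f z \<in> U}" if "open U" for U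
  proof -
    have "openin (subtopology X ?S) {z \<in> topspace (subtopology X ?S). of_real (a z) * f (\<phi> z) \<in> U}"
      by (rule openin_continuous_map_preimage[OF c]) (use that open_openin in blast)
    then have "openin X {z \<in> ?S. of_real (a z) * f (\<phi> z) \<in> U}"
      using op by (simp add: openin_open_subtopology)
    moreover have "openin X (if \<Delta> f \<in> U then {p} else {})" using open_p by auto
    ultimately have "openin X ({z \<in> ?S. of_real (a z) * f (\<phi> z) \<in> U} \<union> (if \<Delta> f \<in> U then {p} else {}))"
      by blast
    moreover have "{z \<in> topspace X. T f z \<in> U} = {z \<in> ?S. of_real (a z) * f (\<phi> z) \<in> U} \<union> (if \<Delta> f \<in> U then {p} else {})"
      using p_in by (auto simp: T_def)
    ultimately show ?thesis by simp
  qed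
  then have "continuous_map X euclidean (T f)" by (simp add: continuous_map_def)
  then show ?thesis by (simp add: Cfun_def T_def)
qed

lemma T_linear_isometry: "linear_isometry X (T :: ('x \<Rightarrow> 'k::{real_normed_field,banach}) \<Rightarrow> _)"
  unfolding linear_isometry_def
proof (intro conjI ballI allI)
  fix f g :: "'x \<Rightarrow> 'k" and c :: 'k
  assume f: "f \<in> Cfun X"
  show "T f \<in> Cfun X" by (rule T_Cfun[OF f])
  show "T (\<lambda>z. c * f z) = (\<lambda>z. c * T f z)"
    by (rule ext) (simp add: T_def \<Delta>_cmult[OF f])
  show "sup_norm X (T f) = sup_norm X f"
  proof (rule antisym; rule sup_norm_le)
    fix z assume z: "z \<in> topspace X"
    show "norm (T f z) \<le> sup_norm X f"
    proof (cases "z = p")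
      case True
      then show ?thesis using \<Delta>_le[OF f] sup_norm_nonneg[OF f] by (simp add: T_p)
    next
      case False
      then show ?thesis using z Cfun_le[OF f phi_in] by (simp add: T_def norm_mult norm_a a_abs)
    qed
    \<comment> \<open>Each value of \<open>f\<close> reappears in modulus at
      \<open>\<psi> z\<close>, so the norm does not drop.\<close>
    have "norm (f z) = norm (T f (\<psi> z))"
      using z by (simp add: T_psi norm_mult a_abs psi_in)
    also have "\<dots> \<le> sup_norm X (T f)" by (rule Cfun_le[OF T_Cfun[OF f] psi_in[OF z]])
    finally show "norm (f z) \<le> sup_norm X (T f)" .
  qed
next
  fix f g :: "'x \<Rightarrow> 'k"
  assume f: "f \<in> Cfun X" and g: "g \<in> Cfun X"
  show "T (\<lambda>z. f z + g z) = (\<lambda>z. T f z + T g z)"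
    by (rule ext) (simp add: T_def \<Delta>_add[OF f g] distrib_left)
qed

text \<open>Away from \<open>p\<close> the equation \<open>T h = f\<close> has exactly one solution,
  so the value at \<open>p\<close> is the only obstruction, and the indicator of \<open>p\<close>
  spans a complement of the range.\<close>

lemma T_codimension: "codimension_one X (T ` (Cfun X :: ('x \<Rightarrow> 'k::{real_normed_field,banach}) set))"
proof -
  let ?g = "\<lambda>z. if z = p then 1 else 0 :: 'k"
  have "openin X {z \<in> topspace X. ?g z \<in> U}" for U
  proof -
    have "{z \<in> topspace X. ?g z \<in> U} =
      (if 1 \<in> U then {p} else {}) \<union> (if 0 \<in> U then topspace X - {p} else {})"
      using p_in by auto
    moreover have "openin X (if 1 \<in> U then {p} else {})" "openin X (if 0 \<in> U then topspace X - {p} else {})"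
      using open_p open_compl_p by simp_all
    ultimately show ?thesis by (simp only: openin_Un)
  qed
  then have g: "?g \<in> Cfun X" using p_in by (auto simp: Cfun_def continuous_map_def)
  have "?g \<notin> T ` Cfun X"
  proof
    assume "?g \<in> T ` Cfun X"
    then obtain h where h: "h \<in> Cfun X" and gh: "?g = T h" by blast
    have "h z = 0" if z: "z \<in> topspace X" for z
    proof -
      have "T h (\<psi> z) = 0" using psi_ne[OF z] fun_cong[OF gh, of "\<psi> z"] by simp
      then show ?thesis using T_psi[OF z, of h] a_abs[OF psi_in[OF z]] by auto
    qed
    then have "h (x m) = 0" if "m \<in> P" for m using that x_in by blast
    then have "(\<lambda>m. if m \<in> P then (1/4) ^ m *\<^sub>R h (x m) else 0) = (\<lambda>m. 0)" by auto
    then have "\<Delta> h = 0" unfolding \<Delta>_def by simp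
    moreover have "T h p = 1" using fun_cong[OF gh, of p] by simp
    ultimately show False by (simp add: T_p)
  qed
  moreover have "\<exists>c. (\<lambda>z. f z - c * ?g z) \<in> T ` Cfun X" if f: "f \<in> Cfun X" for f
  proof -
    \<comment> \<open>Inverts \<open>T\<close> off \<open>p\<close>: passing from \<open>z\<close>
      to \<open>\<psi> z\<close> undoes \<open>\<phi>\<close>, and the sign \<open>a\<close> is its
      own inverse.\<close>
    define h where "h z = (if z \<in> topspace X then of_real (a (\<psi> z)) * f (\<psi> z) else 0)" for z
    have fc: "continuous_map X euclidean f" using f by (simp add: Cfun_def)
    have "continuous_map X euclidean (\<lambda>z. of_real (a (\<psi> z)) * f (\<psi> z))"
      by (rule continuous_map_mult'[OF continuous_map_compose[OF cont_psi continuous_of_real_a, unfolded o_def]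
        continuous_map_compose[OF cont_psi fc, unfolded o_def]])
    then have "continuous_map X euclidean h"
      by (rule continuous_map_eq) (simp add: h_def)
    then have h: "h \<in> Cfun X" by (simp add: Cfun_def h_def)
    have "(\<lambda>z. f z - (f p - \<Delta> h) * ?g z) = T h"
    proof
      fix z
      show "f z - (f p - \<Delta> h) * ?g z = T h z"
        using f p_in by (auto simp: T_def h_def phi_in a_sq Cfun_def)
    qed
    then show ?thesis using h by blast
  qed
  ultimately show ?thesis unfolding codimension_one_def using g by blast
qed

section \<open>Functions lying in the range of every power of the operator\<close>

lemma T_pow_psi:
  assumes z: "z \<in> topspace X"
  shows "(T ^^ n) h ((\<psi> ^^ n) z) = of_real (\<Prod>i=1..n. a ((\<psi> ^^ i) z)) * h z"
proof (induction n)
  case (Suc n)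
  have "(T ^^ Suc n) h ((\<psi> ^^ Suc n) z) = of_real (a ((\<psi> ^^ Suc n) z)) * (T ^^ n) h ((\<psi> ^^ n) z)"
    using T_psi[OF psi_pow_in[OF z]] by simp
  then show ?case by (simp add: Suc)
qed auto

text \<open>The sign collected by \<open>x m\<close> in its first \<open>n\<close> steps. The
  product starts at \<open>i = 1\<close> because \<open>T\<close> weighs by \<open>a\<close> at the
  point of arrival.\<close>

definition cocycle :: "nat \<Rightarrow> nat \<Rightarrow> real" where
  "cocycle m n = (\<Prod>i=1..n. a ((\<psi> ^^ i) (x m)))"

lemma cocycle_abs: "m \<in> P \<Longrightarrow> \<bar>cocycle m n\<bar> = 1"
  by (simp add: cocycle_def abs_prod a_abs psi_pow_in x_in)

text \<open>Write \<open>f = (T ^^ Suc n) g\<close>. The weight is 1 along the orbit of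
  \<open>p\<close>, so \<open>T g p = \<Delta> g\<close> travels unchanged to
  \<open>(\<psi> ^^ n) p\<close>; the values \<open>g (x m)\<close> in \<open>\<Delta> g\<close> are
  recovered from \<open>f\<close> at \<open>(\<psi> ^^ Suc n) (x m)\<close>. Thus \<open>g\<close>,
  which depends on \<open>n\<close>, disappears.\<close>

lemma Inter_range_value:
  fixes f :: "'x \<Rightarrow> 'k::{real_normed_field,banach}"
  assumes f: "f \<in> (\<Inter>n\<in>{1..}. (T ^^ n) ` Cfun X)"
  shows "f ((\<psi> ^^ n) p) =
    (\<Sum>m. if m \<in> P then (1/4) ^ m *\<^sub>R (of_real (cocycle m (Suc n)) * f ((\<psi> ^^ Suc n) (x m))) else 0)"
proof -
  have "f \<in> (T ^^ Suc n) ` Cfun X" using INT_D[OF f, of "Suc n"] by (simp del: funpow.simps)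
  then obtain g where g: "f = (T ^^ Suc n) g" by blast
  have "f ((\<psi> ^^ n) p) = (T ^^ n) (T g) ((\<psi> ^^ n) p)" by (simp add: g funpow_swap1)
  also have "\<dots> = \<Delta> g" by (subst T_pow_psi[OF p_in]) (simp add: a_p T_p del: funpow.simps)
  also have "\<dots> = (\<Sum>m. if m \<in> P then (1/4) ^ m *\<^sub>R (of_real (cocycle m (Suc n)) * f ((\<psi> ^^ Suc n) (x m))) else 0)"
    unfolding \<Delta>_def
  proof (rule suminf_cong)
    fix m
    have "g (x m) = of_real (cocycle m (Suc n)) * f ((\<psi> ^^ Suc n) (x m))" if m: "m \<in> P"
    proof -
      let ?c = "cocycle m (Suc n)"
      have "f ((\<psi> ^^ Suc n) (x m)) = of_real ?c * g (x m)"
        unfolding g cocycle_def by (rule T_pow_psi[OF x_in[OF m]])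
      then have "of_real ?c * f ((\<psi> ^^ Suc n) (x m)) = of_real (?c * ?c) * g (x m)"
        by (simp only: of_real_mult mult.assoc)
      moreover have "?c * ?c = 1" using cocycle_abs[OF m, of "Suc n"] abs_mult_self_eq[of ?c] by simp
      ultimately show ?thesis by (simp only: of_real_1 mult_1_left)
    qed
    then show "(if m \<in> P then (1/4) ^ m *\<^sub>R g (x m) else 0) =
      (if m \<in> P then (1/4) ^ m *\<^sub>R (of_real (cocycle m (Suc n)) * f ((\<psi> ^^ Suc n) (x m))) else 0)"
      by auto
  qed
  finally show ?thesis .
qed


text \<open>The series of \<open>Inter_range_value\<close> is compared at the two times given by
  \<open>recurrent\<close>. The left sides nearly agree, being late terms of a convergent sequence;
  the terms below \<open>k\<close> nearly cancel; the two \<open>k\<close>-th terms reinforce each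
  other to about \<open>2 * (1/4) ^ k\<close> times the value in question; the later terms amount to
  at most \<open>2 * M * ((1/4) ^ k / 3)\<close>. Division by \<open>2 * (1/4) ^ k\<close> leaves
  \<open>M / 3\<close>.\<close>

lemma Inter_range_bound:
  fixes f :: "'x \<Rightarrow> 'k::{real_normed_field,banach}"
  assumes f: "f \<in> (\<Inter>n\<in>{1..}. (T ^^ n) ` Cfun X)" and fC: "f \<in> Cfun X" and k: "k \<in> P"
  shows "norm (f ((\<psi> ^^ j) (x k))) \<le> sup_norm X f / 3"
proof (rule field_le_epsilon)
  fix e :: real assume e: "e > 0"
  define M where "M = sup_norm X f"
  define F where "F = f ((\<psi> ^^ j) (x k))"
  \<comment> \<open>The estimate below loses at most \<open>4 * \<epsilon>\<close>, which becomes
    \<open>e\<close> after division by \<open>2 * (1/4) ^ k\<close>.\<close>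
  define \<epsilon> where "\<epsilon> = e / (2 * 4 ^ k)"
  have \<epsilon>: "\<epsilon> > 0" using e by (simp add: \<epsilon>_def)
  have fc: "continuous_map X euclidean f" using fC by (simp add: Cfun_def)
  have bM: "norm (f ((\<psi> ^^ n) (x m))) \<le> M" if "m \<in> P" for m n
    unfolding M_def by (rule Cfun_le[OF fC psi_pow_in[OF x_in[OF that]]])
  define t where "t m n = (if m \<in> P then (1/4) ^ m *\<^sub>R (of_real (cocycle m n) * f ((\<psi> ^^ n) (x m))) else 0)" for m n
  have st: "summable (\<lambda>m. t m n)" for n
    unfolding t_def
    by (rule summable_norm_cancel, rule summable_weighted(1)[where M = M])
      (simp add: norm_mult cocycle_abs bM)
  have D: "f ((\<psi> ^^ n) p) = (\<Sum>m. t m (Suc n))" for n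
    unfolding t_def by (rule Inter_range_value[OF f])
  have "(\<lambda>n. f ((\<psi> ^^ n) p)) \<longlonglongrightarrow> f l"
    using continuous_map_limit[OF fc lim] by (simp add: o_def)
  then have "Cauchy (\<lambda>n. f ((\<psi> ^^ n) p))" by (rule LIMSEQ_imp_Cauchy)
  then obtain B where B: "\<And>n n'. B \<le> n \<Longrightarrow> B \<le> n' \<Longrightarrow> norm (f ((\<psi> ^^ n) p) - f ((\<psi> ^^ n') p)) < \<epsilon>"
    using \<epsilon> by (metis CauchyD)
  define U where "U m = {z \<in> topspace X. f z \<in> ball (f ((\<psi> ^^ j) (x m))) \<epsilon>}" for m
  have U: "openin X (U m) \<and> (\<psi> ^^ j) (x m) \<in> U m" if "m \<in> P" for m
    unfolding U_def using openin_continuous_map_preimage[OF fc, of "ball _ \<epsilon>"] \<epsilon> psi_pow_in x_in that by auto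
  \<comment> \<open>The bound is \<open>Suc B\<close> because time \<open>n\<close> of the series
    belongs to the point \<open>(\<psi> ^^ (n - 1)) p\<close>.\<close>
  obtain n n' where nB: "Suc B \<le> n" "Suc B \<le> n'" and nn: "\<forall>m\<in>P. m \<le> k \<longrightarrow>
         (\<psi> ^^ n) (x m) \<in> U m \<and> (\<psi> ^^ n') (x m) \<in> U m \<and>
         cocycle m n = (if m = k then - 1 else 1) * cocycle m n'"
    using recurrent[OF k, where B = "Suc B" and U = U and j = j] U unfolding cocycle_def by blast
  \<comment> \<open>\<open>G\<close> is the ideal difference of the two \<open>k\<close>-th terms,
    \<open>v\<close> the error left at each index, and \<open>b\<close> a majorant of it: small from
    the returns up to \<open>k\<close>, and with the trivial bound \<open>2 * M\<close> added beyond
    \<open>k\<close>, where the returns are not controlled.\<close>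
  define G where "G = (2 * (1/4) ^ k) *\<^sub>R (of_real (cocycle k n) * F)"
  define v where "v m = t m n - t m n' - (if m = k then G else 0)" for m
  define b where "b m = 2 * \<epsilon> * (1/4) ^ m + 2 * M * (if m > k then (1/4) ^ m else 0)" for m
  have near: "norm (f z - f ((\<psi> ^^ j) (x m))) < \<epsilon>" if "z \<in> U m" for z m
    using that by (simp add: U_def dist_norm norm_minus_commute)
  have M0: "0 \<le> M" unfolding M_def by (rule sup_norm_nonneg[OF fC])
  have vb: "norm (v m) \<le> b m" for m
  proof -
    consider "m \<notin> P" | "m \<in> P" "m < k" | "m \<in> P" "m = k" | "m \<in> P" "k < m" by linarith
    then show ?thesis
    proof cases
      case 1
      then show ?thesis using k \<epsilon> M0 by (auto simp: v_def t_def b_def)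
    next
      case 2
      then have c: "cocycle m n = cocycle m n'" and z: "(\<psi> ^^ n) (x m) \<in> U m" "(\<psi> ^^ n') (x m) \<in> U m"
        using nn by auto
      have "v m = (1/4) ^ m *\<^sub>R (of_real (cocycle m n') * (f ((\<psi> ^^ n) (x m)) - f ((\<psi> ^^ n') (x m))))"
        using 2 c by (simp only: v_def t_def if_True scaleR_diff_right right_diff_distrib) simp
      then have "norm (v m) = (1/4) ^ m * norm (f ((\<psi> ^^ n) (x m)) - f ((\<psi> ^^ n') (x m)))"
        using cocycle_abs[OF 2(1), of n'] by (simp add: norm_mult)
      also have "\<dots> \<le> (1/4) ^ m * (2 * \<epsilon>)"
        using norm_triangle_ineq4[of "f ((\<psi> ^^ n) (x m)) - f ((\<psi> ^^ j) (x m))" "f ((\<psi> ^^ n') (x m)) - f ((\<psi> ^^ j) (x m))"]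
          near[OF z(1)] near[OF z(2)] by (intro mult_left_mono) auto
      finally show ?thesis using 2 by (simp add: b_def mult.commute)
    next
      case 3
      then have c: "cocycle m n' = - cocycle m n" and z: "(\<psi> ^^ n) (x m) \<in> U m" "(\<psi> ^^ n') (x m) \<in> U m"
        using nn by auto
      have "v m = (1/4) ^ m *\<^sub>R (of_real (cocycle m n) * ((f ((\<psi> ^^ n) (x m)) - F) + (f ((\<psi> ^^ n') (x m)) - F)))"
        using 3 unfolding v_def t_def G_def c
        by (simp add: algebra_simps scaleR_2 flip: scaleR_scaleR)
      then have "norm (v m) = (1/4) ^ m * norm ((f ((\<psi> ^^ n) (x m)) - F) + (f ((\<psi> ^^ n') (x m)) - F))"
        using cocycle_abs[OF 3(1), of n] by (simp add: norm_mult)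
      also have "\<dots> \<le> (1/4) ^ m * (2 * \<epsilon>)"
        using norm_triangle_ineq[of "f ((\<psi> ^^ n) (x m)) - F" "f ((\<psi> ^^ n') (x m)) - F"]
          near[OF z(1)] near[OF z(2)] 3 by (intro mult_left_mono) (auto simp: F_def)
      finally show ?thesis using 3 by (simp add: b_def mult.commute)
    next
      case 4
      have nt: "norm (t m i) \<le> (1/4) ^ m * M" for i
        using 4(1) cocycle_abs[OF 4(1), of i] bM[OF 4(1), of i]
        by (simp add: t_def norm_mult)
      have "norm (v m) \<le> norm (t m n) + norm (t m n')"
        using 4 by (simp add: v_def norm_triangle_ineq4)
      also have "\<dots> \<le> (1/4) ^ m * M + (1/4) ^ m * M" using nt by (intro add_mono)
      also have "\<dots> \<le> b m" using 4 \<epsilon> by (simp add: b_def)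
      finally show ?thesis .
    qed
  qed
  have "(\<lambda>i. (1/4) ^ Suc k * (1/4::real) ^ i) sums ((1/4) ^ Suc k * (1 / (1 - 1/4)))"
    by (intro sums_mult geometric_sums) simp
  then have "(\<lambda>m. if m > k then (1/4::real) ^ m else 0) sums ((1/4) ^ k / 3)"
    by (subst sums_zero_iff_shift[symmetric, of "Suc k"]) (auto simp: power_add mult.commute)
  then have bs: "b sums (2 * \<epsilon> * (1 / (1 - 1/4)) + 2 * M * ((1/4) ^ k / 3))"
    unfolding b_def by (intro sums_add sums_mult geometric_sums) simp_all
  have tsums: "(\<lambda>m. t m i) sums (\<Sum>m. t m i)" for i by (rule summable_sums[OF st])
  have "v sums ((\<Sum>m. t m n) - (\<Sum>m. t m n') - G)"
    unfolding v_def by (intro sums_diff tsums) (use sums_single[of k "\<lambda>_. G"] in simp)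
  then have "norm ((\<Sum>m. t m n) - (\<Sum>m. t m n') - G) \<le> 2 * \<epsilon> * (1 / (1 - 1/4)) + 2 * M * ((1/4) ^ k / 3)"
    using norm_suminf_le[OF vb sums_summable[OF bs]] by (simp add: sums_iff sums_unique[OF bs, symmetric])
  moreover have "norm ((\<Sum>m. t m n) - (\<Sum>m. t m n')) < \<epsilon>"
    using B[of "n - 1" "n' - 1"] nB D[of "n - 1"] D[of "n' - 1"] by simp
  moreover have "norm G = 2 * (1/4) ^ k * norm F"
    using cocycle_abs[OF k, of n] by (simp add: G_def norm_mult)
  ultimately have "2 * (1/4) ^ k * norm F \<le> 4 * \<epsilon> + 2 * M * ((1/4) ^ k / 3)"
    using norm_triangle_ineq2[of G "(\<Sum>m. t m n) - (\<Sum>m. t m n')"] \<epsilon> by (simp add: norm_minus_commute)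
  then have "norm F \<le> e + M / 3"
    by (simp add: \<epsilon>_def field_simps)
  then show "norm (f ((\<psi> ^^ j) (x k))) \<le> sup_norm X f / 3 + e" by (simp add: F_def M_def)
qed

text \<open>The bound \<open>M / 3\<close> holds on the orbits of the \<open>x m\<close> by
  \<open>Inter_range_bound\<close>, and on the orbit of \<open>p\<close> because the weights sum to
  at most 1/3. Density spreads it over the whole space, and \<open>M \<le> M / 3\<close> leaves only
  the zero function.\<close>

lemma T_Inter: "(\<Inter>n\<in>{1..}. (T ^^ n) ` Cfun X) = {\<lambda>_. 0 :: 'k::{real_normed_field,banach}}"
proof
  have zero: "(\<lambda>_. 0 :: 'k) \<in> Cfun X" by (simp add: Cfun_def)
  have "T (\<lambda>_. 0 :: 'k) = (\<lambda>_. 0)" using \<Delta>_cmult[OF zero, of 0] by (auto simp: T_def)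
  then have "(T ^^ n) (\<lambda>_. 0 :: 'k) = (\<lambda>_. 0)" for n by (induction n) auto
  then show "{\<lambda>_. 0 :: 'k} \<subseteq> (\<Inter>n\<in>{1..}. (T ^^ n) ` Cfun X)"
    using zero by (metis (no_types, lifting) INT_I image_eqI singletonD subsetI)
  show "(\<Inter>n\<in>{1..}. (T ^^ n) ` Cfun X) \<subseteq> {\<lambda>_. 0 :: 'k}"
  proof
    fix f :: "'x \<Rightarrow> 'k" assume f: "f \<in> (\<Inter>n\<in>{1..}. (T ^^ n) ` Cfun X)"
    then have "f \<in> (T ^^ 1) ` Cfun X" by blast
    then have fC: "f \<in> Cfun X" using T_Cfun by auto
    then have fc: "continuous_map X euclidean f" by (simp add: Cfun_def)
    define M where "M = sup_norm X f"
    define Q where "Q = {z \<in> topspace X. f z \<in> cball 0 (M/3)}"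
    have "closedin X Q"
      unfolding Q_def by (rule closedin_continuous_map_preimage[OF fc]) simp
    moreover have "norm (f ((\<psi> ^^ n) p)) \<le> M / 3" for n
      unfolding Inter_range_value[OF f]
    proof (rule summable_weighted(2))
      fix m assume m: "m \<in> P"
      show "norm (of_real (cocycle m (Suc n)) * f ((\<psi> ^^ Suc n) (x m))) \<le> M"
        using Cfun_le[OF fC psi_pow_in[OF x_in[OF m], of "Suc n"]] cocycle_abs[OF m, of "Suc n"]
        by (simp add: norm_mult M_def del: funpow.simps)
    qed
    then have "range (\<lambda>n. (\<psi> ^^ n) p) \<union> (\<Union>m\<in>P. range (\<lambda>n. (\<psi> ^^ n) (x m))) \<subseteq> Q"
      using Inter_range_bound[OF f fC] psi_pow_in p_in x_in by (auto simp: Q_def M_def)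
    ultimately have "topspace X \<subseteq> Q" using closure_of_minimal dense by metis
    then have M: "M \<le> M / 3" unfolding M_def by (intro sup_norm_le) (auto simp: Q_def M_def)
    have "norm (f z) \<le> 0" if "z \<in> topspace X" for z
      using Cfun_le[OF fC that] M unfolding M_def by linarith
    then have "f z = 0" for z using fC by (cases "z \<in> topspace X") (auto simp: Cfun_def)
    then show "f \<in> {\<lambda>_. 0}" by auto
  qed
qed

lemma T_isometric_shift: "isometric_shift X (T :: ('x \<Rightarrow> 'k::{real_normed_field,banach}) \<Rightarrow> _)"
  unfolding isometric_shift_def using T_linear_isometry T_codimension T_Inter by blast

lemma T_representation:
  "type_I_representation X (T :: ('x \<Rightarrow> 'k::{real_normed_field,banach}) \<Rightarrow> _) p \<phi> (\<lambda>z. of_real (a z))"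
  unfolding type_I_representation_def
  using p_in open_p homeomorphic_phi a_abs
  by (auto simp: T_def intro: continuous_map_from_subtopology[OF continuous_of_real_a])

lemma T_type_I0: "type_I0 X (T :: ('x \<Rightarrow> 'k::{real_normed_field,banach}) \<Rightarrow> _)"
proof -
  \<comment> \<open>The constant 1, cut off outside the carrier so as to belong to
    \<open>Cfun X\<close>; it tells \<open>\<Delta>\<close> from a unimodular multiple of an
    evaluation.\<close>
  let ?f = "\<lambda>z. if z \<in> topspace X then 1 else 0 :: 'k"
  have "continuous_map X euclidean ?f"
    by (rule continuous_map_eq[of _ _ "\<lambda>_. 1"]) auto
  then have f: "?f \<in> Cfun X" by (simp add: Cfun_def)
  have "sup_norm X ?f \<le> 1" by (rule sup_norm_le) auto
  then have lt: "norm (T ?f p) < 1" using \<Delta>_le[OF f] by (simp add: T_p)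
  have "\<not> type_II X (T :: ('x \<Rightarrow> 'k) \<Rightarrow> _)"
  proof
    assume "type_II X (T :: ('x \<Rightarrow> 'k) \<Rightarrow> _)"
    then obtain \<phi>' b where "\<phi>' ` topspace X = topspace X" "\<forall>z\<in>topspace X. norm (b z) = 1"
      "\<forall>f\<in>Cfun X. \<forall>z\<in>topspace X. T f z = b z * (f (\<phi>' z) :: 'k)"
      unfolding type_II_def by blast
    then have "norm (T ?f p) = 1" using f p_in by (auto simp: norm_mult)
    with lt show False by simp
  qed
  then show ?thesis
    unfolding type_I0_def type_I_def using T_isometric_shift T_representation by blast
qed

subsection \<open>Generation\<close>

text \<open>The set \<open>A\<close> is left open since \<open>\<phi>\<close> is inverted on the
  complement of \<open>p\<close> in \<open>shift_points\<close> but on \<open>R\<close> in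
  \<open>int_iterate\<close>.\<close>

lemma inv_phi: "A \<subseteq> topspace X - {p} \<Longrightarrow> z \<in> topspace X \<Longrightarrow> \<psi> z \<in> A \<Longrightarrow> inv_into A \<phi> z = \<psi> z"
  using homeomorphic_phi
  by (intro inv_into_f_eq) (auto simp: homeomorphic_map_def intro: inj_on_subset)

lemma inv_pow_p: "(inv_into (topspace X - {p}) \<phi> ^^ n) p = (\<psi> ^^ n) p"
  by (induction n) (auto simp: inv_phi psi_in psi_ne psi_pow_in p_in)

lemma shift_points_eq: "shift_points X p \<phi> = range (\<lambda>n. (\<psi> ^^ n) p)"
  by (simp add: shift_points_def inv_pow_p)

abbreviation R :: "'x set" where "R \<equiv> shift_rest X p \<phi>"

lemma R_eq: "R = topspace X - X closure_of range (\<lambda>n. (\<psi> ^^ n) p)"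
  by (simp add: shift_rest_def shift_points_eq)

lemma p_notin_R: "p \<notin> R"
proof -
  have "range (\<lambda>n. (\<psi> ^^ n) p) \<subseteq> X closure_of range (\<lambda>n. (\<psi> ^^ n) p)"
    using psi_pow_in[OF p_in] by (intro closure_of_subset) blast
  moreover have "p \<in> range (\<lambda>n. (\<psi> ^^ n) p)" using rangeI[of "\<lambda>n. (\<psi> ^^ n) p" 0] by simp
  ultimately show ?thesis unfolding R_eq by blast
qed

lemma R_sub: "R \<subseteq> topspace X - {p}"
  using p_notin_R by (auto simp: shift_rest_def)

lemma C_sub_R: "m \<in> P \<Longrightarrow> C m \<subseteq> R"
  using closure_p_C C_sub unfolding R_eq by blast

text \<open>\<open>\<psi>\<close> maps the closure of the orbit of \<open>p\<close> into itself, so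
  a point outside this closure cannot have its \<open>\<phi>\<close>-image inside.\<close>

lemma phi_R: "z \<in> R \<Longrightarrow> \<phi> z \<in> R"
proof -
  let ?N = "range (\<lambda>n. (\<psi> ^^ n) p)"
  assume z: "z \<in> R"
  then have zX: "z \<in> topspace X" "z \<noteq> p" using R_sub by auto
  have "\<phi> z \<notin> X closure_of ?N"
  proof
    assume "\<phi> z \<in> X closure_of ?N"
    then have "\<psi> (\<phi> z) \<in> X closure_of (\<psi> ` ?N)"
      using cont_psi unfolding continuous_map_eq_image_closure_subset by blast
    moreover have "\<psi> ((\<psi> ^^ n) p) \<in> ?N" for n
      using rangeI[of "\<lambda>n. (\<psi> ^^ n) p" "Suc n"] by simp
    then have "\<psi> ` ?N \<subseteq> ?N" by blast
    ultimately show False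
      using z zX closure_of_mono[of "\<psi> ` ?N" ?N X] unfolding R_eq by auto
  qed
  then show ?thesis using zX phi_in by (simp add: R_eq)
qed

text \<open>This direction uses that \<open>\<psi>\<close> is open: a neighbourhood of
  \<open>z\<close> has an open image around \<open>\<psi> z\<close>, which meets the orbit of
  \<open>p\<close>. As \<open>p\<close> is not a value of \<open>\<psi>\<close>, the orbit point
  found can be pulled back by one step.\<close>

lemma psi_R: "z \<in> R \<Longrightarrow> \<psi> z \<in> R"
proof -
  let ?N = "range (\<lambda>n. (\<psi> ^^ n) p)"
  assume z: "z \<in> R"
  then have zX: "z \<in> topspace X" using R_sub by auto
  have "\<psi> z \<notin> X closure_of ?N"
  proof
    assume cl: "\<psi> z \<in> X closure_of ?N"
    have "z \<in> X closure_of ?N" unfolding in_closure_of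
    proof (intro conjI allI impI zX)
      fix V assume V: "z \<in> V \<and> openin X V"
      have "open_map X (subtopology X (topspace X - {p})) \<psi>"
        using maps by (meson homeomorphic_imp_open_map homeomorphic_maps_map)
      then have "openin X (\<psi> ` V)"
        using V open_compl_p by (simp add: open_map_def openin_open_subtopology)
      then obtain n where n: "(\<psi> ^^ n) p \<in> \<psi> ` V"
        using cl V unfolding in_closure_of by blast
      then obtain v where v: "v \<in> V" "(\<psi> ^^ n) p = \<psi> v" by blast
      have vX: "v \<in> topspace X" using v V openin_subset by blast
      then have "n \<noteq> 0" using v(2) psi_ne by (metis funpow_0)
      then obtain i where "n = Suc i" using not0_implies_Suc by blast
      then have "\<psi> v = \<psi> ((\<psi> ^^ i) p)" using v(2) by simp
      then have "v = (\<psi> ^^ i) p" using phi_psi[OF vX] phi_psi[OF psi_pow_in[OF p_in]] by metis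
      then show "\<exists>y. y \<in> ?N \<and> y \<in> V" using v by blast
    qed
    then show False using z by (simp add: R_eq)
  qed
  then show ?thesis using zX psi_in by (simp add: R_eq)
qed

text \<open>Each \<open>C m\<close> is invariant in both directions, so an orbit can neither enter
  nor leave it.\<close>

lemma int_iterate_in_C:
  assumes m: "m \<in> P" and z: "z \<in> R" and c: "int_iterate R \<phi> k z \<in> C m"
  shows "z \<in> C m"
proof -
  have R: "(\<phi> ^^ n) z \<in> R" "(\<psi> ^^ n) z \<in> R" for n
    using z by (induction n) (auto intro: phi_R psi_R)
  have inv: "(inv_into R \<phi> ^^ n) z = (\<psi> ^^ n) z" for n
  proof (induction n)
    case (Suc n)
    have "(\<psi> ^^ n) z \<in> R" "\<psi> ((\<psi> ^^ n) z) \<in> R" using R(2)[of n] R(2)[of "Suc n"] by auto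
    then show ?case using Suc R_sub inv_phi[of R "(\<psi> ^^ n) z"] by auto
  qed auto
  have 1: "(\<phi> ^^ n) z \<in> C m \<Longrightarrow> z \<in> C m" for n
  proof (induction n)
    case (Suc n)
    have "(\<phi> ^^ n) z \<in> topspace X - {p}" using R(1)[of n] R_sub by blast
    then have "(\<phi> ^^ n) z = \<psi> ((\<phi> ^^ Suc n) z)" by simp
    then show ?case using Suc psi_C[OF m] by blast
  qed auto
  have 2: "(\<psi> ^^ n) z \<in> C m \<Longrightarrow> z \<in> C m" for n
  proof (induction n)
    case (Suc n)
    have "(\<psi> ^^ n) z \<in> topspace X" using R(2)[of n] R_sub by blast
    then have "(\<psi> ^^ n) z = \<phi> ((\<psi> ^^ Suc n) z)" by simp
    then show ?case using Suc phi_C_mem[OF m] by metis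
  qed auto
  show ?thesis using c 1 2 inv by (auto simp: int_iterate_def split: if_splits)
qed

text \<open>Each \<open>C m\<close> is a nonempty open part of \<open>R\<close>, so a generating
  orbit meets it and the generator lies in it. As the \<open>C m\<close> are disjoint, distinct
  blocks need distinct generators.\<close>

lemma generated_by_card:
  assumes "generated_by X p \<phi> n"
  shows "finite P \<and> card P \<le> n"
proof -
  obtain y where y: "y ` {1..n} \<subseteq> R" and cl: "subtopology X R closure_of
          {int_iterate R \<phi> k (y i) | k i. i \<in> {1..n}} = R"
    using assms unfolding generated_by_def by blast
  have "\<exists>i\<in>{1..n}. y i \<in> C m" if m: "m \<in> P" for m
  proof -
    have "x m \<in> subtopology X R closure_of {int_iterate R \<phi> k (y i) | k i. i \<in> {1..n}}"
      using cl C_sub_R[OF m] x_C[OF m] by auto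
    moreover have "openin (subtopology X R) (C m)"
      using open_C[OF m] C_sub_R[OF m] by (auto simp: openin_subtopology)
    ultimately obtain k i where "i \<in> {1..n}" "int_iterate R \<phi> k (y i) \<in> C m"
      using x_C[OF m] unfolding in_closure_of by blast
    then show ?thesis using int_iterate_in_C[OF m] y by blast
  qed
  then obtain i where i: "\<And>m. m \<in> P \<Longrightarrow> i m \<in> {1..n} \<and> y (i m) \<in> C m" by metis
  have "inj_on i P"
  proof (rule inj_onI)
    fix m m' assume mm: "m \<in> P" "m' \<in> P" "i m = i m'"
    then have "y (i m) \<in> C m \<inter> C m'" using i[of m] i[of m'] by simp
    then show "m = m'" using disjoint_C mm by (auto simp: disjoint_family_on_def)
  qed
  moreover have "i ` P \<subseteq> {1..n}" using i by blast
  ultimately show ?thesis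
    by (metis card_atLeastAtMost card_inj_on_le diff_Suc_1 finite_atLeastAtMost finite_imageD finite_subset)
qed

text \<open>The points \<open>x m\<close> themselves generate: \<open>R\<close> avoids the closure
  of the orbit of \<open>p\<close>, so of all orbits in \<open>dense\<close> those of the
  \<open>x m\<close> must already be dense in \<open>R\<close>.\<close>

lemma generated_by_orbits:
  assumes P: "P = {1..n}"
  shows "generated_by X p \<phi> n"
proof -
  let ?N = "range (\<lambda>n. (\<psi> ^^ n) p)" and ?O = "\<Union>m\<in>P. range (\<lambda>n. (\<psi> ^^ n) (x m))"
  let ?S = "{int_iterate R \<phi> k (x i) | k i. i \<in> {1..n}}"
  have inv: "(inv_into R \<phi> ^^ j) (x m) = (\<psi> ^^ j) (x m)" if m: "m \<in> P" for m j
  proof (induction j)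
    case (Suc j)
    have "\<psi> ((\<psi> ^^ j) (x m)) \<in> R"
      using psi_C_mem[OF m x_C[OF m], of "Suc j"] C_sub_R[OF m] by auto
    then show ?case using Suc R_sub inv_phi[of R "(\<psi> ^^ j) (x m)"] psi_pow_in[OF x_in[OF m]] by auto
  qed auto
  have OS: "?O \<subseteq> ?S"
  proof
    fix z assume "z \<in> ?O"
    then obtain m j where m: "m \<in> P" and z: "z = (\<psi> ^^ j) (x m)" by auto
    \<comment> \<open>Forward steps of \<open>\<psi>\<close> are negative iterates of
      \<open>\<phi>\<close>; exponent 0 falls into the other branch of the definition and is treated
      apart.\<close>
    have "int_iterate R \<phi> (- int j) (x m) = z"
      using inv[OF m, of j] by (cases "j = 0") (auto simp: int_iterate_def z)
    then show "z \<in> ?S" using m P by blast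
  qed
  have "R \<subseteq> X closure_of ?O"
  proof
    fix z assume z: "z \<in> R"
    then have "z \<in> X closure_of (?N \<union> ?O)" using dense R_sub by auto
    then show "z \<in> X closure_of ?O" using z by (simp only: closure_of_Un R_eq) blast
  qed
  moreover have OR: "?O \<subseteq> R" using psi_C_mem x_C C_sub_R by blast
  ultimately have "R \<subseteq> subtopology X R closure_of ?O"
    by (simp add: closure_of_subtopology inf_absorb2)
  then have "R \<subseteq> subtopology X R closure_of ?S" using closure_of_mono[OF OS] by blast
  moreover have "subtopology X R closure_of ?S \<subseteq> R"
    using closure_of_subset_topspace[of "subtopology X R" ?S] by auto
  moreover have "x ` {1..n} \<subseteq> R" using P x_C C_sub_R by blast
  ultimately show ?thesis unfolding generated_by_def by blast
qed

lemma T_generated: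
  assumes "initial_subset P"
  shows "generated_shift X (T :: ('x \<Rightarrow> 'k::{real_normed_field,banach}) \<Rightarrow> _) (ecard P)"
proof -
  have "X closure_of shift_points X p \<phi> \<noteq> topspace X"
    using P_nonempty x_C C_sub_R R_eq shift_points_eq by fastforce
  moreover have "case ecard P of enat n \<Rightarrow> least_generated_by X p \<phi> n
                 | \<infinity> \<Rightarrow> \<forall>n. \<not> least_generated_by X p \<phi> n"
  proof (cases "finite P")
    case True
    \<comment> \<open>An initial subset is closed downwards to 1, so a finite one is the interval
      \<open>{1..card P}\<close> that \<open>generated_by_orbits\<close> expects.\<close>
    have sub: "n \<in> P \<Longrightarrow> {1..n} \<subseteq> P" for n
    proof (induction n)
      case (Suc n)
      then have "n = 0 \<or> n \<in> P" using assms unfolding initial_subset_def by force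
      then show ?case using Suc by (auto simp: atLeastAtMostSuc_conv)
    qed auto
    have "n \<in> {1..Max P}" if "n \<in> P" for n
      using that P_pos Max_ge[OF True that] by (cases n) auto
    then have "P = {1..Max P}" using sub[OF Max_in[OF True P_nonempty]] by blast
    then have P: "P = {1..card P}" by (metis card_atLeastAtMost diff_Suc_1)
    have "1 \<le> card P" using True P_nonempty by (simp add: Suc_le_eq card_gt_0_iff)
    then have "least_generated_by X p \<phi> (card P)"
      unfolding least_generated_by_def using generated_by_orbits[OF P] generated_by_card by force
    then show ?thesis using True by (simp add: ecard_def)
  next
    case False
    then show ?thesis using generated_by_card by (auto simp: ecard_def least_generated_by_def)
  qed
  ultimately show ?thesis unfolding generated_shift_def
    using T_type_I0 T_representation by (fastforce simp: type_I0_def)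
qed

lemma admits_generated_shift:
  "initial_subset P \<Longrightarrow> admits_generated_I0_shift TYPE('k::{real_normed_field,banach}) X (ecard P)"
  unfolding admits_generated_I0_shift_def using T_type_I0 T_generated by blast

end

text \<open>Conjugation by a homeomorphism; it moves the model from the space of blocks to a carrier
  of type \<open>point\<close> or to a subset of \<open>ell2\<close>.\<close>

lemma shift_model_homeomorphic:
  assumes "shift_model X P p \<phi> \<psi> a l x C" and hg: "homeomorphic_maps X Y h g"
  shows "shift_model Y P (h p) (h \<circ> \<phi> \<circ> g) (h \<circ> \<psi> \<circ> g) (a \<circ> g) (h l) (h \<circ> x) (\<lambda>m. h ` C m)"
proof -
  interpret shift_model X P p \<phi> \<psi> a l x C by fact
  have h: "homeomorphic_map X Y h" and hc: "continuous_map X Y h" and gc: "continuous_map Y X g"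
    using hg by (auto simp: homeomorphic_maps_map homeomorphic_imp_continuous_map)
  have gh: "g (h z) = z" if "z \<in> topspace X" for z
    using hg that by (simp add: homeomorphic_maps_def)
  have h_in: "h z \<in> topspace Y" if "z \<in> topspace X" for z
    using that hc by (auto simp: continuous_map_def)
  have g_in: "g z \<in> topspace X" if "z \<in> topspace Y" for z
    using that gc by (auto simp: continuous_map_def)
  have hg': "h (g z) = z" if "z \<in> topspace Y" for z
    using hg that by (simp add: homeomorphic_maps_def)
  have h_open: "openin Y (h ` S)" if "openin X S" for S
    using that h homeomorphic_map_openness openin_subset by blast
  have inj: "h z = h w \<longleftrightarrow> z = w" if "z \<in> topspace X" "w \<in> topspace X" for z w
    using gh that by metis
  let ?\<psi> = "h \<circ> \<psi> \<circ> g"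
  have pow: "(?\<psi> ^^ n) (h z) = h ((\<psi> ^^ n) z)" if "z \<in> topspace X" for n z
    by (induction n) (simp_all add: gh psi_pow_in[OF that])
  have pow_p: "(?\<psi> ^^ n) (h p) = h ((\<psi> ^^ n) p)" for n by (rule pow[OF p_in])
  have pow_x: "(?\<psi> ^^ n) ((h \<circ> x) m) = h ((\<psi> ^^ n) (x m))" if "m \<in> P" for n m
    using pow[OF x_in[OF that]] by simp
  show ?thesis
  proof
    show "compact_space Y" "Hausdorff_space Y"
      using h compact_X Hausdorff_X homeomorphic_compact_space homeomorphic_Hausdorff_space
        homeomorphic_map_imp_homeomorphic_space by blast+
    show "P \<noteq> {}" "0 \<notin> P" by (fact P_nonempty, fact P_pos)
    show "openin Y {h p}" using h_open[OF open_p] by simp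
    have im: "h ` (topspace X \<inter> (topspace X - {p})) = topspace Y \<inter> (topspace Y - {h p})"
    proof (intro equalityI subsetI)
      fix w assume "w \<in> topspace Y \<inter> (topspace Y - {h p})"
      then show "w \<in> h ` (topspace X \<inter> (topspace X - {p}))"
        using hg'[of w] g_in[of w] by (intro image_eqI[of _ _ "g w"]) auto
    qed (use h_in inj p_in in auto)
    have 1: "homeomorphic_maps (subtopology X (topspace X - {p})) (subtopology Y (topspace Y - {h p})) h g"
      by (rule homeomorphic_maps_subtopologies[OF hg im])
    have 2: "homeomorphic_maps Y X g h" using hg homeomorphic_maps_sym by blast
    have "homeomorphic_maps Y (subtopology Y (topspace Y - {h p})) (h \<circ> (\<psi> \<circ> g)) ((h \<circ> \<phi>) \<circ> g)"
      by (rule homeomorphic_maps_compose[OF conjI[OF homeomorphic_maps_compose[OF conjI[OF 2 maps]] 1]])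
    then show "homeomorphic_maps Y (subtopology Y (topspace Y - {h p})) (h \<circ> \<psi> \<circ> g) (h \<circ> \<phi> \<circ> g)"
      by (simp add: comp_assoc)
    show "continuous_map Y euclideanreal (a \<circ> g)"
      using continuous_map_compose[OF gc a_cont] .
    show "\<bar>(a \<circ> g) z\<bar> = 1" if "z \<in> topspace Y" for z
      using a_abs g_in that by simp
    show "limitin Y (\<lambda>n. (?\<psi> ^^ n) (h p)) (h l) sequentially"
      using continuous_map_limit[OF hc lim] by (simp only: pow_p) (simp add: o_def)
    show "(a \<circ> g) ((?\<psi> ^^ n) (h p)) = 1" for n
      by (simp only: pow_p o_apply gh[OF psi_pow_in[OF p_in]] a_p)
    show "openin Y (h ` C m)" "(h \<circ> x) m \<in> h ` C m" if "m \<in> P" for m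
      using h_open[OF open_C[OF that]] x_C[OF that] by auto
    show "?\<psi> ` h ` C m = h ` C m" if m: "m \<in> P" for m
    proof -
      have "?\<psi> ` h ` C m = h ` \<psi> ` C m"
        using C_sub[OF m] gh by (force simp: image_image)
      then show ?thesis by (simp add: psi_C m)
    qed
    show "h p \<notin> h ` C m" if "m \<in> P" for m
      using p_C[OF that] C_sub[OF that] inj p_in by blast
    show "disjoint_family_on (\<lambda>m. h ` C m) P"
      unfolding disjoint_family_on_def
    proof (intro ballI impI)
      fix m n assume mn: "m \<in> P" "n \<in> P" "m \<noteq> n"
      then have "C m \<inter> C n = {}" using disjoint_C by (auto simp: disjoint_family_on_def)
      then show "h ` C m \<inter> h ` C n = {}"
        using inj_on_image_Int[of h "topspace X" "C m" "C n"] C_sub mn inj by (auto simp: inj_on_def)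
    qed
    have "Y closure_of (range (\<lambda>n. (?\<psi> ^^ n) (h p)) \<union> (\<Union>m\<in>P. range (\<lambda>n. (?\<psi> ^^ n) ((h \<circ> x) m))))
      = Y closure_of (h ` (range (\<lambda>n. (\<psi> ^^ n) p) \<union> (\<Union>m\<in>P. range (\<lambda>n. (\<psi> ^^ n) (x m)))))"
      by (simp only: pow_p pow_x image_Un image_UN image_image cong: SUP_cong)
    also have "\<dots> = h ` topspace X"
      by (subst homeomorphic_map_closure_of[OF h]) (use psi_pow_in p_in x_in in blast, simp only: dense)
    also have "\<dots> = topspace Y" using h homeomorphic_imp_surjective_map by blast
    finally show "Y closure_of (range (\<lambda>n. (?\<psi> ^^ n) (h p)) \<union> (\<Union>m\<in>P. range (\<lambda>n. (?\<psi> ^^ n) ((h \<circ> x) m)))) = topspace Y" .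
    fix k j B U
    assume k: "k \<in> P" and U: "\<And>m. \<lbrakk>m \<in> P; m \<le> k\<rbrakk> \<Longrightarrow> openin Y (U m) \<and> (?\<psi> ^^ j) ((h \<circ> x) m) \<in> U m"
    define V where "V m = {z \<in> topspace X. h z \<in> U m}" for m
    have V: "openin X (V m) \<and> (\<psi> ^^ j) (x m) \<in> V m" if "m \<in> P" "m \<le> k" for m
      using U[OF that] openin_continuous_map_preimage[OF hc] psi_pow_in[OF x_in[OF that(1)]]
      unfolding pow_x[OF that(1)] V_def by simp
    obtain n n' where n: "B \<le> n" "B \<le> n'" "\<forall>m\<in>P. m \<le> k \<longrightarrow>
         (\<psi> ^^ n) (x m) \<in> V m \<and> (\<psi> ^^ n') (x m) \<in> V m \<and>
         (\<Prod>i=1..n. a ((\<psi> ^^ i) (x m))) = (if m = k then - 1 else 1) * (\<Prod>i=1..n'. a ((\<psi> ^^ i) (x m)))"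
      using recurrent[where k = k and U = V and B = B and j = j] k V by blast
    have ag: "(a \<circ> g) (h ((\<psi> ^^ i) (x m))) = a ((\<psi> ^^ i) (x m))" if "m \<in> P" for i m
      by (simp add: gh psi_pow_in x_in that)
    show "\<exists>n n'. B \<le> n \<and> B \<le> n' \<and> (\<forall>m\<in>P. m \<le> k \<longrightarrow>
         (?\<psi> ^^ n) ((h \<circ> x) m) \<in> U m \<and> (?\<psi> ^^ n') ((h \<circ> x) m) \<in> U m \<and>
         (\<Prod>i=1..n. (a \<circ> g) ((?\<psi> ^^ i) ((h \<circ> x) m))) =
         (if m = k then - 1 else 1) * (\<Prod>i=1..n'. (a \<circ> g) ((?\<psi> ^^ i) ((h \<circ> x) m))))"
      by (rule exI[of _ n], rule exI[of _ n']) (use n in \<open>simp add: ag pow_x V_def del: comp_apply o_apply\<close>)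
  qed
qed

subsection \<open>Carriers for compact spaces\<close>

text \<open>A point is coded by the traces of its open neighbourhoods on a countable dense set, each
  trace being a set of naturals; in a Hausdorff space the code determines the point.\<close>

lemma separable_Hausdorff_imp_point_copy:
  fixes X :: "'x topology"
  assumes "Hausdorff_space X" and D: "countable D" "X closure_of D = topspace X"
  obtains Y :: "nat set set topology" and h g where "homeomorphic_maps X Y h g"
proof -
  define D' where "D' = D \<inter> topspace X"
  have D': "countable D'" "X closure_of D' = topspace X"
    using D closure_of_restrict[of X D] by (auto simp: D'_def Int_commute)
  define h where "h z = {to_nat_on D' ` (U \<inter> D') | U. openin X U \<and> z \<in> U}" for z
  have inj: "inj_on h (topspace X)"
  proof (rule inj_onI, rule ccontr)
    fix z w assume zw: "z \<in> topspace X" "w \<in> topspace X" "h z = h w" "z \<noteq> w"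
    then obtain U V where UV: "openin X U" "openin X V" "z \<in> U" "w \<in> V" "disjnt U V"
      using assms(1) unfolding Hausdorff_space_def by meson
    then have "to_nat_on D' ` (U \<inter> D') \<in> h w" using zw(3) unfolding h_def by blast
    then obtain U' where U': "openin X U'" "w \<in> U'" "to_nat_on D' ` (U \<inter> D') = to_nat_on D' ` (U' \<inter> D')"
      unfolding h_def by blast
    have eq: "U \<inter> D' = U' \<inter> D'"
      using U'(3) inj_on_image_eq_iff[OF inj_on_to_nat_on[OF D'(1)], of "U \<inter> D'" "U' \<inter> D'"] by simp
    \<comment> \<open>\<open>U'\<close> and \<open>V\<close> are neighbourhoods of \<open>w\<close>
      and share a point of the dense set; equality of the traces puts it into \<open>U\<close> as
      well, although \<open>U\<close> and \<open>V\<close> are disjoint.\<close>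
    have "w \<in> X closure_of D'" "openin X (U' \<inter> V)" "w \<in> U' \<inter> V"
      using zw UV U' D' by auto
    then obtain d where "d \<in> D'" "d \<in> U' \<inter> V" unfolding in_closure_of by blast
    then show False using eq UV(5) unfolding disjnt_def by blast
  qed
  define g where "g = inv_into (topspace X) h"
  \<comment> \<open>The topology is carried over along the decoding map \<open>g\<close>, which
    makes \<open>h\<close> a homeomorphism onto its image.\<close>
  define Y where "Y = pullback_topology (h ` topspace X) g X"
  have gh: "g (h z) = z" if "z \<in> topspace X" for z
    using inj that by (simp add: g_def)
  have tY: "topspace Y = h ` topspace X"
    unfolding Y_def topspace_pullback_topology using gh by auto
  have "homeomorphic_maps X Y h g"
    unfolding homeomorphic_maps_def
  proof (intro conjI ballI)
    show "continuous_map Y X g" unfolding Y_def using continuous_map_pullback continuous_map_id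
      by (metis comp_id id_comp)
    have "continuous_map X X (g \<circ> h)" by (rule continuous_map_eq[OF continuous_map_id]) (simp add: gh)
    then show "continuous_map X Y h" unfolding Y_def by (rule continuous_map_pullback') auto
  qed (auto simp: gh tY)
  then show ?thesis by (rule that)
qed

text \<open>Damping the \<open>i\<close>-th function by \<open>(1/2) ^ i\<close> places the
  evaluation map in \<open>ell2\<close>; as a continuous injection of a compact space into a
  Hausdorff space it is an embedding.\<close>

lemma separated_imp_ell2_copy:
  fixes X :: "'x topology" and F :: "nat \<Rightarrow> 'x \<Rightarrow> real"
  assumes X: "compact_space X" and F: "\<And>i. continuous_map X euclideanreal (F i)"
    and F01: "\<And>i z. z \<in> topspace X \<Longrightarrow> F i z \<in> {0..1}"
    and sep: "\<And>z w. z \<in> topspace X \<Longrightarrow> w \<in> topspace X \<Longrightarrow> z \<noteq> w \<Longrightarrow> \<exists>i. F i z \<noteq> F i w"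
  obtains S h g where "S \<subseteq> ell2" "homeomorphic_maps X (subtopology ell2_topology S) h g"
proof -
  define h where "h z i = (1/2) ^ i * F i z" for z i
  have pw: "((1/2) ^ i)\<^sup>2 = (1/4::real) ^ i" for i by (simp add: power2_eq_square flip: power_mult_distrib)
  have sg: "summable (\<lambda>i. (1/4::real) ^ i)" by (rule summable_geometric) simp
  have h_ell: "h z \<in> ell2" if "z \<in> topspace X" for z
    unfolding ell2_iff_summable
  proof (rule summable_comparison_test'[OF sg, of 0])
    fix i
    have "(F i z)\<^sup>2 \<le> 1\<^sup>2" using F01[OF that, of i] by (intro power_mono) auto
    then show "norm ((h z i)\<^sup>2) \<le> (1/4) ^ i"
      by (simp add: h_def power_mult_distrib pw mult_left_le)
  qed
  have cont: "continuous_map X ell2_topology h"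
    unfolding ell2_topology_def ell2.continuous_map_to_metric
  proof (intro ballI allI impI)
    fix z and \<epsilon> :: real assume z: "z \<in> topspace X" and \<epsilon>: "\<epsilon> > 0"
    have "(\<lambda>n. \<Sum>i. (1/4::real) ^ (i + n)) \<longlonglongrightarrow> 0"
      by (rule suminf_exist_split2[OF sg])
    moreover have e2: "0 < \<epsilon>\<^sup>2 / 2" using \<epsilon> by simp
    ultimately obtain n where n: "(\<Sum>i. (1/4::real) ^ (i + n)) < \<epsilon>\<^sup>2 / 2"
      by (metis (mono_tags, lifting) eventually_sequentially order_refl order_tendstoD(2))
    \<comment> \<open>A neighbourhood has to control the first \<open>n\<close> coordinates only;
      the others contribute less than \<open>\<epsilon>\<^sup>2 / 2\<close> since all functions take
      values in the unit interval.\<close>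
    define G where "G w = (\<Sum>i<n. (1/4) ^ i * (F i z - F i w)\<^sup>2)" for w
    have "continuous_map X euclideanreal G"
      unfolding G_def by (intro continuous_intros F) auto
    then have "openin X {w \<in> topspace X. G w \<in> {..<\<epsilon>\<^sup>2 / 2}}"
      by (rule openin_continuous_map_preimage) simp
    moreover have "z \<in> {w \<in> topspace X. G w \<in> {..<\<epsilon>\<^sup>2 / 2}}" using z e2 by (simp add: G_def)
    moreover have "h w \<in> ell2.mball (h z) \<epsilon>" if "w \<in> {w \<in> topspace X. G w \<in> {..<\<epsilon>\<^sup>2 / 2}}" for w
    proof -
      have w: "w \<in> topspace X" "G w < \<epsilon>\<^sup>2 / 2" using that by auto
      define d where "d i = (h z i - h w i)\<^sup>2" for i
      have d: "d i = (1/4) ^ i * (F i z - F i w)\<^sup>2" for i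
        by (simp add: d_def h_def power_mult_distrib pw flip: right_diff_distrib)
      have db: "norm (d i) \<le> (1/4) ^ i" for i
      proof -
        have "(F i z - F i w)\<^sup>2 \<le> 1" using F01[OF z, of i] F01[OF w(1), of i]
          by (auto simp: abs_square_le_1 abs_le_iff)
        then show ?thesis by (simp add: d mult_left_le)
      qed
      have sd: "summable d" by (rule summable_comparison_test'[OF sg, of 0]) (use db in auto)
      have "suminf d = (\<Sum>i. d (i + n)) + (\<Sum>i<n. d i)"
        by (rule suminf_split_initial_segment[OF sd])
      also have "(\<Sum>i. d (i + n)) \<le> (\<Sum>i. (1/4) ^ (i + n))"
        using db by (intro suminf_le) (auto simp: sd sg summable_ignore_initial_segment abs_le_iff)
      finally have "suminf d < \<epsilon>\<^sup>2" using n w(2) by (simp add: G_def d)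
      moreover have "(\<lambda>i. h z i - h w i) \<in> ell2" using sd by (simp add: ell2_iff_summable d_def[abs_def])
      ultimately have "ell2_dist (h z) (h w) < \<epsilon>"
        using \<epsilon> by (simp add: ell2_dist_def ell2_norm_suminf d_def[abs_def] real_less_lsqrt)
      then show ?thesis using h_ell z w by simp
    qed
    ultimately show "\<exists>U. openin X U \<and> z \<in> U \<and> (\<forall>w\<in>U. h w \<in> ell2.mball (h z) \<epsilon>)"
      by (intro exI[of _ "{w \<in> topspace X. G w \<in> {..<\<epsilon>\<^sup>2 / 2}}"] conjI ballI)
  qed
  have "inj_on h (topspace X)"
  proof (rule inj_onI, rule ccontr)
    fix z w assume "z \<in> topspace X" "w \<in> topspace X" and eq: "h z = h w" and "z \<noteq> w"
    then obtain i where "F i z \<noteq> F i w" using sep by blast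
    then show False using fun_cong[OF eq, of i] by (simp add: h_def)
  qed
  moreover have "Hausdorff_space ell2_topology"
    unfolding ell2_topology_def by (rule ell2.Hausdorff_space_mtopology)
  ultimately have "embedding_map X ell2_topology h"
    using continuous_imp_closed_map X cont injective_closed_imp_embedding_map by blast
  then obtain g where "homeomorphic_maps X (subtopology ell2_topology (h ` topspace X)) h g"
    unfolding embedding_map_def homeomorphic_map_maps by blast
  then show ?thesis using that h_ell by blast
qed

section \<open>Jointly generic points for the shifts on powers\<close>

text \<open>An infinite \<open>I\<close> is equinumerous with its product with the integers, and an
  \<open>I\<close> of at most continuum size can be named by sets of naturals. A coordinate thus
  becomes a row and an integer place in that row, along which one can shift.\<close>

lemma infinite_lepoll_real_labelling:
  assumes "(UNIV :: nat set) \<lesssim> I" "I \<lesssim> (UNIV :: real set)"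
  obtains \<beta> and T :: "nat set set" where "bij_betw \<beta> I (T \<times> (UNIV :: int set))"
proof -
  have "I \<lesssim> (UNIV :: nat set set)"
    using assms(2) nat_sets_eqpoll_reals eqpoll_sym lepoll_trans2 by blast
  then obtain f :: "_ \<Rightarrow> nat set" where f: "inj_on f I" unfolding lepoll_def by blast
  have inf: "infinite I" using assms(1) infinite_le_lepoll by blast
  have "(UNIV :: int set) \<lesssim> (UNIV :: nat set)"
    unfolding lepoll_def by (intro exI[of _ to_nat]) simp
  then have "(UNIV :: int set) \<lesssim> I" using assms(1) lepoll_trans by blast
  then have "ordLeq3 (card_of (UNIV :: int set)) (card_of I)"
    unfolding lepoll_def using card_of_ordLeq by blast
  then have "ordIso2 (card_of (I \<times> (UNIV :: int set))) (card_of I)"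
    using card_of_Times_infinite[OF inf] by blast
  then have "I \<approx> I \<times> (UNIV :: int set)"
    using eqpoll_iff_card_of_ordIso eqpoll_sym by blast
  also have "\<dots> \<approx> f ` I \<times> (UNIV :: int set)"
    using f by (intro times_eqpoll_cong) (simp_all add: eqpoll_sym inj_on_image_eqpoll_self)
  finally show ?thesis using that unfolding eqpoll_def by blast
qed

lemma finite_sets_separated_initially:
  fixes F :: "nat set set"
  assumes "finite F"
  obtains s where "\<And>s'. s \<le> s' \<Longrightarrow> inj_on (\<lambda>t. t \<inter> {..<s'}) F"
proof -
  \<comment> \<open>For equal \<open>t\<close> and \<open>t'\<close> the \<open>LEAST\<close> is an
    unspecified number, which at most makes \<open>s\<close> larger.\<close>
  define D where "D = (\<lambda>(t, t'). LEAST d. (d \<in> t) \<noteq> (d \<in> t')) ` (F \<times> F)"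
  have "finite D" using assms by (simp add: D_def)
  then obtain s where s: "D \<subseteq> {..<s}" using finite_nat_iff_bounded by blast
  show ?thesis
  proof (rule that, rule inj_onI, rule ccontr)
    fix s' t t' assume a: "s \<le> s'" "t \<in> F" "t' \<in> F" "t \<inter> {..<s'} = t' \<inter> {..<s'}" "t \<noteq> t'"
    define d where "d = (LEAST d. (d \<in> t) \<noteq> (d \<in> t'))"
    have "\<exists>d. (d \<in> t) \<noteq> (d \<in> t')" using a by blast
    then have "(d \<in> t) \<noteq> (d \<in> t')" unfolding d_def by (rule LeastI_ex)
    moreover have "d \<in> D" using a by (auto simp: D_def d_def)
    then have "d < s'" using s a(1) by auto
    ultimately show False using a(4) by blast
  qed
qed

text \<open>The numbers are chosen one after the other, each beyond all earlier windows, so that the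
  windows of radius \<open>s e\<close> around \<open>N e\<close> are disjoint. The modulus 0 is
  exempted because it occurs when arbitrary numbers are decoded as patterns.\<close>

lemma spaced_residues:
  fixes s L r B :: "nat \<Rightarrow> nat"
  obtains N :: "nat \<Rightarrow> nat" where "\<And>e. B e \<le> N e" "\<And>e. 0 < L e \<Longrightarrow> N e mod L e = r e mod L e"
    "\<And>e e'. e' < e \<Longrightarrow> N e' + s e' + s e < N e"
proof -
  have ex: "\<exists>n\<ge>b. 0 < l \<longrightarrow> n mod l = q mod l" for b l q :: nat
  proof (cases "l = 0")
    case False
    then have "b \<le> q mod l + l * b" by (simp add: trans_le_add2)
    then show ?thesis by (intro exI[of _ "q mod l + l * b"]) simp
  qed auto
  \<comment> \<open>Dependent choice on pairs: \<open>n\<close> is the place \<open>N e\<close>, and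
    \<open>b\<close> bounds the right ends of all windows placed so far.\<close>
  have "\<exists>f. \<forall>e. (case f e of (n, b) \<Rightarrow> B e \<le> n \<and> (0 < L e \<longrightarrow> n mod L e = r e mod L e) \<and> n + s e \<le> b) \<and>
    (case f e of (n, b) \<Rightarrow> case f (Suc e) of (n', b') \<Rightarrow> b + s (Suc e) < n' \<and> b \<le> b')"
  proof (rule dependent_nat_choice)
    show "\<exists>x. case x of (n, b) \<Rightarrow> B 0 \<le> n \<and> (0 < L 0 \<longrightarrow> n mod L 0 = r 0 mod L 0) \<and> n + s 0 \<le> b"
      using ex[of "B 0" "L 0" "r 0"] by auto
    fix x :: "nat \<times> nat" and e
    obtain n where "n \<ge> B (Suc e) + snd x + s (Suc e) + 1" "0 < L (Suc e) \<longrightarrow> n mod L (Suc e) = r (Suc e) mod L (Suc e)"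
      using ex by blast
    then show "\<exists>y. (case y of (n, b) \<Rightarrow> B (Suc e) \<le> n \<and> (0 < L (Suc e) \<longrightarrow> n mod L (Suc e) = r (Suc e) mod L (Suc e))
       \<and> n + s (Suc e) \<le> b) \<and>
      (case x of (n, b) \<Rightarrow> case y of (n', b') \<Rightarrow> b + s (Suc e) < n' \<and> b \<le> b')"
      by (intro exI[of _ "(n, n + s (Suc e) + snd x)"]) (auto split: prod.split)
  qed
  then obtain f where f0: "\<forall>e. (case f e of (n, b) \<Rightarrow> B e \<le> n \<and> (0 < L e \<longrightarrow> n mod L e = r e mod L e) \<and> n + s e \<le> b) \<and>
    (case f e of (n, b) \<Rightarrow> case f (Suc e) of (n', b') \<Rightarrow> b + s (Suc e) < n' \<and> b \<le> b')"
    by (rule exE)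
  have f: "B e \<le> fst (f e)" "0 < L e \<Longrightarrow> fst (f e) mod L e = r e mod L e" "fst (f e) + s e \<le> snd (f e)"
    "snd (f e) + s (Suc e) < fst (f (Suc e))" "snd (f e) \<le> snd (f (Suc e))" for e
    using spec[OF f0, of e] by (simp_all add: case_prod_beta)
  have mono: "snd (f e) \<le> snd (f e')" if "e \<le> e'" for e e'
    by (rule lift_Suc_mono_le[of "\<lambda>e. snd (f e)", OF f(5) that])
  show ?thesis
  proof (rule that[of "\<lambda>e. fst (f e)"])
    fix e e' :: nat assume "e' < e"
    then obtain i where i: "e = Suc i" "e' \<le> i" by (cases e) auto
    then show "fst (f e') + s e' + s e < fst (f e)"
      using f(3)[of e'] f(4)[of i] mono[OF i(2)] by simp
  qed (use f in auto)
qed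

text \<open>All finite patterns are listed and written at far apart places; a set \<open>t\<close> enters a pattern only
  through a finite initial part, so that there are countably many patterns although there are
  continuum many rows.\<close>

lemma universal_array:
  obtains c :: "nat \<Rightarrow> nat set \<Rightarrow> int \<Rightarrow> nat" where
    "\<And>E v B L r. finite E \<Longrightarrow> 0 < L \<Longrightarrow>
       \<exists>n\<ge>B. n mod L = r mod L \<and> (\<forall>(m, t, k)\<in>E. c m t (k + int n) = v m t k)"
proof -
  \<comment> \<open>Initial parts are stored as lists so that the patterns below form a countable
    type.\<close>
  define enc where "enc s t = sorted_list_of_set (t \<inter> {..<s})" for s :: nat and t
  \<comment> \<open>A number decodes to a lower bound for the place, a modulus, a residue, the
    radius of a window and a table of prescribed symbols.\<close>
  define pat where "pat e = (from_nat e :: nat \<times> nat \<times> nat \<times> nat \<times> ((nat \<times> nat list \<times> int) \<times> nat) list)" for e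
  define B L r s l where "B e = fst (pat e)" and "L e = fst (snd (pat e))" and "r e = fst (snd (snd (pat e)))"
    and "s e = fst (snd (snd (snd (pat e))))" and "l e = snd (snd (snd (snd (pat e))))" for e
  obtain N where N: "\<And>e. B e \<le> N e" "\<And>e. 0 < L e \<Longrightarrow> N e mod L e = r e mod L e"
    "\<And>e e'. e' < e \<Longrightarrow> N e' + s e' + s e < N e"
    using spaced_residues[where B = B and L = L and r = r and s = s] by blast
  \<comment> \<open>As windows are disjoint, \<open>SOME\<close> finds the only one containing
    \<open>j\<close>, if there is one. The symbol is looked up at the offset from its centre, with 0
    for entries missing from the table.\<close>
  define c where "c m t j = (let e = (SOME e. \<bar>j - int (N e)\<bar> \<le> int (s e)) in
     case map_of (l e) (m, enc (s e) t, j - int (N e)) of Some w \<Rightarrow> w | None \<Rightarrow> 0)" for m t j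
  show ?thesis
  proof (rule that[of c])
    fix E :: "(nat \<times> nat set \<times> int) set" and v :: "nat \<Rightarrow> nat set \<Rightarrow> int \<Rightarrow> nat" and B' L' r' :: nat
    assume E: "finite E" and L': "0 < L'"
    obtain s1 where s1: "\<And>s'. s1 \<le> s' \<Longrightarrow> inj_on (\<lambda>t. t \<inter> {..<s'}) ((\<lambda>(m, t, k). t) ` E)"
      using finite_sets_separated_initially[of "(\<lambda>(m, t, k). t) ` E"] E by blast
    have "finite ((\<lambda>(m, t, k). nat \<bar>k\<bar>) ` E)" using E by blast
    then obtain s2 where s2: "(\<lambda>(m, t, k). nat \<bar>k\<bar>) ` E \<subseteq> {..<s2}" using finite_nat_iff_bounded by blast
    \<comment> \<open>The radius has two tasks: to cover all offsets in \<open>E\<close>, and to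
      make initial parts of that length distinguish the rows in \<open>E\<close>.\<close>
    define s' where "s' = max s1 s2"
    obtain es where es: "set es = E" "distinct es" using finite_distinct_list[OF E] by blast
    define l' where "l' = map (\<lambda>(m, t, k). ((m, enc s' t, k), v m t k)) es"
    have inj: "t = t'" if "(m, t, k) \<in> E" "(m', t', k') \<in> E" "enc s' t = enc s' t'" for m t k m' t' k'
    proof -
      have "t \<inter> {..<s'} = t' \<inter> {..<s'}"
        using arg_cong[OF that(3), of set] by (simp add: enc_def)
      moreover have "t \<in> (\<lambda>(m, t, k). t) ` E" "t' \<in> (\<lambda>(m, t, k). t) ` E"
        using that by (force intro: rev_image_eqI)+
      ultimately show ?thesis using inj_onD[OF s1[of s'], of t t'] by (simp add: s'_def)
    qed
    have "inj_on (fst \<circ> (\<lambda>(m, t, k). ((m, enc s' t, k), v m t k))) (set es)"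
    proof (rule inj_onI)
      fix a b
      assume ab: "a \<in> set es" "b \<in> set es" "(fst \<circ> (\<lambda>(m, t, k). ((m, enc s' t, k), v m t k))) a =
        (fst \<circ> (\<lambda>(m, t, k). ((m, enc s' t, k), v m t k))) b"
      obtain m t k m' t' k' where eq: "a = (m, t, k)" "b = (m', t', k')" by (metis prod.exhaust)
      have "enc s' t = enc s' t'" "m = m'" "k = k'" using ab(3) by (simp_all add: eq)
      then show "a = b" using inj[OF ab(1,2)[unfolded es eq]] by (simp add: eq)
    qed
    then have dist: "distinct (map fst l')" by (simp add: l'_def distinct_map es)
    define e where "e = to_nat (B', L', r', s', l')"
    have pe: "B e = B'" "L e = L'" "r e = r'" "s e = s'" "l e = l'"
      by (simp_all add: B_def L_def r_def s_def l_def pat_def e_def)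
    have "c m t (k + int (N e)) = v m t k" if mtk: "(m, t, k) \<in> E" for m t k
    proof -
      have ks: "\<bar>k\<bar> \<le> int s'" using s2 mtk by (force simp: s'_def)
      have "(SOME e'. \<bar>k + int (N e) - int (N e')\<bar> \<le> int (s e')) = e"
      proof (rule some_equality)
        show "\<bar>k + int (N e) - int (N e)\<bar> \<le> int (s e)" using ks by (simp add: pe)
        fix e' assume e': "\<bar>k + int (N e) - int (N e')\<bar> \<le> int (s e')"
        have "\<not> e' < e" "\<not> e < e'" using N(3)[of e' e] N(3)[of e e'] e' ks pe by linarith+
        then show "e' = e" by simp
      qed
      moreover have "map_of l' (m, enc s' t, k) = Some (v m t k)"
        by (rule map_of_is_SomeI[OF dist]) (use mtk es in \<open>force simp: l'_def\<close>)
      ultimately show ?thesis by (simp add: c_def pe)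
    qed
    then show "\<exists>n\<ge>B'. n mod L' = r' mod L' \<and> (\<forall>(m, t, k)\<in>E. c m t (k + int n) = v m t k)"
      using N(1)[of e] N(2)[of e] L' pe by (intro exI[of _ "N e"]) auto
  qed
qed

lemma separable_dense_sequence:
  assumes "separable_space X" "topspace X \<noteq> {}"
  obtains d :: "nat \<Rightarrow> 'a" where "range d \<subseteq> topspace X" "\<And>U. openin X U \<Longrightarrow> U \<noteq> {} \<Longrightarrow> \<exists>u. d u \<in> U"
proof -
  obtain D where D: "countable D" "D \<subseteq> topspace X" "X closure_of D = topspace X"
    using assms(1) unfolding separable_space_def by blast
  have ne: "D \<noteq> {}" using D(3) assms(2) closure_of_empty by metis
  show ?thesis
  proof (rule that[of "from_nat_into D"])
    show "range (from_nat_into D) \<subseteq> topspace X" using D ne by auto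
    fix U assume U: "openin X U" "U \<noteq> {}"
    then obtain z where "z \<in> U" by blast
    then have "z \<in> X closure_of D" using D(3) openin_subset[OF U(1)] by auto
    then obtain d where "d \<in> D" "d \<in> U" using U \<open>z \<in> U\<close> unfolding in_closure_of by blast
    then show "\<exists>u. from_nat_into D u \<in> U" using D(1) by (metis from_nat_into_surj)
  qed
qed

text \<open>The coordinates of each power are arranged in rows indexed by the integers;
  \<open>\<theta> m\<close> shifts all rows, and \<open>y m\<close> is the universal array read
  through a dense sequence of \<open>K m\<close>. A nonempty open set contains a box restricting
  finitely many coordinates, hence asks for a finite pattern, and the array serves all blocks of
  \<open>F\<close> at one common time.\<close>

lemma jointly_generic_points:
  fixes K :: "nat \<Rightarrow> 'a topology" and I :: "nat \<Rightarrow> 'i set"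
  assumes sep: "\<And>m. m \<in> P \<Longrightarrow> separable_space (K m) \<and> topspace (K m) \<noteq> {}"
    and I: "\<And>m. m \<in> P \<Longrightarrow> (UNIV :: nat set) \<lesssim> I m \<and> I m \<lesssim> (UNIV :: real set)"
  shows "\<exists>\<theta> \<theta>' y.
    (\<forall>m\<in>P. homeomorphic_maps (power_topology (K m) (I m)) (power_topology (K m) (I m)) (\<theta> m) (\<theta>' m)) \<and>
    (\<forall>m\<in>P. y m \<in> topspace (power_topology (K m) (I m))) \<and>
    (\<forall>F V B L r. finite F \<and> F \<subseteq> P \<and> 0 < L \<and>
        (\<forall>m\<in>F. openin (power_topology (K m) (I m)) (V m) \<and> V m \<noteq> {}) \<longrightarrow>
       (\<exists>n\<ge>B. n mod L = r mod L \<and> (\<forall>m\<in>F. (\<theta> m ^^ n) (y m) \<in> V m)))"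
proof -
  let ?Y = "\<lambda>m. power_topology (K m) (I m)"
  have "\<forall>m\<in>P. \<exists>\<beta> T. bij_betw \<beta> (I m) ((T :: nat set set) \<times> (UNIV :: int set))"
    using I infinite_lepoll_real_labelling by metis
  then obtain \<beta> and T :: "nat \<Rightarrow> nat set set" where \<beta>: "\<And>m. m \<in> P \<Longrightarrow> bij_betw (\<beta> m) (I m) (T m \<times> (UNIV :: int set))"
    by metis
  have "\<forall>m\<in>P. \<exists>d :: nat \<Rightarrow> 'a. range d \<subseteq> topspace (K m) \<and> (\<forall>U. openin (K m) U \<longrightarrow> U \<noteq> {} \<longrightarrow> (\<exists>u. d u \<in> U))"
    using sep separable_dense_sequence by (metis (no_types, lifting))
  then obtain d :: "nat \<Rightarrow> nat \<Rightarrow> 'a" where d: "\<And>m. m \<in> P \<Longrightarrow> range (d m) \<subseteq> topspace (K m)"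
    "\<And>m U. m \<in> P \<Longrightarrow> openin (K m) U \<Longrightarrow> U \<noteq> {} \<Longrightarrow> \<exists>u. d m u \<in> U"
    by metis
  obtain c :: "nat \<Rightarrow> nat set \<Rightarrow> int \<Rightarrow> nat" where c: "\<And>E v B L r. finite E \<Longrightarrow> 0 < L \<Longrightarrow>
       \<exists>n\<ge>B. n mod L = r mod L \<and> (\<forall>(m, t, k)\<in>E. c m t (k + int n) = v m t k)"
    using universal_array by blast
  \<comment> \<open>The coordinate in the same row, \<open>j\<close> places further on.\<close>
  define \<pi> where "\<pi> m j i = inv_into (I m) (\<beta> m) (fst (\<beta> m i), snd (\<beta> m i) + j)" for m j i
  have \<pi>: "\<pi> m j i \<in> I m" "\<beta> m (\<pi> m j i) = (fst (\<beta> m i), snd (\<beta> m i) + j)" if "m \<in> P" "i \<in> I m" for m i j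
  proof -
    have "\<beta> m i \<in> T m \<times> UNIV" using \<beta>[OF that(1)] that(2) by (auto simp: bij_betw_def)
    then have "(fst (\<beta> m i), snd (\<beta> m i) + j) \<in> \<beta> m ` I m"
      using \<beta>[OF that(1)] by (auto simp: bij_betw_def mem_Times_iff)
    then show "\<pi> m j i \<in> I m" "\<beta> m (\<pi> m j i) = (fst (\<beta> m i), snd (\<beta> m i) + j)"
      unfolding \<pi>_def by (rule inv_into_into, rule f_inv_into_f)
  qed
  have \<pi>_inv: "\<pi> m j i = i'" if "m \<in> P" "i \<in> I m" "i' \<in> I m" "\<beta> m i' = (fst (\<beta> m i), snd (\<beta> m i) + j)" for m j i i'
    using \<pi>[OF that(1,2), of j] that \<beta>[OF that(1)] by (metis bij_betw_def inj_on_def)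
  have \<pi>_\<pi>: "\<pi> m j (\<pi> m j' i) = \<pi> m (j + j') i" if "m \<in> P" "i \<in> I m" for m j j' i
    by (rule \<pi>_inv) (use \<pi> that in auto)
  have \<pi>_0: "\<pi> m 0 i = i" if "m \<in> P" "i \<in> I m" for m i
    by (rule \<pi>_inv) (use that in auto)
  define S where "S m j z = restrict (\<lambda>i. z (\<pi> m j i)) (I m)" for m j and z :: "'i \<Rightarrow> 'a"
  have S_cont: "continuous_map (?Y m) (?Y m) (S m j)" if "m \<in> P" for m j
    unfolding power_topology_def continuous_map_componentwise
    using \<pi>(1)[OF that] by (auto simp: S_def intro: continuous_map_product_projection)
  have S_in: "S m j z \<in> topspace (?Y m)" if "m \<in> P" "z \<in> topspace (?Y m)" for m j z
    using S_cont[OF that(1), of j] that(2) by (auto simp: continuous_map_def)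
  have SS: "S m j (S m j' z) = S m (j + j') z" if "m \<in> P" for m j j' z
    using \<pi>(1)[OF that] \<pi>_\<pi>[OF that] by (auto simp: S_def fun_eq_iff add.commute)
  have S0: "S m 0 z = z" if "m \<in> P" "z \<in> topspace (?Y m)" for m z
    using that by (auto simp: S_def fun_eq_iff \<pi>_0 power_topology_def PiE_def extensional_def)
  have pow: "(S m 1 ^^ n) z = S m (int n) z" if "m \<in> P" "z \<in> topspace (?Y m)" for m n z
    by (induction n) (simp_all add: S0 SS that add.commute)
  define y where "y m = restrict (\<lambda>i. d m (c m (fst (\<beta> m i)) (snd (\<beta> m i)))) (I m)" for m
  have y: "y m \<in> topspace (?Y m)" if "m \<in> P" for m
    using d(1)[OF that] by (auto simp: y_def power_topology_def)
  have Sy: "S m j (y m) i = d m (c m (fst (\<beta> m i)) (snd (\<beta> m i) + j))" if "m \<in> P" "i \<in> I m" for m i j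
    using \<pi>[OF that, of j] that by (simp add: S_def y_def)
  show ?thesis
  proof (rule exI[of _ "\<lambda>m. S m 1"], rule exI[of _ "\<lambda>m. S m (-1)"], rule exI[of _ y],
      intro conjI ballI allI impI)
    show "homeomorphic_maps (?Y m) (?Y m) (S m 1) (S m (-1))" if "m \<in> P" for m
      using S_cont[OF that] SS[OF that] S0[OF that] by (simp add: homeomorphic_maps_def)
    show "y m \<in> topspace (?Y m)" if "m \<in> P" for m by (rule y[OF that])
    fix F V and B L r :: nat
    assume asm: "finite F \<and> F \<subseteq> P \<and> 0 < L \<and> (\<forall>m\<in>F. openin (?Y m) (V m) \<and> V m \<noteq> {})"
    then have F: "finite F" "F \<subseteq> P" and L: "0 < L" by simp_all
    have V: "openin (?Y m) (V m) \<and> V m \<noteq> {}" if "m \<in> F" for m using asm that by simp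
    have "\<exists>U. finite {i \<in> I m. U i \<noteq> topspace (K m)} \<and> (\<forall>i\<in>I m. openin (K m) (U i) \<and> U i \<noteq> {}) \<and> Pi\<^sub>E (I m) U \<subseteq> V m"
      if m: "m \<in> F" for m
    proof -
      \<comment> \<open>A point of \<open>V m\<close> makes all sides of the box nonempty, so that
        each contains a term of the dense sequence.\<close>
      obtain z where z: "z \<in> V m" using V[OF m] by blast
      then obtain U where U: "finite {i \<in> I m. U i \<noteq> topspace (K m)}" "\<forall>i\<in>I m. openin (K m) (U i)"
        "z \<in> Pi\<^sub>E (I m) U" "Pi\<^sub>E (I m) U \<subseteq> V m"
        using V[OF m] unfolding power_topology_def openin_product_topology_alt by blast
      then show ?thesis by (intro exI[of _ U]) auto
    qed
    then have "\<exists>U. \<forall>m\<in>F. finite {i \<in> I m. U m i \<noteq> topspace (K m)} \<and>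
        (\<forall>i\<in>I m. openin (K m) (U m i) \<and> U m i \<noteq> {}) \<and> Pi\<^sub>E (I m) (U m) \<subseteq> V m"
      by (intro bchoice ballI)
    then obtain U where U0: "\<forall>m\<in>F. finite {i \<in> I m. U m i \<noteq> topspace (K m)} \<and>
        (\<forall>i\<in>I m. openin (K m) (U m i) \<and> U m i \<noteq> {}) \<and> Pi\<^sub>E (I m) (U m) \<subseteq> V m"
      by (rule exE)
    have U: "\<And>m. m \<in> F \<Longrightarrow> finite {i \<in> I m. U m i \<noteq> topspace (K m)}"
      "\<And>m i. m \<in> F \<Longrightarrow> i \<in> I m \<Longrightarrow> openin (K m) (U m i) \<and> U m i \<noteq> {}" "\<And>m. m \<in> F \<Longrightarrow> Pi\<^sub>E (I m) (U m) \<subseteq> V m"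
      using U0 by simp_all
    define u where "u m i = (SOME u. d m u \<in> U m i)" for m i
    have u: "d m (u m i) \<in> U m i" if "m \<in> F" "i \<in> I m" for m i
    proof -
      have "m \<in> P" using F(2) that(1) by (rule subsetD)
      then show ?thesis
        unfolding u_def using someI_ex[OF d(2)] U(2)[OF that] by simp
    qed
    \<comment> \<open>Only coordinates with a proper side enter the pattern; on the others every
      value is allowed.\<close>
    define E where "E = (\<Union>m\<in>F. (\<lambda>i. (m, fst (\<beta> m i), snd (\<beta> m i))) ` {i \<in> I m. U m i \<noteq> topspace (K m)})"
    have "finite E" using F U(1) by (simp add: E_def)
    then obtain n where n: "n \<ge> B" "n mod L = r mod L"
      "\<forall>(m, t, k)\<in>E. c m t (k + int n) = u m (inv_into (I m) (\<beta> m) (t, k))"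
      using c[of E L B r "\<lambda>m t k. u m (inv_into (I m) (\<beta> m) (t, k))"] L by blast
    have "(S m 1 ^^ n) (y m) \<in> V m" if m: "m \<in> F" for m
    proof -
      have mP: "m \<in> P" using m F by blast
      have "S m (int n) (y m) i \<in> U m i" if i: "i \<in> I m" for i
      proof (cases "U m i = topspace (K m)")
        case True
        then show ?thesis using Sy[OF mP i] d(1)[OF mP] by auto
      next
        case False
        then have "(m, fst (\<beta> m i), snd (\<beta> m i)) \<in> E" using m i by (auto simp: E_def)
        moreover have "inv_into (I m) (\<beta> m) (\<beta> m i) = i"
          using \<beta>[OF mP] i by (simp add: bij_betw_def)
        ultimately have "c m (fst (\<beta> m i)) (snd (\<beta> m i) + int n) = u m i"
          using n(3) by auto
        then show ?thesis using Sy[OF mP i] u[OF m i] by simp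
      qed
      then have "S m (int n) (y m) \<in> Pi\<^sub>E (I m) (U m)" by (auto simp: S_def)
      then show ?thesis using U(3)[OF m] pow[OF mP y[OF mP]] by auto
    qed
    then show "\<exists>n\<ge>B. n mod L = r mod L \<and> (\<forall>m\<in>F. (S m 1 ^^ n) (y m) \<in> V m)" using n by blast
  qed
qed

section \<open>The compact space of blocks\<close>

text \<open>This is the sign collected along an orbit that meets the negative copy once in every
  \<open>c\<close> steps.\<close>

lemma prod_minus_one_multiples: "(\<Prod>i=1..n. if c dvd i then - 1 else 1 :: real) = (- 1) ^ (n div c)"
  by (induction n) (simp_all add: div_Suc mod_eq_0_iff_dvd)

text \<open>The parity of \<open>n div c\<close> can be read off from the residue modulo
  \<open>2 * c\<close>, so that signs are prescribed through return times.\<close>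

lemma minus_one_power_div_cong:
  assumes "n mod (2 * c) = j mod (2 * c)" "0 < c"
  shows "(- 1 :: real) ^ (n div c) = (- 1) ^ (j div c)"
proof -
  have "n div c mod 2 = (n mod (2 * c)) div c" for n
    using assms(2) by (simp add: mod_mult2_eq mult.commute[of 2])
  then have "n div c mod 2 = j div c mod 2" using assms(1) by metis
  then show ?thesis by (simp add: minus_one_power_iff even_iff_mod_2_eq_zero)
qed

text \<open>\<open>Fib m k z\<close> is the point \<open>z\<close> in the copy of index
  \<open>k\<close> of block \<open>m\<close>; \<open>Seq\<close> and \<open>SeqLim\<close> form the
  convergent sequence, which starts at the isolated point \<open>Seq 0\<close>; \<open>Rem\<close>
  and \<open>RemLim\<close> form the remainder.\<close>

datatype 'y block_point = Fib nat int 'y | Seq nat | SeqLim | Rem int | RemLim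

text \<open>The data left after the choice of generic points: \<open>Y m\<close> is the power used
  in block \<open>m\<close>, and \<open>p m\<close> is the length of its cycle. By
  \<open>p_ge\<close> every fixed index occurs in all late blocks; \<open>generic\<close> lets
  finitely many blocks return simultaneously at a time of prescribed residue.\<close>

locale block_system =
  fixes P :: "nat set" and p :: "nat \<Rightarrow> nat" and Y :: "nat \<Rightarrow> 'y topology"
    and \<theta> \<theta>' :: "nat \<Rightarrow> 'y \<Rightarrow> 'y" and y :: "nat \<Rightarrow> 'y"
  assumes P_nonempty: "P \<noteq> {}" and P_pos: "0 \<notin> P"
    and p_pos: "m \<in> P \<Longrightarrow> 0 < p m" and p_ge: "m \<in> P \<Longrightarrow> m \<le> p m"
    and p_even: "m \<in> P \<Longrightarrow> k \<in> P \<Longrightarrow> m < k \<Longrightarrow> 2 * p m dvd p k"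
    and compact_Y: "m \<in> P \<Longrightarrow> compact_space (Y m)"
    and Hausdorff_Y: "m \<in> P \<Longrightarrow> Hausdorff_space (Y m)"
    and \<theta>: "m \<in> P \<Longrightarrow> homeomorphic_maps (Y m) (Y m) (\<theta> m) (\<theta>' m)"
    and y_in: "m \<in> P \<Longrightarrow> y m \<in> topspace (Y m)"
    and generic: "\<lbrakk>finite F; F \<subseteq> P; 0 < L; \<And>m. m \<in> F \<Longrightarrow> openin (Y m) (V m) \<and> V m \<noteq> {}\<rbrakk> \<Longrightarrow>
       \<exists>n\<ge>B. n mod L = r mod L \<and> (\<forall>m\<in>F. (\<theta> m ^^ n) (y m) \<in> V m)"
begin

text \<open>The \<open>p m\<close> copies in block \<open>m\<close> are indexed by the integers of a symmetric interval, on which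
  \<open>wrap m\<close> is reduction modulo \<open>p m\<close>. A fixed index \<open>k\<close> then makes sense in all large blocks, and
  the copies with index \<open>k\<close> shrink to the point \<open>Rem k\<close> as the block number grows.\<close>

definition half :: "nat \<Rightarrow> int" where "half m = int (p m div 2)"
definition Ix :: "nat \<Rightarrow> int set" where "Ix m = {- half m..<int (p m) - half m}"
definition wrap :: "nat \<Rightarrow> int \<Rightarrow> int" where "wrap m k = (k + half m) mod int (p m) - half m"
definition fib :: "nat \<Rightarrow> int \<Rightarrow> 'y block_point set" where "fib m k = Fib m k ` topspace (Y m)"

lemma wrap_in: "m \<in> P \<Longrightarrow> wrap m k \<in> Ix m"
  using p_pos[of m] by (simp add: wrap_def Ix_def)

lemma wrap_id: "k \<in> Ix m \<Longrightarrow> wrap m k = k"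
  by (simp add: wrap_def Ix_def)

lemma wrap_wrap: "wrap m (wrap m k + j) = wrap m (k + j)"
  by (simp add: wrap_def algebra_simps mod_simps)

lemma zero_in_Ix: "m \<in> P \<Longrightarrow> 0 \<in> Ix m"
  using p_pos[of m] by (auto simp: Ix_def half_def)

lemma wrap_eq_iff: "m \<in> P \<Longrightarrow> wrap m k = wrap m j \<longleftrightarrow> int (p m) dvd k - j"
  by (simp add: wrap_def mod_eq_dvd_iff)

lemma half_bounds: "2 * half m \<le> int (p m)" "int (p m) \<le> 2 * half m + 1"
  by (auto simp: half_def)

lemma wrap_pred: "m \<in> P \<Longrightarrow> k \<in> Ix m \<Longrightarrow> wrap m (k - 1) = (if k - 1 \<in> Ix m then k - 1 else k - 1 + int (p m))"
proof -
  assume k: "m \<in> P" "k \<in> Ix m"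
  have "wrap m (k - 1) = wrap m (k - 1 + int (p m))"
    using wrap_eq_iff[OF k(1)] by simp
  then show ?thesis
    using k p_pos[OF k(1)] wrap_id[of "k - 1" m] wrap_id[of "k - 1 + int (p m)" m] by (auto simp: Ix_def)
qed

lemma wrap_succ: "m \<in> P \<Longrightarrow> k \<in> Ix m \<Longrightarrow> wrap m (k + 1) = (if k + 1 \<in> Ix m then k + 1 else k + 1 - int (p m))"
proof -
  assume k: "m \<in> P" "k \<in> Ix m"
  have "wrap m (k + 1) = wrap m (k + 1 - int (p m))"
    using wrap_eq_iff[OF k(1)] by simp
  then show ?thesis
    using k p_pos[OF k(1)] wrap_id[of "k + 1" m] wrap_id[of "k + 1 - int (p m)" m] by (auto simp: Ix_def)
qed

text \<open>At the end of the interval the index jumps to the opposite end, which is equally far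
  from 0 up to one step. This gives continuity at \<open>RemLim\<close>.\<close>

lemma wrap_pred_far: "m \<in> P \<Longrightarrow> k \<in> Ix m \<Longrightarrow> \<bar>k\<bar> - 1 \<le> \<bar>wrap m (k - 1)\<bar>"
  using half_bounds[of m] by (simp add: wrap_pred) (auto simp: Ix_def)

lemma wrap_succ_far: "m \<in> P \<Longrightarrow> k \<in> Ix m \<Longrightarrow> \<bar>k\<bar> - 1 \<le> \<bar>wrap m (k + 1)\<bar>"
  using half_bounds[of m] by (simp add: wrap_succ) (auto simp: Ix_def)

lemma in_Ix_large: "m \<in> P \<Longrightarrow> 2 * \<bar>k\<bar> + 2 \<le> int m \<Longrightarrow> k \<in> Ix m"
  using half_bounds[of m] p_ge[of m] by (auto simp: Ix_def)

section \<open>Topology of the space of blocks\<close>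

definition S :: "'y block_point set" where
  "S = (\<Union>m\<in>P. \<Union>k\<in>Ix m. fib m k) \<union> range Seq \<union> {SeqLim} \<union> (if infinite P then range Rem \<union> {RemLim} else {})"

text \<open>\<open>Rem k\<close> is isolated within the remainder and approached by the copies of
  index \<open>k\<close> in late blocks; \<open>RemLim\<close> is approached by everything whose
  index is large in absolute value, in whatever block. For finite \<open>P\<close> the set
  \<open>S\<close> contains no remainder, so both clauses hold vacuously.\<close>

definition opn :: "'y block_point set \<Rightarrow> bool" where
  "opn U \<longleftrightarrow> U \<subseteq> S \<and> (\<forall>m\<in>P. \<forall>k\<in>Ix m. openin (Y m) {z. Fib m k z \<in> U}) \<and>
     (SeqLim \<in> U \<longrightarrow> (\<exists>b. \<forall>n\<ge>b. Seq n \<in> U)) \<and>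
     (\<forall>k. Rem k \<in> U \<longrightarrow> (\<exists>b. \<forall>m\<in>P. b \<le> m \<and> k \<in> Ix m \<longrightarrow> fib m k \<subseteq> U)) \<and>
     (RemLim \<in> U \<longrightarrow> (\<exists>b. \<forall>k. b < \<bar>k\<bar> \<longrightarrow> Rem k \<in> U \<and> (\<forall>m\<in>P. k \<in> Ix m \<longrightarrow> fib m k \<subseteq> U)))"

definition X :: "'y block_point topology" where "X = topology opn"

lemma S_simps [simp]:
  "Fib m k z \<in> S \<longleftrightarrow> m \<in> P \<and> k \<in> Ix m \<and> z \<in> topspace (Y m)"
  "Seq n \<in> S" "SeqLim \<in> S" "Rem k \<in> S \<longleftrightarrow> infinite P" "RemLim \<in> S \<longleftrightarrow> infinite P"
  by (auto simp: S_def fib_def)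

lemma fib_sub_S: "m \<in> P \<Longrightarrow> k \<in> Ix m \<Longrightarrow> fib m k \<subseteq> S"
  by (auto simp: fib_def)

lemma opn_sub: "opn U \<Longrightarrow> U \<subseteq> S"
  and opn_fib: "opn U \<Longrightarrow> m \<in> P \<Longrightarrow> k \<in> Ix m \<Longrightarrow> openin (Y m) {z. Fib m k z \<in> U}"
  and opn_SeqLim: "opn U \<Longrightarrow> SeqLim \<in> U \<Longrightarrow> \<exists>b. \<forall>n\<ge>b. Seq n \<in> U"
  and opn_Rem: "opn U \<Longrightarrow> Rem k \<in> U \<Longrightarrow> \<exists>b. \<forall>m\<in>P. b \<le> m \<and> k \<in> Ix m \<longrightarrow> fib m k \<subseteq> U"
  and opn_RemLim: "opn U \<Longrightarrow> RemLim \<in> U \<Longrightarrow>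
    \<exists>b. \<forall>k. b < \<bar>k\<bar> \<longrightarrow> Rem k \<in> U \<and> (\<forall>m\<in>P. k \<in> Ix m \<longrightarrow> fib m k \<subseteq> U)"
  unfolding opn_def by simp_all

lemma opn_Int:
  assumes U: "opn U" and V: "opn V"
  shows "opn (U \<inter> V)"
  unfolding opn_def
proof (intro conjI ballI allI impI)
  show "U \<inter> V \<subseteq> S" using U by (auto simp: opn_def)
  show "openin (Y m) {z. Fib m k z \<in> U \<inter> V}" if "m \<in> P" "k \<in> Ix m" for m k
    using openin_Int[of "Y m" "{z. Fib m k z \<in> U}" "{z. Fib m k z \<in> V}"] U V that
    by (simp add: opn_def Collect_conj_eq)
  show "\<exists>b. \<forall>n\<ge>b. Seq n \<in> U \<inter> V" if w: "SeqLim \<in> U \<inter> V"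
  proof -
    obtain b b' where "\<forall>n\<ge>b. Seq n \<in> U" "\<forall>n\<ge>b'. Seq n \<in> V" using opn_SeqLim[OF U] opn_SeqLim[OF V] w by blast
    then show ?thesis by (intro exI[of _ "max b b'"]) auto
  qed
  show "\<exists>b. \<forall>m\<in>P. b \<le> m \<and> k \<in> Ix m \<longrightarrow> fib m k \<subseteq> U \<inter> V" if w: "Rem k \<in> U \<inter> V" for k
  proof -
    obtain b b' where "\<forall>m\<in>P. b \<le> m \<and> k \<in> Ix m \<longrightarrow> fib m k \<subseteq> U" "\<forall>m\<in>P. b' \<le> m \<and> k \<in> Ix m \<longrightarrow> fib m k \<subseteq> V"
      using opn_Rem[OF U] opn_Rem[OF V] w by blast
    then show ?thesis by (intro exI[of _ "max b b'"]) auto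
  qed
  show "\<exists>b. \<forall>k. b < \<bar>k\<bar> \<longrightarrow> Rem k \<in> U \<inter> V \<and> (\<forall>m\<in>P. k \<in> Ix m \<longrightarrow> fib m k \<subseteq> U \<inter> V)" if w: "RemLim \<in> U \<inter> V"
  proof -
    obtain b b' where "\<forall>k. b < \<bar>k\<bar> \<longrightarrow> Rem k \<in> U \<and> (\<forall>m\<in>P. k \<in> Ix m \<longrightarrow> fib m k \<subseteq> U)"
      "\<forall>k. b' < \<bar>k\<bar> \<longrightarrow> Rem k \<in> V \<and> (\<forall>m\<in>P. k \<in> Ix m \<longrightarrow> fib m k \<subseteq> V)"
      using opn_RemLim[OF U] opn_RemLim[OF V] w by blast
    then show ?thesis by (intro exI[of _ "max b b'"]) auto
  qed
qed

lemma opn_Union: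
  assumes "\<And>U. U \<in> \<U> \<Longrightarrow> opn U"
  shows "opn (\<Union>\<U>)"
  unfolding opn_def
proof (intro conjI ballI allI impI)
  show "\<Union>\<U> \<subseteq> S" using opn_sub[OF assms] by blast
  show "openin (Y m) {z. Fib m k z \<in> \<Union>\<U>}" if "m \<in> P" "k \<in> Ix m" for m k
  proof -
    have "{z. Fib m k z \<in> \<Union>\<U>} = (\<Union>U\<in>\<U>. {z. Fib m k z \<in> U})" by auto
    then show ?thesis using opn_fib[OF assms that] by auto
  qed
  show "\<exists>b. \<forall>n\<ge>b. Seq n \<in> \<Union>\<U>" if SL: "SeqLim \<in> \<Union>\<U>"
  proof -
    obtain U where "U \<in> \<U>" "SeqLim \<in> U" using SL by blast
    then show ?thesis using opn_SeqLim[OF assms, of U] by blast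
  qed
  show "\<exists>b. \<forall>m\<in>P. b \<le> m \<and> k \<in> Ix m \<longrightarrow> fib m k \<subseteq> \<Union>\<U>" if R: "Rem k \<in> \<Union>\<U>" for k
  proof -
    obtain U where U: "U \<in> \<U>" "Rem k \<in> U" using R by blast
    then obtain b where "\<forall>m\<in>P. b \<le> m \<and> k \<in> Ix m \<longrightarrow> fib m k \<subseteq> U"
      using opn_Rem[OF assms, of U k] by blast
    then show ?thesis using U(1) by (intro exI[of _ b]) blast
  qed
  show "\<exists>b. \<forall>k. b < \<bar>k\<bar> \<longrightarrow> Rem k \<in> \<Union>\<U> \<and> (\<forall>m\<in>P. k \<in> Ix m \<longrightarrow> fib m k \<subseteq> \<Union>\<U>)" if R: "RemLim \<in> \<Union>\<U>"
  proof -
    obtain U where U: "U \<in> \<U>" "RemLim \<in> U" using R by blast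
    then obtain b where "\<forall>k. b < \<bar>k\<bar> \<longrightarrow> Rem k \<in> U \<and> (\<forall>m\<in>P. k \<in> Ix m \<longrightarrow> fib m k \<subseteq> U)"
      using opn_RemLim[OF assms, of U] by blast
    then show ?thesis using U(1) by (intro exI[of _ b]) blast
  qed
qed

lemma openin_X: "openin X U \<longleftrightarrow> opn U"
  unfolding X_def using opn_Int opn_Union by (subst topology_inverse') (auto simp: istopology_def)

lemma openin_fib: "openin X U \<Longrightarrow> m \<in> P \<Longrightarrow> k \<in> Ix m \<Longrightarrow> openin (Y m) {z. Fib m k z \<in> U}"
  by (simp add: openin_X opn_def)

lemma opn_S: "opn S"
proof -
  have "{z. Fib m k z \<in> S} = topspace (Y m)" if "m \<in> P" "k \<in> Ix m" for m k using that by auto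
  then show ?thesis using fib_sub_S by (auto simp: opn_def)
qed

lemma topspace_X [simp]: "topspace X = S"
proof
  show "topspace X \<subseteq> S" using openin_X[of "topspace X"] by (simp add: opn_def)
  show "S \<subseteq> topspace X" using opn_S openin_X openin_subset by blast
qed

lemma openin_Fib_image:
  assumes "m \<in> P" "k \<in> Ix m" "openin (Y m) V"
  shows "openin X (Fib m k ` V)"
proof -
  have "{z. Fib m' k' z \<in> Fib m k ` V} = (if m' = m \<and> k' = k then V else {})" for m' k' by auto
  then show ?thesis unfolding openin_X opn_def using assms openin_subset[OF assms(3)] by auto
qed

lemma openin_Seq: "openin X {Seq n}"
  unfolding openin_X opn_def by auto

lemma continuous_Fib: "m \<in> P \<Longrightarrow> k \<in> Ix m \<Longrightarrow> continuous_map (Y m) X (Fib m k)"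
proof -
  assume mk: "m \<in> P" "k \<in> Ix m"
  have "{z \<in> topspace (Y m). Fib m k z \<in> U} = {z. Fib m k z \<in> U}" if "openin X U" for U
    using openin_subset[OF that] by auto
  then show ?thesis using mk openin_fib[OF _ mk] by (auto simp: continuous_map_def)
qed

text \<open>Countably many clopen sets separating any two points that do not lie in the same copy.
  The last kind ties \<open>Rem k\<close> to all copies of index \<open>k\<close>; the intersection
  with \<open>S\<close> removes \<open>Rem k\<close> when \<open>P\<close> is finite.\<close>

definition clopens :: "'y block_point set set" where
  "clopens = (\<Union>m\<in>P. fib m ` Ix m) \<union> range (\<lambda>n. {Seq n}) \<union> {insert SeqLim (range Seq)} \<union>
     range (\<lambda>k. S \<inter> ({Rem k} \<union> (\<Union>m. fib m k)))"

lemma fib_iff [simp]: "Fib m k z \<in> fib m' k' \<longleftrightarrow> m = m' \<and> k = k' \<and> z \<in> topspace (Y m)"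
  "Seq n \<notin> fib m' k'" "SeqLim \<notin> fib m' k'" "Rem k \<notin> fib m' k'" "RemLim \<notin> fib m' k'"
  by (auto simp: fib_def)

text \<open>For a union of whole copies the traces on the copies are all or nothing, so only the
  limit points require a check.\<close>

lemma opn_by_fibres:
  assumes "U \<subseteq> S"
    and "\<And>m k. m \<in> P \<Longrightarrow> k \<in> Ix m \<Longrightarrow> fib m k \<subseteq> U \<or> fib m k \<inter> U = {}"
    and "SeqLim \<in> U \<longrightarrow> (\<exists>b. \<forall>n\<ge>b. Seq n \<in> U)"
    and "\<And>k. Rem k \<in> U \<longrightarrow> (\<exists>b. \<forall>m\<in>P. b \<le> m \<and> k \<in> Ix m \<longrightarrow> fib m k \<subseteq> U)"
    and "RemLim \<in> U \<longrightarrow> (\<exists>b. \<forall>k. b < \<bar>k\<bar> \<longrightarrow> Rem k \<in> U \<and> (\<forall>m\<in>P. k \<in> Ix m \<longrightarrow> fib m k \<subseteq> U))"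
  shows "openin X U"
proof -
  have "openin (Y m) {z. Fib m k z \<in> U}" if "m \<in> P" "k \<in> Ix m" for m k
  proof -
    have "{z. Fib m k z \<in> U} \<subseteq> topspace (Y m)" using assms(1) that by auto
    then have "{z. Fib m k z \<in> U} = topspace (Y m) \<or> {z. Fib m k z \<in> U} = {}"
      using assms(2)[OF that] by (auto simp: fib_def)
    then show ?thesis by (metis openin_empty openin_topspace)
  qed
  then show ?thesis using assms by (simp add: openin_X opn_def)
qed

lemma clopens_open:
  assumes "Q \<in> clopens"
  shows "openin X Q" "openin X (S - Q)"
proof -
  consider m k where "m \<in> P" "k \<in> Ix m" "Q = fib m k" | n where "Q = {Seq n}" | "Q = insert SeqLim (range Seq)"
    | k where "Q = S \<inter> ({Rem k} \<union> (\<Union>m. fib m k))"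
    using assms unfolding clopens_def by blast
  then have "openin X Q \<and> openin X (S - Q)"
  proof cases
    case 1
    \<comment> \<open>The witnesses are for the complement: at \<open>RemLim\<close> the indices
      beyond \<open>\<bar>k\<bar>\<close>, and at \<open>Rem k\<close> the blocks beyond
      \<open>m\<close>, avoid this copy.\<close>
    then show ?thesis
      by (auto intro!: opn_by_fibres exI[of _ "\<bar>k\<bar>"] exI[of _ "Suc m"] simp: fib_def)
  next
    case 2
    then show ?thesis
      by (auto intro!: opn_by_fibres exI[of _ "Suc n"] exI[of _ "0::int"] simp: fib_def)
  next
    case 3
    then show ?thesis by (auto intro!: opn_by_fibres exI[of _ "0::int"] exI[of _ "0::nat"] simp: fib_def)
  next
    case 4
    have Q: "Fib m j z \<in> Q \<longleftrightarrow> j = k \<and> m \<in> P \<and> j \<in> Ix m \<and> z \<in> topspace (Y m)" "Rem j \<in> Q \<longleftrightarrow> j = k \<and> infinite P"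
      "SeqLim \<notin> Q" "Seq n \<notin> Q" "RemLim \<notin> Q" for m j z n
      by (auto simp: 4)
    have fQ: "m \<in> P \<Longrightarrow> k \<in> Ix m \<Longrightarrow> fib m k \<subseteq> Q" "j \<noteq> k \<Longrightarrow> fib m j \<inter> Q = {}" for m j
      by (auto simp: Q fib_def)
    have fS: "m \<in> P \<Longrightarrow> j \<in> Ix m \<Longrightarrow> j \<noteq> k \<Longrightarrow> fib m j \<subseteq> S - Q" for m j
      using fQ(2)[of j m] fib_sub_S[of m j] by blast
    have "openin X Q"
    proof (rule opn_by_fibres)
      show "Q \<subseteq> S" by (simp add: 4)
      show "fib m j \<subseteq> Q \<or> fib m j \<inter> Q = {}" if "m \<in> P" "j \<in> Ix m" for m j
        using fQ that by (cases "j = k") simp_all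
      show "Rem j \<in> Q \<longrightarrow> (\<exists>b. \<forall>m\<in>P. b \<le> m \<and> j \<in> Ix m \<longrightarrow> fib m j \<subseteq> Q)" for j
        by (simp add: Q fQ)
    qed (simp_all add: Q)
    moreover have "openin X (S - Q)"
    proof (rule opn_by_fibres)
      show "fib m j \<subseteq> S - Q \<or> fib m j \<inter> (S - Q) = {}" if "m \<in> P" "j \<in> Ix m" for m j
        using fS[OF that] fQ(1)[of m] that by (cases "j = k") blast+
      show "RemLim \<in> S - Q \<longrightarrow> (\<exists>b. \<forall>j. b < \<bar>j\<bar> \<longrightarrow> Rem j \<in> S - Q \<and> (\<forall>m\<in>P. j \<in> Ix m \<longrightarrow> fib m j \<subseteq> S - Q))"
        by (intro impI exI[of _ "\<bar>k\<bar>"]) (use fS in \<open>auto simp: Q\<close>)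
      show "Rem j \<in> S - Q \<longrightarrow> (\<exists>b. \<forall>m\<in>P. b \<le> m \<and> j \<in> Ix m \<longrightarrow> fib m j \<subseteq> S - Q)" for j
        using fS by (auto simp: Q)
    qed (auto simp: Q)
    ultimately show ?thesis by blast
  qed
  then show "openin X Q" "openin X (S - Q)" by auto
qed

lemma clopens_separate:
  assumes "w \<in> S" "w' \<in> S" "w \<noteq> w'"
    and "\<nexists>m k z z'. m \<in> P \<and> k \<in> Ix m \<and> z \<in> topspace (Y m) \<and> z' \<in> topspace (Y m) \<and> w = Fib m k z \<and> w' = Fib m k z'"
  shows "\<exists>Q\<in>clopens. (w \<in> Q) \<noteq> (w' \<in> Q)"
proof -
  have f: "fib m k \<in> clopens" if "m \<in> P" "k \<in> Ix m" for m k using that by (auto simp: clopens_def)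
  have s: "{Seq n} \<in> clopens" for n by (auto simp: clopens_def)
  have sl: "insert SeqLim (range Seq) \<in> clopens" by (auto simp: clopens_def)
  have r: "S \<inter> ({Rem k} \<union> (\<Union>m. fib m k)) \<in> clopens" for k by (auto simp: clopens_def)
  have sym: "\<exists>Q\<in>clopens. (w \<in> Q) \<noteq> (w' \<in> Q)" if "w = Fib m k z \<or> w' = Fib m k z" for m k z
  proof -
    have "m \<in> P" "k \<in> Ix m" using assms(1,2) that by auto
    then show ?thesis using f assms that by (intro bexI[of _ "fib m k"]) (auto simp: fib_def)
  qed
  show ?thesis
  proof (cases "\<exists>m k z. w = Fib m k z \<or> w' = Fib m k z")
    case True
    then show ?thesis using sym by blast
  next
    case False
    show ?thesis
    proof (cases "\<exists>n. w = Seq n \<or> w' = Seq n")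
      case True
      then obtain n where "w = Seq n \<or> w' = Seq n" by blast
      then show ?thesis using assms(3) by (intro bexI[OF _ s[of n]]) auto
    next
      case noSeq: False
      show ?thesis
      proof (cases "\<exists>n. w = Rem n \<or> w' = Rem n")
        case True
        then obtain n where "w = Rem n \<or> w' = Rem n" by blast
        then show ?thesis using assms(1-3) False by (intro bexI[OF _ r[of n]]) (cases w; cases w'; auto)
      next
        case noRem: False
        then show ?thesis using assms(3) False noSeq by (intro bexI[OF _ sl]) (cases w; cases w'; auto)
      qed
    qed
  qed
qed

lemma Hausdorff_X: "Hausdorff_space X"
  unfolding Hausdorff_space_def
proof (intro allI impI)
  fix w w' assume a: "w \<in> topspace X \<and> w' \<in> topspace X \<and> w \<noteq> w'"
  show "\<exists>U V. openin X U \<and> openin X V \<and> w \<in> U \<and> w' \<in> V \<and> disjnt U V"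
  proof (cases "\<exists>m k z z'. m \<in> P \<and> k \<in> Ix m \<and> z \<in> topspace (Y m) \<and> z' \<in> topspace (Y m) \<and> w = Fib m k z \<and> w' = Fib m k z'")
    case True
    then obtain m k z z' where w: "m \<in> P" "k \<in> Ix m" "z \<in> topspace (Y m)" "z' \<in> topspace (Y m)" "w = Fib m k z" "w' = Fib m k z'"
      by blast
    then obtain U V where "openin (Y m) U" "openin (Y m) V" "z \<in> U" "z' \<in> V" "disjnt U V"
      using Hausdorff_Y[of m] a unfolding Hausdorff_space_def by (metis (no_types, lifting))
    then show ?thesis using w
      by (intro exI[of _ "Fib m k ` U"] exI[of _ "Fib m k ` V"]) (auto simp: openin_Fib_image disjnt_def)
  next
    case False
    then obtain Q where "Q \<in> clopens" "(w \<in> Q) \<noteq> (w' \<in> Q)" 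
      using clopens_separate[OF _ _ _ False] a unfolding topspace_X by blast
    then show ?thesis using clopens_open[of Q] a
      by (cases "w \<in> Q") (auto simp: disjnt_def intro: exI[of _ Q] exI[of _ "S - Q"])
  qed
qed

lemma compact_fib: "m \<in> P \<Longrightarrow> k \<in> Ix m \<Longrightarrow> compactin X (fib m k)"
  unfolding fib_def using compact_Y continuous_Fib image_compactin unfolding compact_space_def by blast

text \<open>For infinite \<open>P\<close>, the members of the cover chosen at \<open>SeqLim\<close>,
  at \<open>RemLim\<close> and at finitely many \<open>Rem k\<close> miss only finitely many points
  \<open>Seq n\<close> and finitely many copies, which are compact. For finite \<open>P\<close>
  there are only finitely many copies altogether.\<close>

lemma compact_X: "compact_space X"
proof -
  have "\<exists>\<F>. finite \<F> \<and> \<F> \<subseteq> \<U> \<and> S \<subseteq> \<Union>\<F>" if \<U>: "\<forall>U\<in>\<U>. openin X U" "S \<subseteq> \<Union>\<U>" for \<U>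
  proof -
    have cover: "\<exists>U\<in>\<U>. w \<in> U" if "w \<in> S" for w using \<U>(2) that by blast
    obtain Us where Us: "Us \<in> \<U>" "SeqLim \<in> Us" using cover[of SeqLim] by auto
    then obtain bs where bs: "\<And>n. n \<ge> bs \<Longrightarrow> Seq n \<in> Us" using opn_SeqLim \<U>(1) openin_X by blast
    have rem: "\<exists>\<F> J. finite \<F> \<and> \<F> \<subseteq> \<U> \<and> finite J \<and> J \<subseteq> Sigma P Ix \<and>
       S - insert SeqLim (range Seq) - (\<Union>(m, k)\<in>J. fib m k) \<subseteq> \<Union>\<F>"
    proof (cases "finite P")
      case True
      then have "finite (Sigma P Ix)" by (auto simp: Ix_def)
      then show ?thesis using True
        by (intro exI[of _ "{}"] exI[of _ "Sigma P Ix"]) (auto simp: S_def)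
    next
      case False
      then obtain U where U: "U \<in> \<U>" "RemLim \<in> U" using cover[of RemLim] by auto
      then obtain b where b: "\<And>k. b < \<bar>k\<bar> \<Longrightarrow> Rem k \<in> U \<and> (\<forall>m\<in>P. k \<in> Ix m \<longrightarrow> fib m k \<subseteq> U)"
        using opn_RemLim \<U>(1) openin_X by blast
      have "\<forall>k. \<exists>V. V \<in> \<U> \<and> Rem k \<in> V" using cover[of "Rem _"] False by auto
      then obtain V where V: "\<And>k. V k \<in> \<U>" "\<And>k. Rem k \<in> V k" by metis
      have "\<forall>k. \<exists>c. \<forall>m\<in>P. c \<le> m \<and> k \<in> Ix m \<longrightarrow> fib m k \<subseteq> V k"
        using V opn_Rem \<U>(1) openin_X by blast
      then obtain c where c: "\<And>k m. m \<in> P \<Longrightarrow> c k \<le> m \<Longrightarrow> k \<in> Ix m \<Longrightarrow> fib m k \<subseteq> V k" by metis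
      \<comment> \<open>All copies of the blocks below one of the bounds \<open>c k\<close>:
        possibly more than the chosen members miss, but still finitely many.\<close>
      define J where "J = (SIGMA m:P \<inter> (\<Union>k\<in>{-b..b}. {..<c k}). Ix m)"
      have "finite J" unfolding J_def by (intro finite_SigmaI) (auto simp: Ix_def)
      moreover have "S - insert SeqLim (range Seq) - (\<Union>(m, k)\<in>J. fib m k) \<subseteq> \<Union>(insert U (V ` {-b..b}))"
      proof
        fix w assume w: "w \<in> S - insert SeqLim (range Seq) - (\<Union>(m, k)\<in>J. fib m k)"
        show "w \<in> \<Union>(insert U (V ` {-b..b}))"
        proof (cases w)
          case (Fib m k z)
          then have mk: "m \<in> P" "k \<in> Ix m" "w \<in> fib m k" using w by auto
          then have "(m, k) \<notin> J" using w by blast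
          then have nJ: "k \<in> {-b..b} \<Longrightarrow> c k \<le> m" using mk by (auto simp: J_def not_less)
          show ?thesis
          proof (cases "k \<in> {-b..b}")
            case True
            then have "w \<in> V k" using c[OF mk(1) nJ[OF True] mk(2)] mk(3) by blast
            then show ?thesis using True by blast
          next
            case False
            then have "b < \<bar>k\<bar>" by auto
            then have "w \<in> U" using b mk by blast
            then show ?thesis by blast
          qed
        next
          case (Rem k)
          then show ?thesis using b[of k] V(2)[of k] by (cases "k \<in> {-b..b}") auto
        qed (use w U in auto)
      qed
      ultimately show ?thesis
        using U V by (intro exI[of _ "insert U (V ` {-b..b})"] exI[of _ J]) (auto simp: J_def)
    qed
    then obtain \<F> J where \<F>: "finite \<F>" "\<F> \<subseteq> \<U>" "finite J" "J \<subseteq> Sigma P Ix"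
       "S - insert SeqLim (range Seq) - (\<Union>(m, k)\<in>J. fib m k) \<subseteq> \<Union>\<F>" by blast
    have "compactin X (\<Union>(m, k)\<in>J. fib m k)"
      using \<F>(3,4) compact_fib by (intro compactin_Union) auto
    moreover have "(\<Union>(m, k)\<in>J. fib m k) \<subseteq> \<Union>\<U>" using \<F>(4) fib_sub_S \<U>(2) by blast
    ultimately obtain \<G> where \<G>: "finite \<G>" "\<G> \<subseteq> \<U>" "(\<Union>(m, k)\<in>J. fib m k) \<subseteq> \<Union>\<G>"
      using \<U>(1) unfolding compactin_def by meson
    have "\<forall>n. \<exists>U. U \<in> \<U> \<and> Seq n \<in> U" using cover[of "Seq _"] by auto
    then obtain V where V: "\<And>n. V n \<in> \<U>" "\<And>n. Seq n \<in> V n" by metis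
    have "S \<subseteq> \<Union>(\<F> \<union> \<G> \<union> insert Us (V ` {..<bs}))"
    proof
      fix w assume w: "w \<in> S"
      have Seq: "Seq n \<in> \<Union>(insert Us (V ` {..<bs}))" for n
        using bs[of n] V(2)[of n] by (cases "n < bs") auto
      consider "w \<in> insert SeqLim (range Seq)" | "w \<in> (\<Union>(m, k)\<in>J. fib m k)"
        | "w \<in> S - insert SeqLim (range Seq) - (\<Union>(m, k)\<in>J. fib m k)"
        using w by blast
      then show "w \<in> \<Union>(\<F> \<union> \<G> \<union> insert Us (V ` {..<bs}))"
      proof cases
        case 1
        then have "w \<in> \<Union>(insert Us (V ` {..<bs}))" using Seq Us(2) by auto
        then show ?thesis by (simp only: Union_Un_distrib) simp
      next
        case 2
        then have "w \<in> \<Union>\<G>" by (rule subsetD[OF \<G>(3)])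
        then show ?thesis by (simp only: Union_Un_distrib) simp
      next
        case 3
        then have "w \<in> \<Union>\<F>" by (rule subsetD[OF \<F>(5)])
        then show ?thesis by (simp only: Union_Un_distrib) simp
      qed
    qed
    moreover have "finite (\<F> \<union> \<G> \<union> insert Us (V ` {..<bs}))" "\<F> \<union> \<G> \<union> insert Us (V ` {..<bs}) \<subseteq> \<U>"
      using \<F> \<G> Us V by auto
    ultimately show ?thesis by (intro exI conjI)
  qed
  then show ?thesis unfolding compact_space_alt by simp
qed


subsection \<open>The dynamics\<close>

primrec \<psi> :: "'y block_point \<Rightarrow> 'y block_point" where
  "\<psi> (Fib m k z) = Fib m (wrap m (k - 1)) (\<theta> m z)"
| "\<psi> (Seq n) = Seq (Suc n)"
| "\<psi> SeqLim = SeqLim"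
| "\<psi> (Rem k) = Rem (k - 1)"
| "\<psi> RemLim = RemLim"

text \<open>Truncated subtraction makes \<open>Seq 0\<close> a fixed point, so that
  \<open>\<phi>\<close> is continuous on the whole space; the homeomorphism is its restriction to
  the complement of \<open>Seq 0\<close>.\<close>

primrec \<phi> :: "'y block_point \<Rightarrow> 'y block_point" where
  "\<phi> (Fib m k z) = Fib m (wrap m (k + 1)) (\<theta>' m z)"
| "\<phi> (Seq n) = Seq (n - 1)"
| "\<phi> SeqLim = SeqLim"
| "\<phi> (Rem k) = Rem (k + 1)"
| "\<phi> RemLim = RemLim"

text \<open>The sign depends on the index alone and therefore passes continuously to the
  remainder.\<close>

primrec weight :: "'y block_point \<Rightarrow> real" where
  "weight (Fib m k z) = (if k = 0 then -1 else 1)"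
| "weight (Seq n) = 1"
| "weight SeqLim = 1"
| "weight (Rem k) = (if k = 0 then -1 else 1)"
| "weight RemLim = 1"

definition base :: "nat \<Rightarrow> 'y block_point" where "base m = Fib m 0 (y m)"
definition block :: "nat \<Rightarrow> 'y block_point set" where "block m = (\<Union>k\<in>Ix m. fib m k)"

lemma \<theta>_cont: "m \<in> P \<Longrightarrow> continuous_map (Y m) (Y m) (\<theta> m)" "m \<in> P \<Longrightarrow> continuous_map (Y m) (Y m) (\<theta>' m)"
  using \<theta> by (auto simp: homeomorphic_maps_def)

lemma \<theta>_in [simp]: "m \<in> P \<Longrightarrow> z \<in> topspace (Y m) \<Longrightarrow> \<theta> m z \<in> topspace (Y m)"
  "m \<in> P \<Longrightarrow> z \<in> topspace (Y m) \<Longrightarrow> \<theta>' m z \<in> topspace (Y m)"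
  using continuous_map_funspace[OF \<theta>_cont(1)] continuous_map_funspace[OF \<theta>_cont(2)] by blast+

lemma \<theta>_inv [simp]: "m \<in> P \<Longrightarrow> z \<in> topspace (Y m) \<Longrightarrow> \<theta> m (\<theta>' m z) = z"
  "m \<in> P \<Longrightarrow> z \<in> topspace (Y m) \<Longrightarrow> \<theta>' m (\<theta> m z) = z"
  using \<theta> by (auto simp: homeomorphic_maps_def)

lemma \<psi>_S: "w \<in> S \<Longrightarrow> \<psi> w \<in> S - {Seq 0}"
  by (cases w) (auto simp: wrap_in)

lemma \<phi>_S: "w \<in> S \<Longrightarrow> \<phi> w \<in> S"
  by (cases w) (auto simp: wrap_in)

lemma \<phi>_\<psi>: "w \<in> S \<Longrightarrow> \<phi> (\<psi> w) = w"
  by (cases w) (auto simp: wrap_wrap wrap_id)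

lemma \<psi>_\<phi>: "w \<in> S \<Longrightarrow> w \<noteq> Seq 0 \<Longrightarrow> \<psi> (\<phi> w) = w"
  using wrap_wrap[of _ _ "-1"] by (cases w) (auto simp: wrap_id)

text \<open>Both \<open>\<psi>\<close> and \<open>\<phi>\<close> move indices by \<open>d = - 1\<close> and \<open>d = 1\<close>, so that one argument serves for both.\<close>

lemma index_shift_preimage_opn:
  fixes f :: "'y block_point \<Rightarrow> 'y block_point" and g :: "nat \<Rightarrow> 'y \<Rightarrow> 'y"
  assumes fF: "\<And>m k z. f (Fib m k z) = Fib m (wrap m (k + d)) (g m z)"
    and fR: "\<And>k. f (Rem k) = Rem (k + d)" "f RemLim = RemLim" "f SeqLim = SeqLim"
    and fS: "\<And>b. \<exists>c. \<forall>n\<ge>c. \<exists>n'\<ge>b. f (Seq n) = Seq n'"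
    and g: "\<And>m. m \<in> P \<Longrightarrow> continuous_map (Y m) (Y m) (g m)"
    and far: "\<And>m k. m \<in> P \<Longrightarrow> k \<in> Ix m \<Longrightarrow> \<bar>k\<bar> - 1 \<le> \<bar>wrap m (k + d)\<bar>"
    and d: "\<bar>d\<bar> = 1" and U: "opn U"
  shows "opn {w \<in> S. f w \<in> U}"
proof -
  have fib_g: "fib m k \<subseteq> {w \<in> S. f w \<in> U}" if "m \<in> P" "k \<in> Ix m" "fib m (wrap m (k + d)) \<subseteq> U" for m k
  proof -
    have "g m z \<in> topspace (Y m)" if "z \<in> topspace (Y m)" for z
      using g[OF \<open>m \<in> P\<close>] that by (auto simp: continuous_map_def)
    then show ?thesis using that by (auto simp: fib_def fF)
  qed
  show ?thesis unfolding opn_def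
  proof (intro conjI ballI allI impI)
    fix m k assume mk: "m \<in> P" "k \<in> Ix m"
    have "{z. Fib m k z \<in> {w \<in> S. f w \<in> U}} = {z \<in> topspace (Y m). g m z \<in> {z. Fib m (wrap m (k + d)) z \<in> U}}"
      using mk by (auto simp: fF)
    then show "openin (Y m) {z. Fib m k z \<in> {w \<in> S. f w \<in> U}}"
      using openin_continuous_map_preimage[OF g[OF mk(1)] opn_fib[OF U mk(1) wrap_in[OF mk(1)]]] by simp
  next
    assume "SeqLim \<in> {w \<in> S. f w \<in> U}"
    then obtain b where b: "\<forall>n\<ge>b. Seq n \<in> U" using opn_SeqLim[OF U] fR by auto
    obtain c where "\<forall>n\<ge>c. \<exists>n'\<ge>b. f (Seq n) = Seq n'" using fS by blast
    then have "\<forall>n\<ge>c. Seq n \<in> {w \<in> S. f w \<in> U}" using b by auto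
    then show "\<exists>b. \<forall>n\<ge>b. Seq n \<in> {w \<in> S. f w \<in> U}" by blast
  next
    fix k assume "Rem k \<in> {w \<in> S. f w \<in> U}"
    then obtain b where b: "\<forall>m\<in>P. b \<le> m \<and> k + d \<in> Ix m \<longrightarrow> fib m (k + d) \<subseteq> U"
      using opn_Rem[OF U, of "k + d"] fR by auto
    have "fib m k \<subseteq> {w \<in> S. f w \<in> U}" if "m \<in> P" "max b (nat (2 * \<bar>k + d\<bar> + 2)) \<le> m" "k \<in> Ix m" for m
    proof (rule fib_g[OF that(1,3)])
      \<comment> \<open>In blocks this late the index \<open>k + d\<close> needs no wrapping, so
        copies near \<open>Rem k\<close> go to copies near \<open>Rem (k + d)\<close>.\<close>
      have kd: "k + d \<in> Ix m" using that by (intro in_Ix_large) auto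
      then have "fib m (k + d) \<subseteq> U" using b that by simp
      then show "fib m (wrap m (k + d)) \<subseteq> U" by (simp add: wrap_id[OF kd])
    qed
    then show "\<exists>b. \<forall>m\<in>P. b \<le> m \<and> k \<in> Ix m \<longrightarrow> fib m k \<subseteq> {w \<in> S. f w \<in> U}" by blast
  next
    assume R: "RemLim \<in> {w \<in> S. f w \<in> U}"
    then obtain b where b: "\<forall>k. b < \<bar>k\<bar> \<longrightarrow> Rem k \<in> U \<and> (\<forall>m\<in>P. k \<in> Ix m \<longrightarrow> fib m k \<subseteq> U)"
      using opn_RemLim[OF U] fR by auto
    have "Rem k \<in> {w \<in> S. f w \<in> U} \<and> (\<forall>m\<in>P. k \<in> Ix m \<longrightarrow> fib m k \<subseteq> {w \<in> S. f w \<in> U})" if k: "b + 1 < \<bar>k\<bar>" for k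
    proof (intro conjI ballI impI)
      have "b < \<bar>k + d\<bar>" using k d by linarith
      then show "Rem k \<in> {w \<in> S. f w \<in> U}" using R b fR(1) by simp
      fix m assume m: "m \<in> P" "k \<in> Ix m"
      \<comment> \<open>Wrapping may change the sign of the index but cannot bring it near
        0.\<close>
      then have "b < \<bar>wrap m (k + d)\<bar>" using far[OF m] k by linarith
      then show "fib m k \<subseteq> {w \<in> S. f w \<in> U}" using b m wrap_in by (intro fib_g) auto
    qed
    then show "\<exists>b. \<forall>k. b < \<bar>k\<bar> \<longrightarrow> Rem k \<in> {w \<in> S. f w \<in> U} \<and> (\<forall>m\<in>P. k \<in> Ix m \<longrightarrow> fib m k \<subseteq> {w \<in> S. f w \<in> U})"
      by blast
  qed blast
qed

lemma \<psi>_cont: "continuous_map X X \<psi>"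
proof -
  have "opn {w \<in> S. \<psi> w \<in> U}" if "opn U" for U
  proof (rule index_shift_preimage_opn[where d = "- 1" and g = \<theta>])
    show "\<exists>c. \<forall>n\<ge>c. \<exists>n'\<ge>b. \<psi> (Seq n) = Seq n'" for b by (intro exI[of _ b]) auto
  qed (use that \<theta>_cont wrap_pred_far in auto)
  then show ?thesis using \<psi>_S by (auto simp: continuous_map_def openin_X)
qed

lemma \<phi>_cont: "continuous_map X X \<phi>"
proof -
  have "opn {w \<in> S. \<phi> w \<in> U}" if "opn U" for U
  proof (rule index_shift_preimage_opn[where d = 1 and g = \<theta>'])
    show "\<exists>c. \<forall>n\<ge>c. \<exists>n'\<ge>b. \<phi> (Seq n) = Seq n'" for b by (intro exI[of _ "Suc b"]) auto
  qed (use that \<theta>_cont wrap_succ_far in auto)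
  then show ?thesis using \<phi>_S by (auto simp: continuous_map_def openin_X)
qed

lemma weight_cont: "continuous_map X euclideanreal weight"
proof -
  define Q where "Q = S \<inter> ({Rem 0} \<union> (\<Union>m. fib m 0))"
  have "Q \<in> clopens" 
    unfolding clopens_def Q_def by (intro UnI2 image_eqI[of _ _ 0]) simp_all
  then have Q: "openin X Q" "openin X (S - Q)" by (rule clopens_open)+
  have w: "weight w = (if w \<in> Q then -1 else 1)" if "w \<in> S" for w
    using that by (cases w) (auto simp: Q_def)
  have "{w \<in> S. weight w \<in> U} = (if - 1 \<in> U then Q else {}) \<union> (if 1 \<in> U then S - Q else {})" for U
    using w openin_subset[OF Q(1)] by (auto split: if_splits)
  moreover have "openin X ((if - 1 \<in> U then Q else {}) \<union> (if 1 \<in> U then S - Q else {}))" for U :: "real set"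
    using Q by (intro openin_Un) auto
  ultimately show ?thesis by (simp add: continuous_map_def)
qed

section \<open>Orbits of the base points: density and simultaneous recurrence\<close>

lemma \<psi>_pow_Fib: "m \<in> P \<Longrightarrow> k \<in> Ix m \<Longrightarrow> (\<psi> ^^ n) (Fib m k z) = Fib m (wrap m (k - int n)) ((\<theta> m ^^ n) z)"
proof (induction n)
  case (Suc n)
  then show ?case using wrap_wrap[of m "k - int n" "-1"] by (simp add: algebra_simps)
qed (simp add: wrap_id)

lemma \<psi>_pow_base: "m \<in> P \<Longrightarrow> (\<psi> ^^ n) (base m) = Fib m (wrap m (- int n)) ((\<theta> m ^^ n) (y m))"
  unfolding base_def by (subst \<psi>_pow_Fib) (auto simp: zero_in_Ix)

lemma \<psi>_pow_Seq: "(\<psi> ^^ n) (Seq 0) = Seq n"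
  by (induction n) auto

text \<open>The orbit starts in the negative copy, at index 0, and returns to it exactly after
  multiples of \<open>p m\<close> steps.\<close>

lemma weight_base: "m \<in> P \<Longrightarrow> weight ((\<psi> ^^ n) (base m)) = (if p m dvd n then -1 else 1)"
proof -
  assume m: "m \<in> P"
  have "wrap m (- int n) = wrap m 0 \<longleftrightarrow> p m dvd n"
    by (subst wrap_eq_iff[OF m]) simp
  then show ?thesis using wrap_id[OF zero_in_Ix[OF m]] by (simp add: \<psi>_pow_base[OF m])
qed

lemma cocycle_base: "m \<in> P \<Longrightarrow> (\<Prod>i=1..n. weight ((\<psi> ^^ i) (base m))) = (- 1) ^ (n div p m)"
  by (simp only: weight_base prod_minus_one_multiples)

text \<open>After \<open>n\<close> steps the orbit is in the copy of index \<open>- n\<close> modulo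
  \<open>p m\<close>, so genericity is applied with modulus \<open>p m\<close> and the residue of
  \<open>- k\<close>.\<close>

lemma fibre_meets_orbit:
  assumes "m \<in> P" "k \<in> Ix m" "openin (Y m) V" "V \<noteq> {}"
  shows "\<exists>n. \<exists>z\<in>V. (\<psi> ^^ n) (base m) = Fib m k z"
proof -
  obtain n where n: "n mod p m = nat ((- k) mod int (p m)) mod p m" "(\<theta> m ^^ n) (y m) \<in> V"
    using generic[of "{m}" "p m" "\<lambda>_. V" 0 "nat ((- k) mod int (p m))"] assms p_pos by auto
  have "int n mod int (p m) = (- k) mod int (p m)"
  proof -
    have "int n mod int (p m) = int (nat ((- k) mod int (p m))) mod int (p m)"
      using arg_cong[OF n(1), of int] by (simp only: zmod_int)
    then show ?thesis using p_pos[OF assms(1)] by simp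
  qed
  then have "int (p m) dvd int n - (- k)" by (simp only: mod_eq_dvd_iff)
  then have "int (p m) dvd - (int n - (- k))" by (simp only: dvd_minus_iff)
  moreover have "- (int n - (- k)) = - int n - k" by simp
  ultimately have "int (p m) dvd - int n - k" by metis
  then have "wrap m (- int n) = k" using wrap_eq_iff[OF assms(1)] wrap_id[OF assms(2)] by metis
  then show ?thesis using n(2) \<psi>_pow_base[OF assms(1)] by auto
qed

text \<open>Copies are reached by \<open>fibre_meets_orbit\<close>. A neighbourhood of
  \<open>Rem k\<close> contains a whole copy from a late block, and one of \<open>RemLim\<close>
  contains some \<open>Rem k\<close>, so the remainder follows from the copies.\<close>

lemma dense_orbits:
  "X closure_of (range (\<lambda>n. (\<psi> ^^ n) (Seq 0)) \<union> (\<Union>m\<in>P. range (\<lambda>n. (\<psi> ^^ n) (base m)))) = topspace X"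
    (is "X closure_of ?D = _")
proof -
  have "\<exists>d\<in>?D. d \<in> U" if w: "w \<in> S" "w \<in> U" "openin X U" for w U
  proof -
    have U: "opn U" using w by (simp add: openin_X)
    have F: ?thesis if mk: "m \<in> P" "k \<in> Ix m" "Fib m k z \<in> U" for m k z
    proof -
      have "{z. Fib m k z \<in> U} \<noteq> {}" using mk(3) by blast
      then obtain n z' where "Fib m k z' \<in> U" "(\<psi> ^^ n) (base m) = Fib m k z'"
        using fibre_meets_orbit[OF mk(1,2) opn_fib[OF U mk(1,2)]] by blast
      then have "(\<psi> ^^ n) (base m) \<in> U" by simp
      moreover have "(\<psi> ^^ n) (base m) \<in> ?D" using mk(1) by blast
      ultimately show ?thesis by (rule bexI)
    qed
    have R: ?thesis if k: "Rem k \<in> U" for k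
    proof -
      have inf: "infinite P" using k opn_sub[OF U] by auto
      obtain b where b: "\<forall>m\<in>P. b \<le> m \<and> k \<in> Ix m \<longrightarrow> fib m k \<subseteq> U" using opn_Rem[OF U k] by blast
      obtain m where m: "m \<in> P" "max b (nat (2 * \<bar>k\<bar> + 2)) < m"
        using inf unfolding infinite_nat_iff_unbounded by blast
      then have "2 * \<bar>k\<bar> + 2 \<le> int m" by linarith
      then have "k \<in> Ix m" by (rule in_Ix_large[OF m(1)])
      moreover from this have "fib m k \<subseteq> U" using b m by simp
      then have "Fib m k (y m) \<in> U" using y_in[OF m(1)] by (auto simp: fib_def)
      ultimately show ?thesis using F[OF m(1)] by blast
    qed
    show ?thesis
    proof (cases w)
      case (Fib m k z)
      then show ?thesis using F w by auto
    next
      case (Seq n)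
      then show ?thesis using w by (auto simp: \<psi>_pow_Seq)
    next
      case SeqLim
      then obtain b where "Seq b \<in> U" using opn_SeqLim[OF U] w by blast
      then show ?thesis by (auto simp: \<psi>_pow_Seq)
    next
      case (Rem k)
      then show ?thesis using R w by blast
    next
      case RemLim
      then obtain b where b: "\<forall>k. b < \<bar>k\<bar> \<longrightarrow> Rem k \<in> U" using opn_RemLim[OF U] w by blast
      then have "Rem (\<bar>b\<bar> + 1) \<in> U" by simp
      then show ?thesis by (rule R)
    qed
  qed
  then have "S \<subseteq> X closure_of ?D" unfolding in_closure_of subset_iff by (metis topspace_X)
  then show ?thesis using closure_of_subset_topspace[of X ?D] by auto
qed

text \<open>Genericity is used twice with modulus \<open>2 * p k\<close>, for the residues of
  \<open>j\<close> and of \<open>j + p k\<close>. For \<open>m < k\<close> the shift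
  \<open>p k\<close> is a multiple of \<open>2 * p m\<close>, and the signs agree; for
  \<open>m = k\<close> it raises the quotient by one, and the sign flips.\<close>

lemma recurrence:
  assumes k: "k \<in> P" and U: "\<And>m. m \<in> P \<Longrightarrow> m \<le> k \<Longrightarrow> openin X (U m) \<and> (\<psi> ^^ j) (base m) \<in> U m"
  shows "\<exists>n n'. B \<le> n \<and> B \<le> n' \<and> (\<forall>m\<in>P. m \<le> k \<longrightarrow>
         (\<psi> ^^ n) (base m) \<in> U m \<and> (\<psi> ^^ n') (base m) \<in> U m \<and>
         (\<Prod>i=1..n. weight ((\<psi> ^^ i) (base m))) =
           (if m = k then - 1 else 1) * (\<Prod>i=1..n'. weight ((\<psi> ^^ i) (base m))))"
proof -
  define F where "F = {m \<in> P. m \<le> k}"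
  \<comment> \<open>The trace of \<open>U m\<close> on the copy that holds
    \<open>(\<psi> ^^ j) (base m)\<close>; times congruent to \<open>j\<close> modulo
    \<open>p m\<close> lead back to this copy.\<close>
  define V where "V m = {z. Fib m (wrap m (- int j)) z \<in> U m}" for m
  have F: "finite F" "F \<subseteq> P" by (auto simp: F_def)
  have V: "openin (Y m) (V m) \<and> V m \<noteq> {}" if "m \<in> F" for m
  proof -
    have m: "m \<in> P" "m \<le> k" using that by (auto simp: F_def)
    have "(\<theta> m ^^ j) (y m) \<in> V m" using U[OF m] by (simp add: V_def \<psi>_pow_base[OF m(1)])
    then show ?thesis unfolding V_def
      using openin_fib[OF _ m(1) wrap_in[OF m(1)]] U[OF m] by blast
  qed
  have L: "0 < 2 * p k" using p_pos[OF k] by simp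
  obtain n where n: "B \<le> n" "n mod (2 * p k) = j mod (2 * p k)" "\<forall>m\<in>F. (\<theta> m ^^ n) (y m) \<in> V m"
    using generic[OF F L V, where B = B and r = j] by blast
  obtain n' where n': "B \<le> n'" "n' mod (2 * p k) = (j + p k) mod (2 * p k)" "\<forall>m\<in>F. (\<theta> m ^^ n') (y m) \<in> V m"
    using generic[OF F L V, where B = B and r = "j + p k"] by blast
  have "(\<psi> ^^ n) (base m) \<in> U m \<and> (\<psi> ^^ n') (base m) \<in> U m \<and>
         (\<Prod>i=1..n. weight ((\<psi> ^^ i) (base m))) =
           (if m = k then - 1 else 1) * (\<Prod>i=1..n'. weight ((\<psi> ^^ i) (base m)))"
    if m: "m \<in> P" "m \<le> k" for m
  proof -
    have "p m dvd p k"
    proof (cases "m = k")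
      case False
      then show ?thesis using p_even[OF m(1) k] m(2) dvd_mult_right by (metis le_neq_implies_less)
    qed simp
    then have d: "p m dvd 2 * p k" by simp
    have "n mod p m = j mod p m" "n' mod p m = (j + p k) mod p m"
      using n(2) n'(2) d by (metis mod_mod_cancel)+
    then have c: "n mod p m = j mod p m" "n' mod p m = j mod p m"
      using \<open>p m dvd p k\<close> by auto
    have w: "wrap m (- int i) = wrap m (- int j)" if "i mod p m = j mod p m" for i
    proof -
      have "int (p m) dvd int j - int i"
        using that by (metis mod_eq_dvd_iff zmod_int)
      then show ?thesis by (simp add: wrap_eq_iff[OF m(1)])
    qed
    have mF: "m \<in> F" using m by (simp add: F_def)
    have U1: "(\<psi> ^^ n) (base m) \<in> U m" "(\<psi> ^^ n') (base m) \<in> U m"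
      using bspec[OF n(3) mF] bspec[OF n'(3) mF]
      by (simp_all add: \<psi>_pow_base[OF m(1)] V_def w[OF c(1)] w[OF c(2)])
    have pm: "0 < p m" by (rule p_pos[OF m(1)])
    have "(- 1 :: real) ^ (n div p m) = (if m = k then - 1 else 1) * (- 1) ^ (n' div p m)"
    proof (cases "m = k")
      case True
      have "(- 1 :: real) ^ (n' div p k) = (- 1) ^ ((j + p k) div p k)"
        by (rule minus_one_power_div_cong[OF n'(2) p_pos[OF k]])
      also have "(j + p k) div p k = Suc (j div p k)" using p_pos[OF k] by simp
      finally show ?thesis using minus_one_power_div_cong[OF n(2) p_pos[OF k]] True by simp
    next
      case False
      then have dd: "2 * p m dvd p k" using p_even[OF m(1) k] m(2) by simp
      then have "n mod (2 * p m) = j mod (2 * p m)" "n' mod (2 * p m) = (j + p k) mod (2 * p m)"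
        using n(2) n'(2) by (metis dvd_mult mod_mod_cancel)+
      moreover have "(j + p k) mod (2 * p m) = j mod (2 * p m)" using dd by auto
      ultimately show ?thesis
        using minus_one_power_div_cong[OF _ pm, of n j] minus_one_power_div_cong[OF _ pm, of n' j] False by simp
    qed
    then show ?thesis using U1 by (simp only: cocycle_base[OF m(1)])
  qed
  then show ?thesis using n(1) n'(1) by blast
qed

lemma open_block: "m \<in> P \<Longrightarrow> openin X (block m)"
  unfolding block_def fib_def using openin_Fib_image by blast

lemma block_shift_model: "shift_model X P (Seq 0) \<phi> \<psi> weight SeqLim base block"
proof
  show "compact_space X" "Hausdorff_space X" by (fact compact_X, fact Hausdorff_X)
  show "P \<noteq> {}" "0 \<notin> P" by (fact P_nonempty, fact P_pos)
  show "openin X {Seq 0}" by (rule openin_Seq)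
  show "homeomorphic_maps X (subtopology X (topspace X - {Seq 0})) \<psi> \<phi>"
    unfolding homeomorphic_maps_def
    using \<psi>_cont \<psi>_S continuous_map_from_subtopology[OF \<phi>_cont] \<phi>_\<psi> \<psi>_\<phi>
    by (auto simp: continuous_map_in_subtopology)
  show "continuous_map X euclideanreal weight" by (rule weight_cont)
  show "\<bar>weight z\<bar> = 1" if "z \<in> topspace X" for z by (cases z) auto
  show "limitin X (\<lambda>n. (\<psi> ^^ n) (Seq 0)) SeqLim sequentially"
    using opn_SeqLim by (simp add: limitin_def \<psi>_pow_Seq openin_X eventually_sequentially)
  show "weight ((\<psi> ^^ n) (Seq 0)) = 1" for n by (simp add: \<psi>_pow_Seq)
  show "openin X (block m)" if "m \<in> P" for m by (rule open_block[OF that])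
  show "base m \<in> block m" if "m \<in> P" for m
    using zero_in_Ix[OF that] y_in[OF that] by (auto simp: base_def block_def)
  show "\<psi> ` block m = block m" if m: "m \<in> P" for m
  proof
    show "\<psi> ` block m \<subseteq> block m"
    proof
      fix v assume "v \<in> \<psi> ` block m"
      then obtain k z where "v = \<psi> (Fib m k z)" "k \<in> Ix m" "z \<in> topspace (Y m)"
        by (auto simp: block_def fib_def)
      then show "v \<in> block m" using m by (simp add: block_def wrap_in)
    qed
    show "block m \<subseteq> \<psi> ` block m"
    proof
      fix w assume w: "w \<in> block m"
      then obtain k z where wz: "w = Fib m k z" "k \<in> Ix m" "z \<in> topspace (Y m)" by (auto simp: block_def fib_def)
      then have "w \<in> S" using m by simp
      then have "\<psi> (\<phi> w) = w" using wz by (intro \<psi>_\<phi>) auto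
      moreover have "\<phi> w \<in> block m" using wz m by (auto simp: block_def wrap_in)
      ultimately show "w \<in> \<psi> ` block m" by (metis imageI)
    qed
  qed
  show "Seq 0 \<notin> block m" if "m \<in> P" for m by (simp add: block_def)
  show "disjoint_family_on block P" by (auto simp: disjoint_family_on_def block_def fib_def)
qed (fact dense_orbits, fact recurrence)

text \<open>The family consists of the indicators of \<open>clopens\<close> and of the functions
  \<open>G m i\<close> placed on a single copy and extended by 0. It is the input for the embedding
  into \<open>ell2\<close>.\<close>

lemma countable_separating_functions:
  assumes G: "\<And>m i. m \<in> P \<Longrightarrow> continuous_map (Y m) euclideanreal (G m i)"
    and G01: "\<And>m i z. m \<in> P \<Longrightarrow> z \<in> topspace (Y m) \<Longrightarrow> G m i z \<in> {0..1}"
    and G_sep: "\<And>m z z'. m \<in> P \<Longrightarrow> z \<in> topspace (Y m) \<Longrightarrow> z' \<in> topspace (Y m) \<Longrightarrow> z \<noteq> z' \<Longrightarrow>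
      \<exists>i :: nat. G m i z \<noteq> G m i z'"
  shows "\<exists>F :: nat \<Rightarrow> 'y block_point \<Rightarrow> real. (\<forall>i. continuous_map X euclideanreal (F i)) \<and>
    (\<forall>i. \<forall>w\<in>topspace X. F i w \<in> {0..1}) \<and>
    (\<forall>w\<in>topspace X. \<forall>w'\<in>topspace X. w \<noteq> w' \<longrightarrow> (\<exists>i. F i w \<noteq> F i w'))"
proof -
  define I where "I Q w = (if w \<in> Q then 1 else 0 :: real)" for Q and w :: "'y block_point"
  define E where "E m k i w = (case w of Fib m' k' z \<Rightarrow> if m' = m \<and> k' = k then G m i z else 0 | _ \<Rightarrow> 0)"
    for m k i and w :: "'y block_point"
  define \<F> where "\<F> = I ` clopens \<union> (\<Union>m\<in>P. \<Union>k\<in>Ix m. range (E m k))"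
  have Ic: "continuous_map X euclideanreal (I Q)" if "Q \<in> clopens" for Q
  proof -
    have Q: "openin X Q" "openin X (S - Q)" by (rule clopens_open[OF that])+
    have "{w \<in> S. I Q w \<in> U} = (if 1 \<in> U then Q else {}) \<union> (if 0 \<in> U then S - Q else {})" for U
      using openin_subset[OF Q(1)] by (auto simp: I_def)
    moreover have "openin X ((if 1 \<in> U then Q else {}) \<union> (if 0 \<in> U then S - Q else {}))" for U :: "real set"
      using Q by (intro openin_Un) auto
    ultimately show ?thesis by (simp add: continuous_map_def)
  qed
  have Ec: "continuous_map X euclideanreal (E m k i)" if mk: "m \<in> P" "k \<in> Ix m" for m k i
  proof -
    have Q: "openin X (S - fib m k)" using mk by (intro clopens_open) (auto simp: clopens_def)
    have "{w \<in> S. E m k i w \<in> U} = Fib m k ` {z \<in> topspace (Y m). G m i z \<in> U} \<union> (if 0 \<in> U then S - fib m k else {})" for U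
    proof (rule set_eqI)
      fix w
      show "w \<in> {w \<in> S. E m k i w \<in> U} \<longleftrightarrow> w \<in> Fib m k ` {z \<in> topspace (Y m). G m i z \<in> U} \<union> (if 0 \<in> U then S - fib m k else {})"
        using mk by (cases w) (auto simp: E_def)
    qed
    moreover have "openin X (Fib m k ` {z \<in> topspace (Y m). G m i z \<in> U} \<union> (if 0 \<in> U then S - fib m k else {}))"
      if "open U" for U
      using Q openin_Fib_image[OF mk openin_continuous_map_preimage[OF G[OF mk(1)]], of U i] that
      by (intro openin_Un) auto
    ultimately show ?thesis by (simp add: continuous_map_def)
  qed
  have "countable clopens" unfolding clopens_def by auto
  then have cF: "countable \<F>" unfolding \<F>_def by auto
  have neF: "\<F> \<noteq> {}" unfolding \<F>_def clopens_def by auto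
  have F: "from_nat_into \<F> i \<in> \<F>" for i using neF by (rule from_nat_into)
  have surj: "\<exists>i. f = from_nat_into \<F> i" if "f \<in> \<F>" for f using from_nat_into_surj[OF cF that] by metis
  show ?thesis
  proof (intro exI[of _ "from_nat_into \<F>"] conjI allI ballI impI)
    show "continuous_map X euclideanreal (from_nat_into \<F> i)" for i
      using F[of i] Ic Ec unfolding \<F>_def by auto
    show "from_nat_into \<F> i w \<in> {0..1}" if "w \<in> topspace X" for i w
    proof -
      have "I Q w \<in> {0..1}" for Q by (simp add: I_def)
      moreover have "E m k j w \<in> {0..1}" if "m \<in> P" for m k j
        using G01[OF that] \<open>w \<in> topspace X\<close> by (cases w) (auto simp: E_def)
      ultimately show ?thesis using F[of i] unfolding \<F>_def by auto
    qed
    fix w w' assume w: "w \<in> topspace X" "w' \<in> topspace X" "w \<noteq> w'"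
    have "\<exists>f\<in>\<F>. f w \<noteq> f w'"
    proof (cases "\<exists>m k z z'. m \<in> P \<and> k \<in> Ix m \<and> z \<in> topspace (Y m) \<and> z' \<in> topspace (Y m) \<and> w = Fib m k z \<and> w' = Fib m k z'")
      case True
      then obtain m k z z' where z: "m \<in> P" "k \<in> Ix m" "z \<in> topspace (Y m)" "z' \<in> topspace (Y m)" "w = Fib m k z" "w' = Fib m k z'"
        by blast
      then obtain i where "G m i z \<noteq> G m i z'" using G_sep[of m z z'] w(3) by blast
      then have "E m k i w \<noteq> E m k i w'" using z by (simp add: E_def)
      moreover have "E m k i \<in> \<F>" using z(1,2) unfolding \<F>_def by blast
      ultimately show ?thesis by blast
    next
      case False
      then obtain Q where "Q \<in> clopens" "(w \<in> Q) \<noteq> (w' \<in> Q)"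
        using clopens_separate[OF _ _ w(3) False] w unfolding topspace_X by blast
      then show ?thesis by (intro bexI[of _ "I Q"]) (auto simp: I_def \<F>_def)
    qed
    then show "\<exists>i. from_nat_into \<F> i w \<noteq> from_nat_into \<F> i w'" using surj by metis
  qed
qed

end

section \<open>The compactification\<close>

text \<open>Compact subsets of a discrete space are finite. The resulting condition is the clause of
  \<open>opn\<close> at \<open>SeqLim\<close>.\<close>

lemma openin_convergent_sequence_space:
  "openin convergent_sequence_space V \<longleftrightarrow> (None \<in> V \<longrightarrow> (\<exists>b. \<forall>n\<ge>b. Some n \<in> V))"
proof
  assume "openin convergent_sequence_space V"
  then consider U where "V = Some ` U" | C :: "nat set" where "finite C" "V = insert None (Some ` (- C))"
    unfolding convergent_sequence_space_def openin_Alexandroff_compactification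
    by (auto simp: compactin_discrete_topology Compl_eq_Diff_UNIV)
  then show "None \<in> V \<longrightarrow> (\<exists>b. \<forall>n\<ge>b. Some n \<in> V)"
  proof cases
    case 2
    then obtain b where "C \<subseteq> {..<b}" using finite_nat_iff_bounded by blast
    then show ?thesis using 2 by (intro impI exI[of _ b]) auto
  qed auto
next
  assume r: "None \<in> V \<longrightarrow> (\<exists>b. \<forall>n\<ge>b. Some n \<in> V)"
  show "openin convergent_sequence_space V"
  proof (cases "None \<in> V")
    case True
    define C where "C = {n. Some n \<notin> V}"
    obtain b where "\<forall>n\<ge>b. Some n \<in> V" using r True by blast
    then have "C \<subseteq> {..<b}" by (auto simp: C_def not_le[symmetric])
    then have "finite C" using finite_subset by blast
    moreover have "V = insert None (Some ` (- C))"
    proof (rule set_eqI)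
      fix v show "v \<in> V \<longleftrightarrow> v \<in> insert None (Some ` (- C))" using True by (cases v) (auto simp: C_def)
    qed
    ultimately show ?thesis
      unfolding convergent_sequence_space_def openin_Alexandroff_compactification
      by (auto simp: compactin_discrete_topology Compl_eq_Diff_UNIV)
  next
    case False
    have "V = Some ` {n. Some n \<in> V}"
    proof (rule set_eqI)
      fix v show "v \<in> V \<longleftrightarrow> v \<in> Some ` {n. Some n \<in> V}" using False by (cases v) auto
    qed
    then show ?thesis
      unfolding convergent_sequence_space_def openin_Alexandroff_compactification
      by (metis UNIV_I openin_discrete_topology subset_UNIV)
  qed
qed

lemma topspace_convergent_sequence_space: "topspace convergent_sequence_space = UNIV"
  using openin_convergent_sequence_space[of UNIV] openin_subset by blast

lemma compactification_homeomorphic: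
  assumes "compactification W X" "homeomorphic_maps X Y h g"
  shows "compactification W Y"
proof -
  obtain e where X: "compact_space X" "Hausdorff_space X" and e: "embedding_map W X e" "X closure_of (e ` topspace W) = topspace X"
    using assms(1) unfolding compactification_def by blast
  have h: "homeomorphic_map X Y h" using assms(2) homeomorphic_maps_map by blast
  have "embedding_map X Y h"
    using h homeomorphic_imp_surjective_map[OF h] by (simp add: embedding_map_def)
  then have "embedding_map W Y (h \<circ> e)" by (rule embedding_map_compose[OF e(1)])
  moreover have "e ` topspace W \<subseteq> topspace X"
    using e(1) unfolding embedding_map_def
    by (metis homeomorphic_imp_continuous_map continuous_map_in_subtopology continuous_map_image_subset_topspace)
  then have "Y closure_of ((h \<circ> e) ` topspace W) = h ` topspace X"
    unfolding image_comp[symmetric] by (subst homeomorphic_map_closure_of[OF h]) (simp_all add: e(2))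
  then have "Y closure_of ((h \<circ> e) ` topspace W) = topspace Y"
    using homeomorphic_imp_surjective_map[OF h] by simp
  moreover have "compact_space Y" "Hausdorff_space Y"
    using h X homeomorphic_compact_space homeomorphic_Hausdorff_space homeomorphic_map_imp_homeomorphic_space by blast+
  ultimately show ?thesis unfolding compactification_def by blast
qed

lemma metrizable_power_separating:
  fixes K :: "'a topology" and I :: "'i set"
  assumes met: "metrizable_space K" and sep: "separable_space K" and ne: "topspace K \<noteq> {}"
    and I: "countable I"
  obtains G :: "nat \<Rightarrow> ('i \<Rightarrow> 'a) \<Rightarrow> real" where
    "\<And>i. continuous_map (power_topology K I) euclideanreal (G i)" "\<And>i z. z \<in> topspace (power_topology K I) \<Longrightarrow> G i z \<in> {0..1}"
    "\<And>z z'. z \<in> topspace (power_topology K I) \<Longrightarrow> z' \<in> topspace (power_topology K I) \<Longrightarrow> z \<noteq> z' \<Longrightarrow> \<exists>i. G i z \<noteq> G i z'"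
proof -
  obtain M d where M: "Metric_space M d" and K: "K = Metric_space.mtopology M d"
    using met unfolding metrizable_space_def by blast
  interpret Metric_space M d by fact
  have tK: "topspace K = M" by (simp add: K)
  obtain s :: "nat \<Rightarrow> 'a" where s: "range s \<subseteq> topspace K" "\<And>U. openin K U \<Longrightarrow> U \<noteq> {} \<Longrightarrow> \<exists>u. s u \<in> U"
    using separable_dense_sequence[OF sep ne] by blast
  have sM: "s b \<in> M" for b using s(1) tK by auto
  have dc: "continuous_map K euclideanreal (\<lambda>x. d x (s b))" for b
    using continuous_map_mdist[of K "metric (M, d)" "\<lambda>x. x" "\<lambda>_. s b"] sM by (simp add: K)
  \<comment> \<open>Distances to a dense sequence, truncated at 1, one function for each coordinate
    and each term of the sequence. The value 0 is the default for empty \<open>I\<close>.\<close>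
  define G where "G i z = (case prod_decode i of (a, b) \<Rightarrow> if from_nat_into I a \<in> I then min 1 (d (z (from_nat_into I a)) (s b)) else 0)" for i z
  show ?thesis
  proof (rule that[of G])
    show "continuous_map (power_topology K I) euclideanreal (G i)" for i
    proof -
      obtain a b where ab: "prod_decode i = (a, b)" by (cases "prod_decode i")
      have "continuous_map (power_topology K I) euclideanreal (\<lambda>z. min 1 (d (z k) (s b)))" if "k \<in> I" for k
      proof (rule continuous_map_real_min)
        have "continuous_map (power_topology K I) K (\<lambda>z. z k)"
          unfolding power_topology_def using continuous_map_product_projection[OF that, of "\<lambda>_. K"] by simp
        from continuous_map_compose[OF this dc[of b]]
        show "continuous_map (power_topology K I) euclideanreal (\<lambda>z. d (z k) (s b))" by (simp add: o_def)
      qed simp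
      then show ?thesis by (cases "from_nat_into I a \<in> I") (simp_all add: G_def[abs_def] ab)
    qed
    show "G i z \<in> {0..1}" for i z by (auto simp: G_def split: prod.split)
    fix z z' assume z: "z \<in> topspace (power_topology K I)" "z' \<in> topspace (power_topology K I)" "z \<noteq> z'"
    then have "z \<in> I \<rightarrow>\<^sub>E topspace K" "z' \<in> I \<rightarrow>\<^sub>E topspace K" by (simp_all add: power_topology_def)
    then obtain k where k: "k \<in> I" "z k \<noteq> z' k" using z(3) PiE_ext by metis
    have zk: "z k \<in> M" "z' k \<in> M" using z k tK by (auto simp: power_topology_def)
    \<comment> \<open>Half the truncated distance: a term of the sequence closer than this to
      \<open>z k\<close> is at least this far from \<open>z' k\<close>, and truncation at 1 keeps
      the two values apart.\<close>
    define \<epsilon> where "\<epsilon> = min 1 (d (z k) (z' k)) / 2"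
    have \<epsilon>: "0 < \<epsilon>" using zk k by (simp add: \<epsilon>_def)
    then have "openin K (mball (z k) \<epsilon>)" "mball (z k) \<epsilon> \<noteq> {}" using zk centre_in_mball_iff[of "z k" \<epsilon>] by (auto simp: K)
    then obtain b where "s b \<in> mball (z k) \<epsilon>" using s(2) by blast
    then have b: "d (z k) (s b) < \<epsilon>" by simp
    have "d (z k) (z' k) \<le> d (z k) (s b) + d (z' k) (s b)"
      using triangle[of "z k" "s b" "z' k"] zk sM[of b] commute[of "s b" "z' k"] by simp
    then have "min 1 (d (z k) (s b)) \<noteq> min 1 (d (z' k) (s b))" using b \<epsilon> by (auto simp: \<epsilon>_def min_def split: if_splits)
    moreover obtain a where "from_nat_into I a = k" using from_nat_into_surj[OF I k(1)] by blast
    ultimately have "G (prod_encode (a, b)) z \<noteq> G (prod_encode (a, b)) z'" using k(1) by (simp add: G_def)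
    then show "\<exists>i. G i z \<noteq> G i z'" by blast
  qed
qed

section \<open>Matching the prescribed copies with the copies in the blocks\<close>

context block_system
begin

lemma card_Ix: "m \<in> P \<Longrightarrow> card (Ix m) = p m"
  by (simp add: Ix_def)

lemma inj_p: "inj_on p P"
proof (rule linorder_inj_onI)
  fix m k assume "m < k" "m \<in> P" "k \<in> P"
  then have "2 * p m dvd p k" "0 < p m" "0 < p k" using p_even p_pos by auto
  then have "2 * p m \<le> p k" using dvd_imp_le by blast
  then show "p m \<noteq> p k" using \<open>0 < p m\<close> by linarith
qed auto

text \<open>Here \<open>c m\<close> stands for the class of the partition containing
  \<open>p m\<close>. Block \<open>m\<close> supplies \<open>p m\<close> copies, so the blocks of
  class \<open>n\<close> together supply \<open>q n\<close> of them; in the infinite case both sides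
  are countably infinite. Since \<open>esum\<close> adds up a set, \<open>p\<close> has to be
  injective.\<close>

lemma copies_bijection:
  assumes c: "\<And>m. m \<in> P \<Longrightarrow> c m \<in> M" and q: "\<And>n. n \<in> M \<Longrightarrow> q n = esum (p ` {m \<in> P. c m = n})"
  shows "\<exists>\<gamma>. bij_betw \<gamma> {(n, j). n \<in> M \<and> enat j < q n} (Sigma P Ix) \<and>
    (\<forall>n j. n \<in> M \<longrightarrow> enat j < q n \<longrightarrow> c (fst (\<gamma> (n, j))) = n)"
proof -
  have "\<exists>g. bij_betw g {j. enat j < q n} (Sigma {m \<in> P. c m = n} Ix)" if n: "n \<in> M" for n
  proof -
    let ?P = "{m \<in> P. c m = n}"
    have inj: "inj_on p ?P" using inj_p by (rule inj_on_subset) auto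
    show ?thesis
    proof (cases "finite ?P")
      case True
      have "card (Sigma ?P Ix) = (\<Sum>m\<in>?P. card (Ix m))" using True by (intro card_SigmaI) (auto simp: Ix_def)
      also have "\<dots> = (\<Sum>m\<in>?P. p m)" by (intro sum.cong) (auto simp: card_Ix)
      also have "\<dots> = (\<Sum>k\<in>p ` ?P. k)" by (simp add: sum.reindex[OF inj])
      finally have "q n = enat (card (Sigma ?P Ix))" using True q[OF n] by (simp add: esum_def)
      then have "{j. enat j < q n} = {0..<card (Sigma ?P Ix)}" by auto
      moreover have "finite (Sigma ?P Ix)" using True by (auto simp: Ix_def)
      ultimately show ?thesis using ex_bij_betw_nat_finite by metis
    next
      case False
      then have "infinite (p ` ?P)" using inj finite_image_iff by blast
      then have "{j. enat j < q n} = UNIV" using q[OF n] by (auto simp: esum_def)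
      moreover have "?P \<subseteq> fst ` Sigma ?P Ix" using zero_in_Ix by force
      then have "infinite (Sigma ?P Ix)" using False finite_subset finite_imageI by blast
      moreover have "countable (Sigma ?P Ix)" by simp
      ultimately show ?thesis using bij_betw_from_nat_into by metis
    qed
  qed
  then have "\<exists>g. \<forall>n\<in>M. bij_betw (g n) {j. enat j < q n} (Sigma {m \<in> P. c m = n} Ix)"
    by (intro bchoice ballI)
  then obtain g where g: "\<And>n. n \<in> M \<Longrightarrow> bij_betw (g n) {j. enat j < q n} (Sigma {m \<in> P. c m = n} Ix)"
    by blast
  define \<gamma> where "\<gamma> = (\<lambda>(n, j). g n j)"
  have \<gamma>: "g n j \<in> Sigma P Ix \<and> c (fst (g n j)) = n" if "n \<in> M" "enat j < q n" for n j
    using bij_betwE[OF g[OF that(1)]] that(2) by force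
  show ?thesis
  proof (intro exI[of _ \<gamma>] conjI allI impI)
    show "c (fst (\<gamma> (n, j))) = n" if "n \<in> M" "enat j < q n" for n j using \<gamma>[OF that] by (simp add: \<gamma>_def)
    show "bij_betw \<gamma> {(n, j). n \<in> M \<and> enat j < q n} (Sigma P Ix)"
    proof (rule bij_betwI')
      fix u v assume "u \<in> {(n, j). n \<in> M \<and> enat j < q n}" "v \<in> {(n, j). n \<in> M \<and> enat j < q n}"
      then obtain n j n' j' where uv: "u = (n, j)" "v = (n', j')" "n \<in> M" "enat j < q n" "n' \<in> M" "enat j' < q n'" by auto
      show "\<gamma> u = \<gamma> v \<longleftrightarrow> u = v"
      proof
        assume eq: "\<gamma> u = \<gamma> v"
        then have "n = n'" using \<gamma>[OF uv(3,4)] \<gamma>[OF uv(5,6)] by (simp add: \<gamma>_def uv(1,2))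
        moreover from this have "j = j'"
          using eq bij_betw_imp_inj_on[OF g[OF uv(3)]] uv by (auto simp: \<gamma>_def inj_on_def)
        ultimately show "u = v" by (simp add: uv)
      qed simp
      show "\<gamma> u \<in> Sigma P Ix" using \<gamma>[OF uv(3,4)] by (simp add: \<gamma>_def uv(1))
    next
      fix w assume w: "w \<in> Sigma P Ix"
      then have n: "c (fst w) \<in> M" using c by auto
      have "w \<in> Sigma {m \<in> P. c m = c (fst w)} Ix" using w by auto
      then obtain j where "enat j < q (c (fst w))" "w = g (c (fst w)) j"
        using bij_betw_imp_surj_on[OF g[OF n]] by auto
      then show "\<exists>u\<in>{(n, j). n \<in> M \<and> enat j < q n}. w = \<gamma> u"
        using n by (intro bexI[of _ "(c (fst w), j)"]) (auto simp: \<gamma>_def)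
    qed
  qed
qed

text \<open>The copies of the sum go onto the copies in the blocks via \<open>\<gamma>\<close>, and
  the convergent sequence goes onto \<open>Seq\<close> and \<open>SeqLim\<close>. The image omits
  exactly the remainder and contains the dense orbits.\<close>

lemma compactification_X:
  assumes \<gamma>: "bij_betw \<gamma> {(n, j). n \<in> M \<and> enat j < q n} (Sigma P Ix)"
    and Z: "\<And>n j. n \<in> M \<Longrightarrow> enat j < q n \<Longrightarrow> Z n = Y (fst (\<gamma> (n, j)))"
  shows "compactification (plus_topology (sum_of_copies M q Z) convergent_sequence_space) X"
proof -
  let ?J = "{(n, j). n \<in> M \<and> enat j < q n}"
  let ?W = "plus_topology (sum_of_copies M q Z) convergent_sequence_space"
  have \<gamma>_in: "fst (\<gamma> (n, j)) \<in> P" "snd (\<gamma> (n, j)) \<in> Ix (fst (\<gamma> (n, j)))" if "n \<in> M" "enat j < q n" for n j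
    using bij_betwE[OF \<gamma>] that by force+
  define e where "e w = (case w of Inl v \<Rightarrow> Fib (fst (\<gamma> (fst v))) (snd (\<gamma> (fst v))) (snd v)
      | Inr None \<Rightarrow> SeqLim | Inr (Some n) \<Rightarrow> Seq n)"
    for w :: "((nat \<times> nat) \<times> 'y) + nat option"
  have e: "e (Inl (i, z)) = Fib (fst (\<gamma> i)) (snd (\<gamma> i)) z" "e (Inr None) = SeqLim" "e (Inr (Some n)) = Seq n" for i z n
    by (simp_all add: e_def)
  have tW: "Inl ((n, j), z) \<in> topspace ?W \<longleftrightarrow> n \<in> M \<and> enat j < q n \<and> z \<in> topspace (Z n)" "Inr v \<in> topspace ?W" for n j z v
    by (auto simp: sum_of_copies_def topspace_convergent_sequence_space)
  have eS: "e w \<in> S" if "w \<in> topspace ?W" for w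
  proof (cases w)
    case (Inl v)
    obtain n j z where v: "v = ((n, j), z)" by (metis prod.exhaust)
    then have "n \<in> M" "enat j < q n" "z \<in> topspace (Z n)" using that Inl tW(1) by auto
    then show ?thesis using \<gamma>_in Z by (simp add: Inl v e)
  next
    case (Inr v)
    then show ?thesis by (cases v) (auto simp: e)
  qed
  have openW: "openin ?W V \<longleftrightarrow> V \<subseteq> topspace ?W \<and> (\<forall>n j. n \<in> M \<and> enat j < q n \<longrightarrow> openin (Z n) {z. Inl ((n, j), z) \<in> V})
      \<and> (Inr None \<in> V \<longrightarrow> (\<exists>b. \<forall>n\<ge>b. Inr (Some n) \<in> V))" for V
    unfolding openin_plus_topology sum_of_copies_def openin_sum_topology openin_convergent_sequence_space
      topspace_plus_topology topspace_sum_topology by fastforce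
  have cont: "continuous_map ?W X e"
    unfolding continuous_map_def
  proof (intro conjI allI impI)
    show "e \<in> topspace ?W \<rightarrow> topspace X" using eS by simp
    fix U assume "openin X U"
    then have U: "opn U" by (simp add: openin_X)
    show "openin ?W {w \<in> topspace ?W. e w \<in> U}" unfolding openW
    proof (intro conjI allI impI)
      fix n j assume nj: "n \<in> M \<and> enat j < q n"
      then have g: "fst (\<gamma> (n, j)) \<in> P" "snd (\<gamma> (n, j)) \<in> Ix (fst (\<gamma> (n, j)))" using \<gamma>_in by auto
      have op: "openin (Z n) {z. Fib (fst (\<gamma> (n, j))) (snd (\<gamma> (n, j))) z \<in> U}"
        using opn_fib[OF U g] Z[of n j] nj by simp
      have "{z. Inl ((n, j), z) \<in> {w \<in> topspace ?W. e w \<in> U}} = {z. Fib (fst (\<gamma> (n, j))) (snd (\<gamma> (n, j))) z \<in> U}"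
        using openin_subset[OF op] nj tW(1)[of n j] by (auto simp: e)
      then show "openin (Z n) {z. Inl ((n, j), z) \<in> {w \<in> topspace ?W. e w \<in> U}}" using op by simp
    next
      assume "Inr None \<in> {w \<in> topspace ?W. e w \<in> U}"
      then show "\<exists>b. \<forall>n\<ge>b. Inr (Some n) \<in> {w \<in> topspace ?W. e w \<in> U}"
        using opn_SeqLim[OF U] tW(2) by (simp add: e)
    qed auto
  qed
  have inj: "inj_on e (topspace ?W)"
  proof (rule inj_onI)
    fix w w' assume w: "w \<in> topspace ?W" "w' \<in> topspace ?W" "e w = e w'"
    show "w = w'"
    proof (cases w; cases w')
      fix v v' assume ww: "w = Inl v" "w' = Inl v'"
      obtain n j z n' j' z' where v: "v = ((n, j), z)" "v' = ((n', j'), z')" by (metis prod.exhaust)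
      have "\<gamma> (n, j) = \<gamma> (n', j')" "z = z'" using w(3) by (simp_all add: ww v e prod_eq_iff)
      moreover have "(n, j) \<in> ?J" "(n', j') \<in> ?J" using w(1,2) ww v tW(1) by auto
      ultimately show ?thesis using \<gamma> by (auto simp: ww v bij_betw_def inj_on_def)
    next
      fix v v' assume ww: "w = Inl v" "w' = Inr v'"
      then show ?thesis using w(3) by (cases v; cases v') (auto simp: e)
    next
      fix v v' assume ww: "w = Inr v" "w' = Inl v'"
      then show ?thesis using w(3) by (cases v; cases v') (auto simp: e)
    next
      fix v v' assume ww: "w = Inr v" "w' = Inr v'"
      then show ?thesis using w(3) by (cases v; cases v') (auto simp: e)
    qed
  qed
  have onto: "\<exists>n j. n \<in> M \<and> enat j < q n \<and> \<gamma> (n, j) = (m, k)" if "m \<in> P" "k \<in> Ix m" for m k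
    using bij_betw_imp_surj_on[OF \<gamma>] that by (smt (verit, best) SigmaI case_prodE imageE mem_Collect_eq)
  have "open_map ?W X e"
    unfolding open_map_def
  proof (intro allI impI)
    fix V assume V: "openin ?W V"
    have VW: "V \<subseteq> topspace ?W" by (rule openin_subset[OF V])
    have mem: "e w \<in> e ` V \<longleftrightarrow> w \<in> V" if "w \<in> topspace ?W" for w
      using inj VW that by (meson imageI inj_on_image_mem_iff)
    \<comment> \<open>Images never reach the remainder, so the conditions of \<open>opn\<close> at
      \<open>Rem\<close> and \<open>RemLim\<close> hold vacuously for them.\<close>
    have noRem: "Rem k \<notin> e ` V" "RemLim \<notin> e ` V" for k
      by (auto simp: e_def split: sum.splits option.splits)
    have VS: "e ` V \<subseteq> S" using VW eS by (meson image_subsetI subsetD)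
    have "opn (e ` V)" unfolding opn_def
    proof (intro conjI ballI allI impI)
      show "e ` V \<subseteq> S" by (rule VS)
      fix m k assume mk: "m \<in> P" "k \<in> Ix m"
      obtain n j where nj: "n \<in> M" "enat j < q n" "\<gamma> (n, j) = (m, k)" using onto[OF mk] by blast
      have ZY: "Z n = Y m" using Z[OF nj(1,2)] nj(3) by simp
      have "Fib m k z \<in> e ` V \<longleftrightarrow> Inl ((n, j), z) \<in> V" for z
      proof
        assume "Inl ((n, j), z) \<in> V"
        then show "Fib m k z \<in> e ` V" using nj(3) by (intro image_eqI[of _ _ "Inl ((n, j), z)"]) (simp_all add: e)
      next
        assume f: "Fib m k z \<in> e ` V"
        then have "Fib m k z \<in> S" by (rule subsetD[OF VS])
        then have "Inl ((n, j), z) \<in> topspace ?W" using nj ZY unfolding tW(1) by simp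
        then show "Inl ((n, j), z) \<in> V" using mem[of "Inl ((n, j), z)"] f nj(3) by (simp add: e)
      qed
      moreover have "openin (Z n) {z. Inl ((n, j), z) \<in> V}" using V nj unfolding openW by blast
      ultimately show "openin (Y m) {z. Fib m k z \<in> e ` V}" by (simp add: ZY)
    next
      assume "SeqLim \<in> e ` V"
      then have "Inr None \<in> V" using mem[OF tW(2), of None] by (simp add: e)
      then obtain b where "\<forall>n\<ge>b. Inr (Some n) \<in> V" using V unfolding openW by blast
      then show "\<exists>b. \<forall>n\<ge>b. Seq n \<in> e ` V" by (intro exI[of _ b]) (force simp: e intro: image_eqI[of _ _ "Inr (Some _)"])
    qed (use noRem in blast)+
    then show "openin X (e ` V)" by (simp add: openin_X)
  qed
  then have emb: "embedding_map ?W X e" using cont inj injective_open_imp_embedding_map by blast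
  have "range (\<lambda>n. (\<psi> ^^ n) (Seq 0)) \<union> (\<Union>m\<in>P. range (\<lambda>n. (\<psi> ^^ n) (base m))) \<subseteq> e ` topspace ?W"
  proof -
    have "Seq n \<in> e ` topspace ?W" for n
      by (rule image_eqI[OF _ tW(2)[of "Some n"]]) (simp add: e)
    moreover have "(\<psi> ^^ i) (base m) \<in> e ` topspace ?W" if m: "m \<in> P" for m i
    proof -
      let ?k = "wrap m (- int i)" and ?z = "(\<theta> m ^^ i) (y m)"
      have z: "?z \<in> topspace (Y m)" using y_in[OF m] by (induction i) (simp_all add: m)
      obtain n j where nj: "n \<in> M" "enat j < q n" "\<gamma> (n, j) = (m, ?k)" using onto[OF m wrap_in[OF m]] by blast
      have "Z n = Y m" using Z[OF nj(1,2)] nj(3) by simp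
      then have "Inl ((n, j), ?z) \<in> topspace ?W" using nj z unfolding tW(1) by simp
      then show ?thesis
        unfolding \<psi>_pow_base[OF m] by (intro image_eqI[of _ _ "Inl ((n, j), ?z)"]) (simp_all add: e nj(3))
    qed
    ultimately show ?thesis by (auto simp: \<psi>_pow_Seq)
  qed
  then have "topspace X \<subseteq> X closure_of (e ` topspace ?W)"
    using closure_of_mono dense_orbits by metis
  then have "X closure_of (e ` topspace ?W) = topspace X"
    using closure_of_subset_topspace by (metis subset_antisym)
  then show ?thesis unfolding compactification_def using compact_X Hausdorff_X emb by blast
qed

end

section \<open>Arithmetic of compatible sequences\<close>

lemma compatible_sequence_divides:
  assumes P: "initial_subset P" and p: "compatible P p"
  shows "\<lbrakk>m \<in> P; k \<in> P; m < k\<rbrakk> \<Longrightarrow> 2 * p m dvd p k"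
proof (induction k)
  case (Suc k)
  have P_def: "0 \<notin> P" "\<forall>n\<in>P. 2 \<le> n \<longrightarrow> n - 1 \<in> P" using P by (auto simp: initial_subset_def)
  have k0: "k \<noteq> 0" using Suc.prems P_def by (metis less_Suc0)
  then have k: "k \<in> P" using bspec[OF P_def(2) Suc.prems(2)] by simp
  \<comment> \<open>\<open>P\<close> contains a number above 1, so the clause of
    \<open>compatible\<close> on even multiples applies.\<close>
  then have "P \<noteq> {1}" using Suc.prems(2) k0 by auto
  then have "\<forall>n. n \<in> P \<and> n + 1 \<in> P \<longrightarrow> (\<exists>l\<ge>1. p (n + 1) = 2 * l * p n)"
    using p by (simp add: compatible_def)
  then have "\<exists>l\<ge>1. p (k + 1) = 2 * l * p k" using k Suc.prems(2) by simp
  then obtain l where l: "p (k + 1) = 2 * l * p k" by blast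
  show ?case
  proof (cases "m = k")
    case True
    then show ?thesis using l by (simp add: mult.assoc)
  next
    case False
    then have "2 * p m dvd p k" using Suc.IH Suc.prems k by simp
    then show ?thesis using l by simp
  qed
qed simp

text \<open>Each step at least doubles the term. Hence the blocks grow and every index eventually
  occurs in them.\<close>

lemma compatible_sequence_ge:
  assumes P: "initial_subset P" and p: "compatible P p"
  shows "m \<in> P \<Longrightarrow> m \<le> p m"
proof (induction m)
  case (Suc m)
  show ?case
  proof (cases "m = 0")
    case True
    then show ?thesis using p Suc.prems by (auto simp: compatible_def)
  next
    case False
    then have m: "m \<in> P" using P Suc.prems by (force simp: initial_subset_def)
    have "2 * p m dvd p (Suc m)" using compatible_sequence_divides[OF P p m Suc.prems] by simp
    moreover have "0 < p (Suc m)" using p Suc.prems by (force simp: compatible_def)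
    ultimately have "2 * p m \<le> p (Suc m)" by (rule dvd_imp_le)
    then show ?thesis using Suc.IH[OF m] False by linarith
  qed
qed simp

theorem theorem4p6:
  fixes M P :: "nat set"
    and p :: "nat \<Rightarrow> nat"
    and A :: "nat \<Rightarrow> nat set"
    and q :: "nat \<Rightarrow> enat"
    and K :: "nat \<Rightarrow> 'a topology"
    and \<kappa> :: "nat \<Rightarrow> 'i set"
    and N :: enat
    and W :: "(((nat \<times> nat) \<times> ('i \<Rightarrow> 'a)) + nat option) topology"
  assumes "initial_subset M" and "initial_subset P" and "M \<subseteq> P"
    and "compatible P p"
    and "indexed_partition M A (p ` P)"
    and "\<And>n. n \<in> M \<Longrightarrow> q n = esum (A n)"
    and "\<And>n. n \<in> M \<Longrightarrow> separable_space (K n) \<and> compact_space (K n) \<and> Hausdorff_space (K n) \<and>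
            topspace (K n) \<noteq> {}"
    and "\<And>n. n \<in> M \<Longrightarrow> (UNIV :: nat set) \<lesssim> \<kappa> n \<and> \<kappa> n \<lesssim> (UNIV :: real set)"
    and "\<And>n k. n \<in> M \<Longrightarrow> k \<in> M \<Longrightarrow> n \<noteq> k \<Longrightarrow>
            \<not> power_topology (K n) (\<kappa> n) homeomorphic_space power_topology (K k) (\<kappa> k)"
    and "N = ecard P"
    and "W = plus_topology (sum_of_copies M q (\<lambda>n. power_topology (K n) (\<kappa> n)))
               convergent_sequence_space"
  shows
    "(\<exists>X :: point topology. compactification W X \<and> admits_generated_I0_shift TYPE(real) X N) \<and>
     (\<exists>X :: point topology. compactification W X \<and> admits_generated_I0_shift TYPE(complex) X N) \<and>
     ((\<forall>n\<in>M. metrizable_space (K n) \<and> \<kappa> n \<approx> (UNIV :: nat set)) \<longrightarrow>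
        (\<exists>S \<subseteq> ell2. compactification W (subtopology ell2_topology S) \<and>
           admits_generated_I0_shift TYPE(real) (subtopology ell2_topology S) N) \<and>
        (\<exists>S \<subseteq> ell2. compactification W (subtopology ell2_topology S) \<and>
           admits_generated_I0_shift TYPE(complex) (subtopology ell2_topology S) N))"
proof -
  note P = assms(2) and comp = assms(4) and part = assms(5) and q = assms(6) and K = assms(7) and \<kappa> = assms(8)
  have "\<forall>m\<in>P. \<exists>n. n \<in> M \<and> p m \<in> A n"
    using part by (auto simp: indexed_partition_def)
  \<comment> \<open>\<open>c m\<close> is the class that contains \<open>p m\<close>; block
    \<open>m\<close> is built from the power belonging to this class.\<close>
  then obtain c where c: "\<And>m. m \<in> P \<Longrightarrow> c m \<in> M \<and> p m \<in> A (c m)" by metis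
  have A: "p ` {m \<in> P. c m = n} = A n" if n: "n \<in> M" for n
  proof
    show "p ` {m \<in> P. c m = n} \<subseteq> A n" using c by auto
    show "A n \<subseteq> p ` {m \<in> P. c m = n}"
    proof
      fix a assume a: "a \<in> A n"
      then have "a \<in> p ` P" using part n by (auto simp: indexed_partition_def)
      then obtain m where m: "m \<in> P" "a = p m" by blast
      then have "a \<in> A (c m) \<inter> A n" using c a by simp
      then have "c m = n" using part c[OF m(1)] n by (auto simp: indexed_partition_def disjoint_family_on_def)
      then show "a \<in> p ` {m \<in> P. c m = n}" using m by auto
    qed
  qed
  let ?Y = "\<lambda>m. power_topology (K (c m)) (\<kappa> (c m))"
  have Kc: "separable_space (K (c m)) \<and> topspace (K (c m)) \<noteq> {}"
    and \<kappa>c: "(UNIV :: nat set) \<lesssim> \<kappa> (c m) \<and> \<kappa> (c m) \<lesssim> (UNIV :: real set)" if "m \<in> P" for m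
    using K \<kappa> c[OF that] by simp_all
  obtain \<theta> \<theta>' y where \<theta>: "\<forall>m\<in>P. homeomorphic_maps (?Y m) (?Y m) (\<theta> m) (\<theta>' m)"
    and y: "\<forall>m\<in>P. y m \<in> topspace (?Y m)"
    and gen: "\<forall>F V B L r. finite F \<and> F \<subseteq> P \<and> 0 < L \<and> (\<forall>m\<in>F. openin (?Y m) (V m) \<and> V m \<noteq> {}) \<longrightarrow>
       (\<exists>n\<ge>B. n mod L = r mod L \<and> (\<forall>m\<in>F. (\<theta> m ^^ n) (y m) \<in> V m))"
    using jointly_generic_points[of P "\<lambda>m. K (c m)" "\<lambda>m. \<kappa> (c m)"] Kc \<kappa>c by auto
  interpret block_system P p ?Y \<theta> \<theta>' y
  proof
    show "P \<noteq> {}" "0 \<notin> P" using P by (auto simp: initial_subset_def)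
    show "0 < p m" if "m \<in> P" for m using comp that by (force simp: compatible_def)
    show "m \<le> p m" if "m \<in> P" for m by (rule compatible_sequence_ge[OF P comp that])
    show "2 * p m dvd p k" if "m \<in> P" "k \<in> P" "m < k" for m k
      by (rule compatible_sequence_divides[OF P comp that])
    show "compact_space (?Y m)" "Hausdorff_space (?Y m)" if "m \<in> P" for m
      using K c[OF that] unfolding power_topology_def
      by (auto simp: compact_space_product_topology Hausdorff_space_product_topology)
    show "homeomorphic_maps (?Y m) (?Y m) (\<theta> m) (\<theta>' m)" "y m \<in> topspace (?Y m)" if "m \<in> P" for m
      using \<theta> y that by simp_all
    show "\<exists>n\<ge>B. n mod L = r mod L \<and> (\<forall>m\<in>F. (\<theta> m ^^ n) (y m) \<in> V m)"
      if "finite F" "F \<subseteq> P" "0 < L" "\<And>m. m \<in> F \<Longrightarrow> openin (?Y m) (V m) \<and> V m \<noteq> {}" for F V B L r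
      using gen that by simp
  qed
  have "\<exists>\<gamma>. bij_betw \<gamma> {(n, j). n \<in> M \<and> enat j < q n} (Sigma P Ix) \<and>
    (\<forall>n j. n \<in> M \<longrightarrow> enat j < q n \<longrightarrow> c (fst (\<gamma> (n, j))) = n)"
    by (rule copies_bijection) (simp_all add: c q A)
  then obtain \<gamma> where \<gamma>: "bij_betw \<gamma> {(n, j). n \<in> M \<and> enat j < q n} (Sigma P Ix)"
    "\<forall>n j. n \<in> M \<longrightarrow> enat j < q n \<longrightarrow> c (fst (\<gamma> (n, j))) = n"
    by (elim exE conjE)
  have W: "compactification W X"
    unfolding assms(11) by (rule compactification_X[OF \<gamma>(1)]) (simp add: \<gamma>(2))
  \<comment> \<open>Left open in the scalar field and in the target space, this fact yields the real
    and the complex case on both carriers.\<close>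
  have shift: "admits_generated_I0_shift TYPE('k::{real_normed_field,banach}) X' N"
    if "homeomorphic_maps X X' h g" for X' :: "'x topology" and h g
    unfolding assms(10)
    by (rule shift_model.admits_generated_shift[OF shift_model_homeomorphic[OF block_shift_model that] P])
  \<comment> \<open>The orbits form a countable dense set, as the coding of points by sets of sets
    of naturals requires.\<close>
  have "countable (range (\<lambda>n. (\<psi> ^^ n) (Seq 0)) \<union> (\<Union>m\<in>P. range (\<lambda>n. (\<psi> ^^ n) (base m))))"
    by auto
  then obtain X' :: "point topology" and h g where X': "homeomorphic_maps X X' h g"
    using separable_Hausdorff_imp_point_copy[OF Hausdorff_X _ dense_orbits] by blast
  have ell: "\<exists>S h g. S \<subseteq> ell2 \<and> homeomorphic_maps X (subtopology ell2_topology S) h g"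
    if met: "\<forall>n\<in>M. metrizable_space (K n) \<and> \<kappa> n \<approx> (UNIV :: nat set)"
  proof -
    \<comment> \<open>A metric on the factor and a countable exponent provide countably many
      separating functions on each power; they are chosen for all blocks at once.\<close>
    have "\<forall>m\<in>P. \<exists>G :: nat \<Rightarrow> ('i \<Rightarrow> 'a) \<Rightarrow> real. (\<forall>i. continuous_map (?Y m) euclideanreal (G i)) \<and>
      (\<forall>i. \<forall>z\<in>topspace (?Y m). G i z \<in> {0..1}) \<and>
      (\<forall>z\<in>topspace (?Y m). \<forall>z'\<in>topspace (?Y m). z \<noteq> z' \<longrightarrow> (\<exists>i. G i z \<noteq> G i z'))"
    proof
      fix m assume "m \<in> P"
      then have m: "c m \<in> M" using c by blast
      then have "countable (\<kappa> (c m))" using met countable_eqpoll[of "UNIV :: nat set"] by auto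
      then obtain G :: "nat \<Rightarrow> ('i \<Rightarrow> 'a) \<Rightarrow> real" where
        "\<And>i. continuous_map (?Y m) euclideanreal (G i)" "\<And>i z. z \<in> topspace (?Y m) \<Longrightarrow> G i z \<in> {0..1}"
        "\<And>z z'. z \<in> topspace (?Y m) \<Longrightarrow> z' \<in> topspace (?Y m) \<Longrightarrow> z \<noteq> z' \<Longrightarrow> \<exists>i. G i z \<noteq> G i z'"
        using metrizable_power_separating[of "K (c m)" "\<kappa> (c m)"] met K m by blast
      then show "\<exists>G :: nat \<Rightarrow> ('i \<Rightarrow> 'a) \<Rightarrow> real. (\<forall>i. continuous_map (?Y m) euclideanreal (G i)) \<and>
        (\<forall>i. \<forall>z\<in>topspace (?Y m). G i z \<in> {0..1}) \<and>
        (\<forall>z\<in>topspace (?Y m). \<forall>z'\<in>topspace (?Y m). z \<noteq> z' \<longrightarrow> (\<exists>i. G i z \<noteq> G i z'))"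
        by (intro exI[of _ G]) blast
    qed
    then obtain G :: "nat \<Rightarrow> nat \<Rightarrow> ('i \<Rightarrow> 'a) \<Rightarrow> real" where G: "\<forall>m\<in>P. (\<forall>i. continuous_map (?Y m) euclideanreal (G m i)) \<and>
      (\<forall>i. \<forall>z\<in>topspace (?Y m). G m i z \<in> {0..1}) \<and>
      (\<forall>z\<in>topspace (?Y m). \<forall>z'\<in>topspace (?Y m). z \<noteq> z' \<longrightarrow> (\<exists>i. G m i z \<noteq> G m i z'))"
      by (rule bchoice[THEN exE])
    have "\<exists>F :: nat \<Rightarrow> ('i \<Rightarrow> 'a) block_point \<Rightarrow> real. (\<forall>i. continuous_map X euclideanreal (F i)) \<and>
      (\<forall>i. \<forall>w\<in>topspace X. F i w \<in> {0..1}) \<and>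
      (\<forall>w\<in>topspace X. \<forall>w'\<in>topspace X. w \<noteq> w' \<longrightarrow> (\<exists>i. F i w \<noteq> F i w'))"
      by (rule countable_separating_functions[of G]) (use G in simp_all)
    then obtain F :: "nat \<Rightarrow> ('i \<Rightarrow> 'a) block_point \<Rightarrow> real" where F: "\<forall>i. continuous_map X euclideanreal (F i)"
      "\<forall>i. \<forall>w\<in>topspace X. F i w \<in> {0..1}"
      "\<forall>w\<in>topspace X. \<forall>w'\<in>topspace X. w \<noteq> w' \<longrightarrow> (\<exists>i. F i w \<noteq> F i w')"
      by (elim exE conjE)
    obtain S h g where "S \<subseteq> ell2" "homeomorphic_maps X (subtopology ell2_topology S) h g"
      by (rule separated_imp_ell2_copy[OF compact_X, of F]) (use F in simp_all)
    then show ?thesis by blast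
  qed
  show ?thesis
  proof (intro conjI impI)
    show "\<exists>X :: point topology. compactification W X \<and> admits_generated_I0_shift TYPE(real) X N"
      "\<exists>X :: point topology. compactification W X \<and> admits_generated_I0_shift TYPE(complex) X N"
      by (intro exI[of _ X'] conjI compactification_homeomorphic[OF W X'] shift[OF X'])+
    assume "\<forall>n\<in>M. metrizable_space (K n) \<and> \<kappa> n \<approx> (UNIV :: nat set)"
    then obtain S h g where S: "S \<subseteq> ell2" and h: "homeomorphic_maps X (subtopology ell2_topology S) h g"
      using ell by (elim meta_impE exE conjE)
    show "\<exists>S \<subseteq> ell2. compactification W (subtopology ell2_topology S) \<and>
           admits_generated_I0_shift TYPE(real) (subtopology ell2_topology S) N"
      "\<exists>S \<subseteq> ell2. compactification W (subtopology ell2_topology S) \<and>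
           admits_generated_I0_shift TYPE(complex) (subtopology ell2_topology S) N"
      by (intro exI[of _ S] conjI S compactification_homeomorphic[OF W h] shift[OF h])+
  qed
qed

end
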